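(* Let $q$ be a power of the prime $p$ and let $\ell,m\in\mathbb{Z}$ with $\ell\geq 0$, $m\geq 1$ and $\gcd(m,p)=1$. If $n=p^{\ell}m$ and $m<q$, then there exists an element $x\in\mathbb{F}_{q^n}$ that is simultaneously primitive and completely normal over $\mathbb{F}_q$.
   Context: $\mathbb{F}_q$ denotes the finite field with $q$ elements and $\mathbb{F}_{q^n}$ its extension of degree $n$. An element of $\mathbb{F}_{q^n}$ is called primitive if it generates the multiplicative group $\mathbb{F}_{q^n}^*$. For a positive divisor $l$ of $n$, an element $x\in\mathbb{F}_{q^n}$ is called normal over $\mathbb{F}_{q^l}$ if $\{x, x^{q^l}, x^{q^{2l}},\ldots,x^{q^{l(n/l-1)}}\}$ is an $\mathbb{F}_{q^l}$-basis of $\mathbb{F}_{q^n}$. An element of $\mathbb{F}_{q^n}$ is called completely normal over $\mathbb{F}_q$ if it is normal over $\mathbb{F}_{q^l}$ for all positive divisors $l$ of $n$. *)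

theory Defs
  imports "HOL-Algebra.Algebra" "HOL-Computational_Algebra.Primes"
begin

definition is_basis :: "('a, 'b) ring_scheme \<Rightarrow> 'a set \<Rightarrow> 'a list \<Rightarrow> bool"
  where "is_basis R K Us \<longleftrightarrow> ring.independent R K Us \<and> ring.Span R K Us = carrier R"

definition primitive_element :: "('a, 'b) ring_scheme \<Rightarrow> 'a \<Rightarrow> bool"
  where "primitive_element R x \<longleftrightarrow>
    x \<in> carrier (mult_of R) \<and> generate (mult_of R) {x} = carrier (mult_of R)"

text \<open>
  In the following two definitions, \<open>R\<close> is meant to be a field with \<open>q ^ n\<close> elements.
  For \<open>l dvd n\<close>, the field with \<open>q ^ l\<close> elements is then the unique subfield of \<open>R\<close> of that
  cardinality. It is introduced existentially, so that normality could not hold vacuously.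
\<close>

definition normal_over ::
    "('a, 'b) ring_scheme \<Rightarrow> nat \<Rightarrow> nat \<Rightarrow> nat \<Rightarrow> 'a \<Rightarrow> bool"
  where "normal_over R q n l x \<longleftrightarrow>
    x \<in> carrier R \<and>
    (\<exists>K. subfield K R \<and> card K = q ^ l \<and>
         is_basis R K (map (\<lambda>i. x [^]\<^bsub>R\<^esub> (q ^ (l * i))) [0..<n div l]))"

definition completely_normal :: "('a, 'b) ring_scheme \<Rightarrow> nat \<Rightarrow> nat \<Rightarrow> 'a \<Rightarrow> bool"
  where "completely_normal R q n x \<longleftrightarrow> (\<forall>l. 0 < l \<and> l dvd n \<longrightarrow> normal_over R q n l x)"

end

(* Let Q = q^n. A relation between the conjugates of x over the field with q^d elements generates,
after extension of scalars to an algebraic closure, a module over the shift operator in which an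
eigenvector exists; hence x satisfies sum_i w^i x^(q^(d i)) = 0 for some w with w^(n/d) = 1. The
elements that are not completely normal therefore lie in a union of few additive subgroups, namely
at most m/gcd(d,m) of them of size at most q^(n-d) for every d dividing n, and d = 1 suffices if m
divides q - 1. As m < q, these subgroups do not cover R.

For a nontrivial multiplicative character chi and an additive subgroup V, averaging over the
translates of V gives |sum_(v in V) chi v|^2 <= Q - |V|. So V contains about the expected number of
elements that are no r-th powers, for r in a given set of primes. Multiplication by elements whose
(q-1)-st power lies in the ground field preserves complete normality, so that only the primes
dividing M = (q^n-1)/((q-1) gcd(n,q-1)) matter. The union bound over the subgroups succeeds as soon
as their number times 2^omega(M) is small compared to sqrt(Q), and 16^omega(M) <= 559 M settles all
but some thirty pairs (q,n). These are treated by factoring M, except for (5,4), where the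
completely normal elements have to be counted exactly. *)

theory Submission
  imports Defs Complex_Main
begin

section \<open>Characters of finite fields and additive subgroups\<close>

text \<open>Complete normality is a condition over every intermediate field at once. Only an upper
  bound for the set of failures is needed, so it is enough to cover this set by additive subgroups,
  and the character sums then involve nothing but subgroups. Averaging over translates replaces
  Gauss sums and additive characters, and its bound depends on no further structure of V.

  The part p^l of n contributes no roots of unity, because z^(p^l) = 1 forces z = 1 in
  characteristic p; this is why m/gcd(d,m) occurs instead of n/d.

  The number (q-1) gcd(n,q-1) is the order of the group of all y with y^((q-1)^2) = 1, that is, with
  y^(q-1) in the ground field.

  The base 16 is 2^4: the bound 2^omega(M) <= (559 M)^(1/4) leaves a factor of about Q^(1/4) of
  sqrt(Q) for the number of subgroups. The base 4 would leave only sqrt((q-1) gcd(n,q-1)), up to a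
  constant, and a larger base would bring in more small primes and a worse constant.

  In the explicit pairs a prime r costs either a factor 2 in the error term or the fraction 1/r in a
  union bound, so the smaller primes go to the characters and the larger ones to the union
  bound.\<close>

lemma (in domain) nat_pow_nonzero: "a \<in> carrier R \<Longrightarrow> a \<noteq> \<zero> \<Longrightarrow> a [^] (k::nat) \<noteq> \<zero>"
  by (induction k) (auto simp: integral_iff)

lemma (in cring) inv_unit_quotient:
  assumes "u \<in> Units R" "w \<in> Units R"
  shows "inv (u \<otimes> inv w) = w \<otimes> inv u"
proof (rule comm_inv_char)
  have "u \<otimes> inv w \<otimes> (w \<otimes> inv u) = u \<otimes> (inv w \<otimes> w) \<otimes> inv u"
    using assms by (simp only: m_assoc Units_closed Units_inv_closed m_closed)
  then show "u \<otimes> inv w \<otimes> (w \<otimes> inv u) = \<one>" using assms by (simp add: Units_closed)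
qed (use assms in auto)

section \<open>Discrete logarithms and multiplicative characters\<close>

locale finite_field_gen = field R for R (structure) +
  fixes g
  assumes fin: "finite (carrier R)"
    and g_carrier: "g \<in> carrier R" and g_nonzero: "g \<noteq> \<zero>"
    and g_generates: "carrier R - {\<zero>} = {g [^] i | i::nat. i \<in> UNIV}"
begin

definition N :: nat where "N = card (carrier R) - 1"

definition ind :: "'a \<Rightarrow> nat" where "ind x = (LEAST i. g [^] i = x)"

lemma card_carrier_ge_2: "card (carrier R) \<ge> 2"
proof -
  have "card {\<zero>, \<one>} \<le> card (carrier R)" by (rule card_mono[OF fin]) auto
  then show ?thesis by simp
qed

lemma card_carrier: "card (carrier R) = N + 1" and N_pos: "N > 0"
  using card_carrier_ge_2 by (auto simp: N_def)

lemma card_nonzero: "card (carrier R - {\<zero>}) = N"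
  using fin by (simp add: N_def card_Diff_singleton)

lemma g_pow_carrier [simp, intro]: "g [^] (i::nat) \<in> carrier R"
  using g_carrier by simp

lemma g_pow_nonzero [simp]: "g [^] (i::nat) \<noteq> \<zero>"
  using g_carrier g_nonzero by (rule nat_pow_nonzero)

lemma g_pow_ind: "x \<in> carrier R \<Longrightarrow> x \<noteq> \<zero> \<Longrightarrow> g [^] ind x = x"
proof -
  assume "x \<in> carrier R" "x \<noteq> \<zero>"
  then have "x \<in> {g [^] i | i::nat. i \<in> UNIV}" using g_generates by (metis Diff_iff singletonD)
  then show ?thesis unfolding ind_def by (auto intro: LeastI)
qed

lemma g_pow_eq_iff: "g [^] (i::nat) = g [^] j \<longleftrightarrow> i mod N = j mod N"
proof -
  interpret G: group "Multiplicative_Group.mult_of R" by (rule field_mult_group)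
  have gG: "g \<in> carrier (Multiplicative_Group.mult_of R)" using g_carrier g_nonzero by simp
  have finG: "finite (carrier (Multiplicative_Group.mult_of R))" using fin by simp
  have "generate (Multiplicative_Group.mult_of R) {g} = {g [^]\<^bsub>Multiplicative_Group.mult_of R\<^esub> k | k::nat. k \<in> UNIV}"
    using G.generate_pow_on_finite_carrier[OF finG gG] by simp
  also have "\<dots> = carrier (Multiplicative_Group.mult_of R)"
    unfolding Multiplicative_Group.nat_pow_mult_of g_generates[symmetric] by simp
  finally have "generate (Multiplicative_Group.mult_of R) {g} = carrier (Multiplicative_Group.mult_of R)" .
  then have ord: "G.ord g = N"
    using G.generate_pow_card[OF gG] card_nonzero by simp
  show ?thesis
  proof (induction i j rule: linorder_wlog)
    case (le i j)
    have "g [^] i = g [^] j \<longleftrightarrow> g [^] i \<otimes> \<one> = g [^] i \<otimes> g [^] (j - i)"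
      using le g_carrier by (simp add: nat_pow_mult)
    also have "\<dots> \<longleftrightarrow> g [^] (j - i) = \<one>"
      using g_carrier m_lcancel[of "g [^] i" "\<one>" "g [^] (j - i)"] by auto
    also have "\<dots> \<longleftrightarrow> N dvd (j - i)"
      using G.pow_eq_id[OF gG, of "j - i"] ord by (simp add: Multiplicative_Group.nat_pow_mult_of)
    also have "\<dots> \<longleftrightarrow> i mod N = j mod N"
      using le mod_eq_dvd_iff_nat[of i j N] by auto
    finally show ?case .
  qed auto
qed

lemma ind_less: "x \<in> carrier R \<Longrightarrow> x \<noteq> \<zero> \<Longrightarrow> ind x < N"
proof -
  assume x: "x \<in> carrier R" "x \<noteq> \<zero>"
  have "g [^] (ind x mod N) = x"
    using g_pow_ind[OF x] g_pow_eq_iff[of "ind x mod N" "ind x"] by simp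
  then have "ind x \<le> ind x mod N" unfolding ind_def by (rule Least_le)
  then show ?thesis using N_pos by (meson le_less_trans mod_less_divisor)
qed

lemma ind_g_pow: "ind (g [^] (i::nat)) = i mod N"
  by (metis g_pow_ind g_pow_eq_iff g_pow_carrier g_pow_nonzero ind_less mod_less)

lemma bij_betw_g_pow: "bij_betw (\<lambda>i. g [^] i) {..<N} (carrier R - {\<zero>})"
  by (rule bij_betwI[where g = ind]) (auto simp: ind_less ind_g_pow g_pow_ind)

text \<open>These are all characters of the multiplicative group, read off the discrete logarithm.
  The value at zero is 0 even for j = 0, which makes \<open>chi_mult\<close> valid on the whole
  field; \<open>ind\<close> is unspecified at zero.\<close>

definition chi :: "nat \<Rightarrow> 'a \<Rightarrow> complex" where
  "chi j x = (if x = \<zero> then 0 else cis (2 * pi * real j * real (ind x) / real N))"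

lemma cis_mod_N: "cis (2 * pi * real j * real (i mod N) / real N) = cis (2 * pi * real j * real i / real N)"
proof -
  define r k where "r = i mod N" and "k = i div N"
  have i: "i = r + N * k" by (simp add: r_def k_def)
  have "2 * pi * real j * real i / real N = 2 * pi * real j * real r / real N + 2 * pi * real (j * k)"
    unfolding i using N_pos by (simp add: field_simps)
  moreover have "cis (2 * pi * real (j * k)) = 1"
    by (rule cis_multiple_2pi) simp
  ultimately have "cis (2 * pi * real j * real i / real N) = cis (2 * pi * real j * real r / real N)"
    by (metis cis_mult mult.right_neutral)
  then show ?thesis by (simp add: r_def)
qed

lemma chi_g_pow: "chi j (g [^] (i::nat)) = cis (2 * pi * real j * real i / real N)"
  by (simp add: chi_def ind_g_pow cis_mod_N)

lemma chi_zero [simp]: "chi j \<zero> = 0" by (simp add: chi_def)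

lemma chi_one [simp]: "chi j \<one> = 1"
  using chi_g_pow[of j 0] by simp

lemma chi_0: "x \<noteq> \<zero> \<Longrightarrow> chi 0 x = 1" by (simp add: chi_def)

lemma chi_add: "x \<noteq> \<zero> \<Longrightarrow> chi (i + j) x = chi i x * chi j x"
  by (simp add: chi_def cis_mult algebra_simps add_divide_distrib)

lemma chi_mult:
  assumes "x \<in> carrier R" "y \<in> carrier R"
  shows "chi j (x \<otimes> y) = chi j x * chi j y"
proof (cases "x = \<zero> \<or> y = \<zero>")
  case False
  then have "x \<otimes> y = g [^] (ind x + ind y)"
    using False assms g_carrier by (simp add: g_pow_ind flip: nat_pow_mult)
  then have "chi j (x \<otimes> y) = cis (2 * pi * real j * real (ind x + ind y) / real N)"
    by (simp only: chi_g_pow)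
  then show ?thesis using False
    by (simp add: chi_def cis_mult algebra_simps add_divide_distrib)
qed (use assms in auto)

lemma sum_chi_nonzero:
  assumes "\<not> N dvd j"
  shows "(\<Sum>x\<in>carrier R - {\<zero>}. chi j x) = 0"
proof -
  define z where "z = cis (2 * pi * real j / real N)"
  have "(\<Sum>x\<in>carrier R - {\<zero>}. chi j x) = (\<Sum>i<N. chi j (g [^] i))"
    by (rule sum.reindex_bij_betw[OF bij_betw_g_pow, symmetric])
  also have "\<dots> = (\<Sum>i<N. z ^ i)"
    by (simp add: chi_g_pow z_def DeMoivre mult_ac)
  also have "\<dots> = 0"
  proof -
    have "z ^ N = 1"
      using N_pos cis_multiple_2pi[of "real j"] by (simp add: z_def DeMoivre)
    moreover have "z \<noteq> 1"
    proof
      assume "z = 1"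
      then have "cos (2 * pi * real j / real N) = 1" by (simp add: z_def complex_eq_iff)
      then obtain k :: int where "2 * pi * real j / real N = real_of_int k * 2 * pi"
        by (auto simp: cos_one_2pi_int)
      then have "real j = real_of_int k * real N" using N_pos by (simp add: field_simps)
      then have "int j = k * int N" by (metis of_int_eq_iff of_int_mult of_int_of_nat_eq)
      then show False using assms by (metis dvd_triv_right of_nat_dvd_iff)
    qed
    ultimately show ?thesis by (simp add: geometric_sum)
  qed
  finally show ?thesis .
qed

lemma chi_cnj: "x \<noteq> \<zero> \<Longrightarrow> chi j x * cnj (chi j x) = 1"
  by (simp add: chi_def complex_mult_cnj cis.code)

lemma chi_inv_mult:
  assumes "x \<in> carrier R" "y \<in> carrier R" "y \<noteq> \<zero>"
  shows "chi j x * cnj (chi j y) = chi j (x \<otimes> inv y)"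
proof -
  have y: "y \<in> Units R" using assms field_Units by auto
  have "chi j x = chi j (x \<otimes> inv y \<otimes> y)" using assms y by (simp add: m_assoc)
  also have "\<dots> = chi j (x \<otimes> inv y) * chi j y" using assms y by (simp add: chi_mult)
  finally show ?thesis using chi_cnj[OF assms(3), of j] by (simp add: mult.assoc)
qed

text \<open>Every ratio other than \<open>1\<close> occurs exactly once among the quotients
  \<open>(a + u) / a\<close>, whence the sum below is minus the missing term.\<close>

lemma sum_chi_shift:
  assumes j: "\<not> N dvd j" and u: "u \<in> carrier R" "u \<noteq> \<zero>"
  shows "(\<Sum>a\<in>carrier R. chi j (a \<oplus> u) * cnj (chi j a)) = -1"
proof -
  have "(\<Sum>a\<in>carrier R. chi j (a \<oplus> u) * cnj (chi j a))
      = (\<Sum>a\<in>carrier R - {\<zero>}. chi j (a \<oplus> u) * cnj (chi j a))"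
    by (rule sum.mono_neutral_right) (auto simp: fin)
  also have "\<dots> = (\<Sum>a\<in>carrier R - {\<zero>}. chi j (\<one> \<oplus> u \<otimes> inv a))"
  proof (rule sum.cong[OF refl])
    fix a assume a: "a \<in> carrier R - {\<zero>}"
    then have aU: "a \<in> Units R" using field_Units by auto
    show "chi j (a \<oplus> u) * cnj (chi j a) = chi j (\<one> \<oplus> u \<otimes> inv a)"
      using a u aU by (simp add: chi_inv_mult l_distr)
  qed
  also have "\<dots> = (\<Sum>b\<in>carrier R - {\<one>}. chi j b)"
  proof (rule sum.reindex_bij_betw)
    show "bij_betw (\<lambda>a. \<one> \<oplus> u \<otimes> inv a) (carrier R - {\<zero>}) (carrier R - {\<one>})"
    proof (rule bij_betwI[where g = "\<lambda>b. u \<otimes> inv (b \<ominus> \<one>)"])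
      have uU: "u \<in> Units R" using u field_Units by auto
      show "(\<lambda>a. \<one> \<oplus> u \<otimes> inv a) \<in> carrier R - {\<zero>} \<rightarrow> carrier R - {\<one>}"
      proof
        fix a assume a: "a \<in> carrier R - {\<zero>}"
        then have aU: "a \<in> Units R" using field_Units by auto
        have "u \<otimes> inv a \<in> Units R" using uU aU by simp
        then have "u \<otimes> inv a \<noteq> \<zero>" using field_Units by auto
        then show "\<one> \<oplus> u \<otimes> inv a \<in> carrier R - {\<one>}"
          using uU aU u by (simp add: add.l_cancel_one)
      qed
      show "(\<lambda>b. u \<otimes> inv (b \<ominus> \<one>)) \<in> carrier R - {\<one>} \<rightarrow> carrier R - {\<zero>}"
      proof
        fix b assume b: "b \<in> carrier R - {\<one>}"
        then have "b \<ominus> \<one> \<in> Units R" using field_Units by auto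
        then have "u \<otimes> inv (b \<ominus> \<one>) \<in> Units R" using uU by simp
        then show "u \<otimes> inv (b \<ominus> \<one>) \<in> carrier R - {\<zero>}" using field_Units by auto
      qed
      fix a assume a: "a \<in> carrier R - {\<zero>}"
      then have aU: "a \<in> Units R" using field_Units by auto
      have 1: "\<one> \<oplus> u \<otimes> inv a \<ominus> \<one> = u \<otimes> inv a"
      proof -
        have c: "u \<otimes> inv a \<in> carrier R" using u aU by simp
        have "\<one> \<oplus> u \<otimes> inv a \<ominus> \<one> = (\<one> \<oplus> \<ominus> \<one>) \<oplus> u \<otimes> inv a"
          using c by (simp add: minus_eq a_ac del: r_neg l_neg)
        then show ?thesis using c by (simp add: r_neg)
      qed
      have "inv (u \<otimes> inv a) = a \<otimes> inv u"
        using uU aU by (rule inv_unit_quotient)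
      then show "u \<otimes> inv (\<one> \<oplus> u \<otimes> inv a \<ominus> \<one>) = a"
        using uU aU u a by (simp add: 1 m_lcomm[of u a "inv u"])
    next
      fix b assume b: "b \<in> carrier R - {\<one>}"
      have uU: "u \<in> Units R" using u field_Units by auto
      have bU: "b \<ominus> \<one> \<in> Units R" using b field_Units by auto
      have "inv (u \<otimes> inv (b \<ominus> \<one>)) = (b \<ominus> \<one>) \<otimes> inv u"
        using uU bU by (rule inv_unit_quotient)
      then have "u \<otimes> inv (u \<otimes> inv (b \<ominus> \<one>)) = b \<ominus> \<one>"
        using uU bU u b by (simp add: m_lcomm[of u "b \<ominus> \<one>" "inv u"])
      then show "\<one> \<oplus> u \<otimes> inv (u \<otimes> inv (b \<ominus> \<one>)) = b"
        using b by (simp add: minus_eq a_lcomm r_neg)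
    qed
  qed
  also have "\<dots> = (\<Sum>b\<in>carrier R. chi j b) - chi j \<one>"
    using fin by (simp add: sum_diff1)
  also have "(\<Sum>b\<in>carrier R. chi j b) = (\<Sum>b\<in>carrier R - {\<zero>}. chi j b)"
    by (rule sum.mono_neutral_right) (auto simp: fin)
  finally show ?thesis using sum_chi_nonzero[OF j] by simp
qed

text \<open>Substituting a + w for the variable leaves the shift by v - w, to which
  \<open>sum_chi_shift\<close> applies. On the diagonal each nonzero element contributes 1 and zero
  contributes 0, which gives N and not N + 1.\<close>

lemma sum_chi_correlation:
  assumes j: "\<not> N dvd j" and v: "v \<in> carrier R" and w: "w \<in> carrier R"
  shows "(\<Sum>a\<in>carrier R. chi j (a \<oplus> v) * cnj (chi j (a \<oplus> w))) = (if v = w then of_nat N else -1)"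
proof -
  have bij: "bij_betw (\<lambda>a. a \<oplus> w) (carrier R) (carrier R)"
  proof (rule bij_betwI[where g = "\<lambda>b. b \<ominus> w"])
    show "a \<oplus> w \<ominus> w = a" if "a \<in> carrier R" for a
      using that w by (simp add: minus_eq a_assoc r_neg)
    show "b \<ominus> w \<oplus> w = b" if "b \<in> carrier R" for b
      using that w by (simp add: minus_eq a_assoc l_neg)
  qed (use w in auto)
  have "(\<Sum>a\<in>carrier R. chi j (a \<oplus> v) * cnj (chi j (a \<oplus> w)))
    = (\<Sum>b\<in>carrier R. chi j (b \<oplus> (v \<ominus> w)) * cnj (chi j b))"
  proof (rule trans[OF _ sum.reindex_bij_betw[OF bij]], intro sum.cong refl)
    fix a assume a: "a \<in> carrier R"
    have "a \<oplus> w \<oplus> (v \<ominus> w) = a \<oplus> v \<oplus> (w \<oplus> \<ominus> w)"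
      unfolding minus_eq using a v w by (simp add: a_ac del: r_neg l_neg)
    then show "chi j (a \<oplus> v) * cnj (chi j (a \<oplus> w)) = chi j (a \<oplus> w \<oplus> (v \<ominus> w)) * cnj (chi j (a \<oplus> w))"
      using a v w by (simp add: r_neg)
  qed
  also have "\<dots> = (if v = w then of_nat N else -1)"
  proof (cases "v = w")
    case True
    have "(\<Sum>b\<in>carrier R. chi j (b \<oplus> (v \<ominus> w)) * cnj (chi j b)) = (\<Sum>b\<in>carrier R. chi j b * cnj (chi j b))"
      using True w by (intro sum.cong refl) (simp add: minus_eq r_neg)
    also have "\<dots> = (\<Sum>b\<in>carrier R - {\<zero>}. chi j b * cnj (chi j b))"
      by (rule sum.mono_neutral_right) (auto simp: fin)
    also have "\<dots> = (\<Sum>b\<in>carrier R - {\<zero>}. 1)" 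
      by (intro sum.cong refl) (use chi_cnj in auto)
    finally show ?thesis using True card_nonzero by simp
  next
    case False
    then have "v \<ominus> w \<noteq> \<zero>" using v w by simp
    then show ?thesis using sum_chi_shift[OF j, of "v \<ominus> w"] False v w by simp
  qed
  finally show ?thesis .
qed

text \<open>The mean square of the character sums over all translates of \<open>V\<close> is known exactly, and the
  translates by elements of \<open>V\<close> all give the same sum.\<close>

lemma norm_sum_chi_subgroup:
  assumes j: "\<not> N dvd j" and V: "subgroup V (add_monoid R)"
  shows "norm (\<Sum>v\<in>V. chi j v) \<le> sqrt (card (carrier R) - card V)"
proof -
  interpret V: subgroup V "add_monoid R" by fact
  have VR: "V \<subseteq> carrier R" using V.subset by simp
  have zV: "\<zero> \<in> V" using V.one_closed by simp
  have finV: "finite V" using VR fin finite_subset by blast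
  have cV: "card V \<le> card (carrier R)" "card V > 0"
    using VR fin zV finV by (auto intro: card_mono simp: card_gt_0_iff)
  define f where "f a = (\<Sum>v\<in>V. chi j (a \<oplus> v))" for a
  have f_V: "f a = f \<zero>" if a: "a \<in> V" for a
  proof -
    have "bij_betw (\<lambda>v. a \<oplus> v) V V"
    proof (rule bij_betwI[where g = "\<lambda>b. \<ominus> a \<oplus> b"])
      have "\<ominus> a \<in> V" using V.m_inv_closed[OF a] by (simp add: a_inv_def)
      then show "(\<lambda>b. \<ominus> a \<oplus> b) \<in> V \<rightarrow> V" using V.m_closed by auto
      show "\<ominus> a \<oplus> (a \<oplus> v) = v" "a \<oplus> (\<ominus> a \<oplus> v) = v" if "v \<in> V" for v
        using subsetD[OF VR that] subsetD[OF VR a] by (simp_all add: r_neg1 r_neg2)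
    qed (use a V.m_closed in auto)
    then have "f a = (\<Sum>v\<in>V. chi j v)"
      unfolding f_def by (rule sum.reindex_bij_betw)
    also have "\<dots> = f \<zero>" unfolding f_def using VR by (intro sum.cong refl) (auto simp: subsetD)
    finally show ?thesis .
  qed
  have "complex_of_real (\<Sum>a\<in>carrier R. (norm (f a))\<^sup>2) = (\<Sum>a\<in>carrier R. f a * cnj (f a))"
    by (simp add: complex_norm_square del: of_real_power flip: of_real_power)
  also have "\<dots> = (\<Sum>a\<in>carrier R. \<Sum>v\<in>V. \<Sum>w\<in>V. chi j (a \<oplus> v) * cnj (chi j (a \<oplus> w)))"
    by (simp add: f_def sum_product)
  also have "\<dots> = (\<Sum>v\<in>V. \<Sum>w\<in>V. \<Sum>a\<in>carrier R. chi j (a \<oplus> v) * cnj (chi j (a \<oplus> w)))"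
    by (rule trans[OF sum.swap]) (rule sum.cong[OF refl], rule sum.swap)
  also have "\<dots> = (\<Sum>v\<in>V. \<Sum>w\<in>V. if v = w then of_nat N else -1)"
    using VR by (intro sum.cong refl sum_chi_correlation[OF j]) auto
  also have "\<dots> = (\<Sum>v\<in>V. \<Sum>w\<in>V. (if v = w then of_nat (N + 1) else 0) - 1)"
    by (intro sum.cong refl) auto
  also have "\<dots> = of_nat (card V) * (of_nat (N + 1) - of_nat (card V))"
    using finV by (simp add: sum_subtractf)
  also have "\<dots> = complex_of_real (real (card V) * (real (card (carrier R)) - real (card V)))"
    by (simp add: card_carrier)
  finally have "(\<Sum>a\<in>carrier R. (norm (f a))\<^sup>2) = real (card V) * (real (card (carrier R)) - real (card V))"
    by (simp only: of_real_eq_iff)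
  \<comment> \<open>Only the translates by elements of V are kept. Each of them contributes the same
    square, so the factor \<open>card V\<close> cancels.\<close>
  moreover have "(\<Sum>a\<in>V. (norm (f a))\<^sup>2) \<le> (\<Sum>a\<in>carrier R. (norm (f a))\<^sup>2)"
    by (rule sum_mono2[OF fin VR]) simp
  moreover have "(\<Sum>a\<in>V. (norm (f a))\<^sup>2) = real (card V) * (norm (f \<zero>))\<^sup>2"
    using f_V by simp
  ultimately have "(norm (f \<zero>))\<^sup>2 \<le> real (card (carrier R)) - real (card V)"
    using cV by simp
  then have "norm (f \<zero>) \<le> sqrt (real (card (carrier R)) - real (card V))"
    by (rule real_le_rsqrt)
  moreover have "f \<zero> = (\<Sum>v\<in>V. chi j v)" 
    unfolding f_def using VR by (intro sum.cong refl) (auto simp: subsetD)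
  ultimately show ?thesis using cV by (simp add: of_nat_diff)
qed

text \<open>For \<open>r dvd N\<close>, the condition \<open>r dvd ind x\<close> says that \<open>x\<close> is an \<open>r\<close>-th power.\<close>

definition free_ind :: "nat set \<Rightarrow> 'a \<Rightarrow> complex" where
  "free_ind P x = of_bool (x \<noteq> \<zero> \<and> (\<forall>r\<in>P. \<not> r dvd ind x))"

text \<open>The characters in the sum are those whose order divides r. Their values at x are the
  powers of an r-th root of unity, which equals 1 exactly when r divides the index of x.\<close>

lemma sum_chi_multiples:
  assumes x: "x \<in> carrier R" "x \<noteq> \<zero>" and r: "r dvd N"
  shows "(\<Sum>t<r. chi (t * (N div r)) x) = (if r dvd ind x then of_nat r else 0)"
proof -
  have r0: "r > 0" using r N_pos by (auto intro: Nat.gr0I)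
  define z where "z = cis (2 * pi * real (ind x) / real r)"
  have "chi (t * (N div r)) x = z ^ t" for t
  proof -
    obtain k where k: "N = r * k" using r by blast
    then have k0: "k > 0" using N_pos by (cases k) auto
    have "2 * pi * real (t * k) * real (ind x) / real N = real t * (2 * pi * real (ind x) / real r)"
      using r0 k0 by (simp add: k field_simps)
    moreover have "N div r = k" using k r0 by simp
    ultimately show ?thesis using x(2) by (simp add: chi_def z_def DeMoivre)
  qed
  moreover have zr: "z ^ r = 1"
    using r0 cis_multiple_2pi[of "real (ind x)"] by (simp add: z_def DeMoivre)
  moreover have "z = 1 \<longleftrightarrow> r dvd ind x"
  proof
    assume "z = 1"
    then have "cos (2 * pi * real (ind x) / real r) = 1" by (simp add: z_def complex_eq_iff)
    then obtain k :: int where "2 * pi * real (ind x) / real r = real_of_int k * 2 * pi"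
      by (auto simp: cos_one_2pi_int)
    then have "real (ind x) = real_of_int k * real r" using r0 by (simp add: field_simps)
    then have "int (ind x) = k * int r" by (metis of_int_eq_iff of_int_mult of_int_of_nat_eq)
    then show "r dvd ind x" by (metis dvd_triv_right of_nat_dvd_iff)
  next
    assume "r dvd ind x"
    then obtain k where k: "ind x = r * k" by blast
    have "2 * pi * real (ind x) / real r = 2 * pi * real k" using r0 by (simp add: k)
    then show "z = 1" unfolding z_def by (metis cis_multiple_2pi Nats_cases Ints_of_nat)
  qed
  ultimately show ?thesis by (auto simp: geometric_sum)
qed

text \<open>By \<open>sum_chi_multiples\<close> the condition at r is one minus the average of r
  characters, of which the trivial one is split off. The factor \<open>chi j\<close> is carried
  along because the induction over P produces products of characters.\<close>

lemma free_ind_insert: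
  assumes x: "x \<in> carrier R" and r: "r dvd N"
  shows "free_ind (insert r P) x * chi j x = (1 - 1 / of_nat r) * (free_ind P x * chi j x)
    - (1 / of_nat r) * (\<Sum>t\<in>{1..<r}. free_ind P x * chi (j + t * (N div r)) x)"
proof (cases "x = \<zero>")
  case False
  have r0: "r > 0" using r N_pos by (auto intro: Nat.gr0I)
  have "(\<Sum>t<r. chi (t * (N div r)) x) = 1 + (\<Sum>t\<in>{1..<r}. chi (t * (N div r)) x)"
    using r0 False by (simp add: lessThan_atLeast0 sum.atLeast_Suc_lessThan chi_0)
  then have *: "(\<Sum>t\<in>{1..<r}. chi (t * (N div r)) x) = (if r dvd ind x then of_nat r else 0) - 1"
    using sum_chi_multiples[OF x False r] by simp
  have S: "(\<Sum>t\<in>{1..<r}. free_ind P x * chi (j + t * (N div r)) x)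
    = free_ind P x * chi j x * ((if r dvd ind x then of_nat r else 0) - 1)"
    unfolding *[symmetric] sum_distrib_left by (simp add: chi_add[OF False] mult_ac)
  have "free_ind (insert r P) x = free_ind P x * (if r dvd ind x then 0 else 1)"
    by (auto simp: free_ind_def)
  then show ?thesis unfolding S using r0 by (simp add: algebra_simps)
qed (simp add: free_ind_def)

lemma sum_free_ind_insert:
  assumes VR: "V \<subseteq> carrier R" and r: "r dvd N"
  shows "(\<Sum>v\<in>V. free_ind (insert r P) v * chi j v)
    = (1 - 1 / of_nat r) * (\<Sum>v\<in>V. free_ind P v * chi j v)
      - (1 / of_nat r) * (\<Sum>t\<in>{1..<r}. \<Sum>v\<in>V. free_ind P v * chi (j + t * (N div r)) v)"
  using VR r by (simp add: free_ind_insert sum_subtractf sum_distrib_left subsetD cong: sum.cong)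
    (rule sum.swap)

text \<open>The hypothesis on \<open>j\<close> keeps the character nontrivial after multiplication by characters whose
  orders are products of primes in \<open>P\<close>.\<close>

lemma norm_sum_free_chi:
  assumes V: "subgroup V (add_monoid R)"
    and P: "finite P" "\<And>r. r \<in> P \<Longrightarrow> Factorial_Ring.prime r \<and> r dvd N"
    and j: "\<not> N dvd \<Prod>P * j"
  shows "norm (\<Sum>v\<in>V. free_ind P v * chi j v)
    \<le> (\<Prod>r\<in>P. 2 * (1 - 1 / real r)) * sqrt (card (carrier R) - card V)"
  using P j
proof (induction P arbitrary: j rule: finite_induct)
  case empty
  have "free_ind {} v * chi j v = chi j v" for v
    by (cases "v = \<zero>") (auto simp: free_ind_def)
  then have "(\<Sum>v\<in>V. free_ind {} v * chi j v) = (\<Sum>v\<in>V. chi j v)" by (intro sum.cong refl)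
  then show ?case using norm_sum_chi_subgroup[OF _ V, of j] empty by simp
next
  case (insert r P)
  have VR: "V \<subseteq> carrier R" using subgroup.subset[OF V] by simp
  have r: "Factorial_Ring.prime r" "r dvd N" using insert.prems by auto
  have r1: "r > 1" using r(1) by (rule prime_gt_1_nat)
  define B where "B = (\<Prod>r\<in>P. 2 * (1 - 1 / real r)) * sqrt (card (carrier R) - card V)"
  \<comment> \<open>Multiplication by r makes the added exponent a multiple of N, so a divisibility
    here would contradict the hypothesis for \<open>insert r P\<close>.\<close>
  have notdvd: "\<not> N dvd \<Prod>P * (j + t * (N div r))" for t
  proof
    assume "N dvd \<Prod>P * (j + t * (N div r))"
    then have "N dvd r * (\<Prod>P * (j + t * (N div r)))" by simp
    also have "r * (\<Prod>P * (j + t * (N div r))) = \<Prod>(insert r P) * j + \<Prod>P * t * (r * (N div r))"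
      using insert.hyps by (simp add: algebra_simps)
    also have "r * (N div r) = N" using r(2) by simp
    finally have "N dvd \<Prod>(insert r P) * j" by (simp add: dvd_add_left_iff)
    then show False using insert.prems(2) by simp
  qed
  have IH: "norm (\<Sum>v\<in>V. free_ind P v * chi (j + t * (N div r)) v) \<le> B" for t
    unfolding B_def by (rule insert.IH) (use insert.prems notdvd in auto)
  have IH0: "norm (\<Sum>v\<in>V. free_ind P v * chi j v) \<le> B"
    using IH[of 0] by simp
  have "(\<Sum>v\<in>V. free_ind (insert r P) v * chi j v)
    = (1 - 1 / of_nat r) * (\<Sum>v\<in>V. free_ind P v * chi j v)
      - (1 / of_nat r) * (\<Sum>t\<in>{1..<r}. \<Sum>v\<in>V. free_ind P v * chi (j + t * (N div r)) v)"
    by (rule sum_free_ind_insert[OF VR r(2)])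
  also have "norm \<dots> \<le> (1 - 1 / real r) * norm (\<Sum>v\<in>V. free_ind P v * chi j v)
      + (1 / real r) * norm (\<Sum>t\<in>{1..<r}. \<Sum>v\<in>V. free_ind P v * chi (j + t * (N div r)) v)"
  proof -
    have "(1 - 1 / of_nat r :: complex) = of_real (1 - 1 / real r)" by simp
    then have "norm (1 - 1 / of_nat r :: complex) = 1 - 1 / real r"
      using r1 by (simp only: norm_of_real) simp
    then show ?thesis
      by (intro order_trans[OF norm_triangle_ineq4]) (simp add: norm_mult norm_divide)
  qed
  also have "\<dots> \<le> (1 - 1 / real r) * B + (1 / real r) * (\<Sum>t\<in>{1..<r}. B)"
    using r1 by (intro add_mono mult_left_mono IH0 sum_norm_le IH) auto
  \<comment> \<open>The trivial character has weight 1 - 1/r, and the other r - 1 characters have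
    the same weight together; this is the factor 2 for each prime.\<close>
  also have "\<dots> = 2 * (1 - 1 / real r) * B"
    using r1 by (simp add: field_simps of_nat_diff)
  finally show ?case using insert.hyps by (simp add: B_def mult_ac)
qed

text \<open>The trivial character yields the main term. A new prime r keeps the old error 2^k - 1
  and adds at most 2^k from the characters of order r, and the two make up 2^(k+1) - 1.\<close>

lemma norm_sum_free_ind:
  assumes V: "subgroup V (add_monoid R)"
    and P: "finite P" "\<And>r. r \<in> P \<Longrightarrow> Factorial_Ring.prime r \<and> r dvd N"
  shows "norm ((\<Sum>v\<in>V. free_ind P v) - of_real ((\<Prod>r\<in>P. 1 - 1 / real r) * (card V - 1)))
    \<le> (\<Prod>r\<in>P. 1 - 1 / real r) * (2 ^ card P - 1) * sqrt (card (carrier R) - card V)"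
  using P
proof (induction P rule: finite_induct)
  case empty
  have VR: "V \<subseteq> carrier R" using subgroup.subset[OF V] by simp
  have z: "\<zero> \<in> V" using subgroup.one_closed[OF V] by simp
  have finV: "finite V" using VR fin finite_subset by blast
  have "(\<Sum>v\<in>V. free_ind {} v) = (\<Sum>v\<in>V - {\<zero>}. 1)"
    using finV by (intro sum.mono_neutral_cong_right) (auto simp: free_ind_def)
  also have "\<dots> = of_nat (card V - 1)" using z finV by (simp add: card_Diff_singleton)
  finally show ?case by simp
next
  case (insert r P)
  have VR: "V \<subseteq> carrier R" using subgroup.subset[OF V] by simp
  have r: "Factorial_Ring.prime r" "r dvd N" using insert.prems by auto
  have r1: "r > 1" using r(1) by (rule prime_gt_1_nat)
  define s where "s = sqrt (card (carrier R) - card V)"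
  define th where "th = (\<Prod>r\<in>P. 1 - 1 / real r)"
  define A where "A = (\<Sum>v\<in>V. free_ind P v)"
  define m where "m = th * (card V - 1)"
  have th2: "(\<Prod>r\<in>P. 2 * (1 - 1 / real r)) = th * 2 ^ card P"
    unfolding prod.distrib by (simp add: th_def)
  have IH: "norm (A - of_real m) \<le> th * (2 ^ card P - 1) * s"
    using insert.IH insert.prems unfolding A_def th_def s_def m_def by auto
  have notdvd: "\<not> N dvd \<Prod>P * (t * (N div r))" if t: "t \<in> {1..<r}" for t
  proof
    assume "N dvd \<Prod>P * (t * (N div r))"
    moreover have N: "N = r * (N div r)" using r(2) by simp
    moreover have "N div r > 0" using N N_pos by (cases "N div r = 0") auto
    ultimately have "r dvd \<Prod>P * t"
      by (metis dvd_mult_cancel2 mult.assoc mult.commute mult_dvd_mono nat_mult_dvd_cancel1)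
    then consider "r dvd \<Prod>P" | "r dvd t" using r(1) prime_dvd_mult_iff by blast
    then show False
    proof cases
      case 1
      then obtain s where "s \<in> P" "r dvd s"
        using prime_dvd_prod_iff[OF insert.hyps(1) r(1), of id] by auto
      then show False using insert.prems[of s] r(1) insert.hyps primes_dvd_imp_eq[of r s] by auto
    next
      case 2
      then show False using t by (auto dest: dvd_imp_le)
    qed
  qed
  have bd: "norm (\<Sum>v\<in>V. free_ind P v * chi (t * (N div r)) v) \<le> th * 2 ^ card P * s"
    if "t \<in> {1..<r}" for t
    unfolding th2[symmetric] s_def
    by (rule norm_sum_free_chi[OF V]) (use insert notdvd[OF that] in auto)
  have f0: "free_ind P v * chi 0 v = free_ind P v" for P v
    by (cases "v = \<zero>") (simp_all add: free_ind_def chi_0)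
  have "(\<Sum>v\<in>V. free_ind (insert r P) v) = (\<Sum>v\<in>V. free_ind (insert r P) v * chi 0 v)"
    by (simp add: f0)
  also have "\<dots> = (1 - 1 / of_nat r) * A
      - (1 / of_nat r) * (\<Sum>t\<in>{1..<r}. \<Sum>v\<in>V. free_ind P v * chi (t * (N div r)) v)"
    unfolding A_def sum_free_ind_insert[OF VR r(2)] by (simp add: f0)
  finally have "(\<Sum>v\<in>V. free_ind (insert r P) v) - of_real ((1 - 1 / real r) * m)
    = of_real (1 - 1 / real r) * (A - of_real m)
      - of_real (1 / real r) * (\<Sum>t\<in>{1..<r}. \<Sum>v\<in>V. free_ind P v * chi (t * (N div r)) v)"
    by (simp add: algebra_simps diff_divide_distrib)
  also have "norm \<dots> \<le> (1 - 1 / real r) * norm (A - of_real m)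
      + (1 / real r) * norm (\<Sum>t\<in>{1..<r}. \<Sum>v\<in>V. free_ind P v * chi (t * (N div r)) v)"
    using r1 by (intro order_trans[OF norm_triangle_ineq4])
      (simp only: norm_mult norm_of_real, simp)
  also have "\<dots> \<le> (1 - 1 / real r) * (th * (2 ^ card P - 1) * s)
      + (1 / real r) * (\<Sum>t\<in>{1..<r}. th * 2 ^ card P * s)"
    using r1 by (intro add_mono mult_left_mono IH sum_norm_le bd) auto
  also have "\<dots> = (1 - 1 / real r) * th * (2 ^ card (insert r P) - 1) * s"
    using r1 insert.hyps by (simp add: field_simps of_nat_diff)
  finally show ?case using insert.hyps by (simp add: th_def m_def s_def mult_ac)
qed

section \<open>Counting and sieving elements free of given primes\<close>

definition free_set :: "nat set \<Rightarrow> 'a set" where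
  "free_set P = {x \<in> carrier R. x \<noteq> \<zero> \<and> (\<forall>r\<in>P. \<not> r dvd ind x)}"

lemma sum_free_ind: "V \<subseteq> carrier R \<Longrightarrow> (\<Sum>v\<in>V. free_ind P v) = of_nat (card (V \<inter> free_set P))"
proof -
  assume V: "V \<subseteq> carrier R"
  then have "finite V" using fin finite_subset by blast
  then have "(\<Sum>v\<in>V. free_ind P v) = (\<Sum>v\<in>V \<inter> free_set P. 1)"
    using V by (intro sum.mono_neutral_cong_right) (auto simp: free_ind_def free_set_def)
  then show ?thesis by simp
qed

text \<open>If V is the whole field, the error term contains the square root of 0 and the count
  becomes exact.\<close>

lemma card_free_set:
  assumes P: "finite P" "\<And>r. r \<in> P \<Longrightarrow> Factorial_Ring.prime r \<and> r dvd N"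
  shows "real (card (free_set P)) = (\<Prod>r\<in>P. 1 - 1 / real r) * real N"
proof -
  have "subgroup (carrier R) (add_monoid R)"
    using add.subgroup_self by simp
  from norm_sum_free_ind[OF this P]
  have "(\<Sum>v\<in>carrier R. free_ind P v) = of_real ((\<Prod>r\<in>P. 1 - 1 / real r) * (card (carrier R) - 1))"
    by simp
  also have "(\<Sum>v\<in>carrier R. free_ind P v) = complex_of_real (real (card (free_set P)))"
    by (simp add: sum_free_ind) (simp add: free_set_def Collect_conj_eq)
  finally show ?thesis by (simp only: of_real_eq_iff) (simp add: N_def)
qed

lemma card_subgroup_free_set:
  assumes V: "subgroup V (add_monoid R)"
    and P: "finite P" "\<And>r. r \<in> P \<Longrightarrow> Factorial_Ring.prime r \<and> r dvd N"
  shows "real (card (V \<inter> free_set P)) \<le> (\<Prod>r\<in>P. 1 - 1 / real r) *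
    (real (card V) - 1 + (2 ^ card P - 1) * sqrt (card (carrier R)))"
proof -
  define th where "th = (\<Prod>r\<in>P. 1 - 1 / real r)"
  have VR: "V \<subseteq> carrier R" using subgroup.subset[OF V] by simp
  have z: "\<zero> \<in> V" using subgroup.one_closed[OF V] by simp
  have "finite V" using VR fin finite_subset by blast
  then have c: "card V > 0" using z by (auto simp: card_gt_0_iff)
  have "1 < real r" if "r \<in> P" for r using prime_gt_1_nat P(2)[OF that] by auto
  then have th: "th \<ge> 0" unfolding th_def
    by (intro prod_nonneg) (fastforce simp: field_simps)
  have "norm (complex_of_real (real (card (V \<inter> free_set P)) - th * (card V - 1)))
    \<le> th * (2 ^ card P - 1) * sqrt (card (carrier R) - card V)"
    using norm_sum_free_ind[OF V P] by (simp add: sum_free_ind[OF VR] th_def)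
  then have "real (card (V \<inter> free_set P)) - th * (card V - 1)
    \<le> th * (2 ^ card P - 1) * sqrt (card (carrier R) - card V)"
    by (simp only: norm_of_real)
  also have "\<dots> \<le> th * (2 ^ card P - 1) * sqrt (card (carrier R))"
    using th by (intro mult_left_mono) auto
  finally show ?thesis using c by (simp add: th_def algebra_simps of_nat_diff)
qed

text \<open>The primes in \<open>P\<close> are treated with character sums, those in \<open>P'\<close> by a union bound.\<close>

lemma sieve:
  assumes P: "finite P" "\<And>r. r \<in> P \<Longrightarrow> Factorial_Ring.prime r \<and> r dvd N"
    and P': "finite P'" "\<And>r. r \<in> P' \<Longrightarrow> Factorial_Ring.prime r \<and> r dvd N" "P \<inter> P' = {}"
    and VV: "finite I" "\<And>i. i \<in> I \<Longrightarrow> subgroup (V i) (add_monoid R)"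
    and bound: "real N > (\<Sum>i\<in>I. real (card (V i)) - 1)
      + real (card I) * (2 ^ card P - 1) * sqrt (card (carrier R)) + (\<Sum>r\<in>P'. real N / real r)"
  shows "\<exists>x\<in>free_set (P \<union> P'). \<forall>i\<in>I. x \<notin> V i"
proof (rule ccontr)
  assume neg: "\<not> ?thesis"
  define th where "th = (\<Prod>r\<in>P. 1 - 1 / real r)"
  have "1 < real r" if "r \<in> P" for r using prime_gt_1_nat P(2)[OF that] by auto
  then have th: "th > 0" unfolding th_def
    by (intro prod_pos) (fastforce simp: field_simps)
  have sub: "free_set P \<subseteq> (\<Union>i\<in>I. V i \<inter> free_set P) \<union> (\<Union>r\<in>P'. free_set P - free_set (insert r P))"
    using neg by (auto simp: free_set_def)
  have finf: "finite (free_set Q)" for Q using fin by (simp add: free_set_def)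
  have "th * real N = real (card (free_set P))"
    by (simp add: card_free_set[OF P] th_def)
  also have "card (free_set P) \<le> card ((\<Union>i\<in>I. V i \<inter> free_set P) \<union> (\<Union>r\<in>P'. free_set P - free_set (insert r P)))"
    using sub by (rule card_mono[rotated]) (use VV(1) P'(1) finf in auto)
  also have "\<dots> \<le> card (\<Union>i\<in>I. V i \<inter> free_set P) + card (\<Union>r\<in>P'. free_set P - free_set (insert r P))"
    by (rule card_Un_le)
  also have "\<dots> \<le> (\<Sum>i\<in>I. card (V i \<inter> free_set P)) + (\<Sum>r\<in>P'. card (free_set P - free_set (insert r P)))"
    by (intro add_mono card_UN_le VV P')
  finally have "th * real N \<le> (\<Sum>i\<in>I. real (card (V i \<inter> free_set P)))
      + (\<Sum>r\<in>P'. real (card (free_set P - free_set (insert r P))))"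
    by (simp flip: of_nat_sum of_nat_add)
  also have "(\<Sum>i\<in>I. real (card (V i \<inter> free_set P)))
    \<le> (\<Sum>i\<in>I. th * (real (card (V i)) - 1 + (2 ^ card P - 1) * sqrt (card (carrier R))))"
    unfolding th_def by (intro sum_mono card_subgroup_free_set VV P)
  \<comment> \<open>By the exact count, the elements lost at r are the fraction 1/r of
    \<open>free_set P\<close>. All terms are then multiples of \<open>th\<close>, which cancels in
    the end.\<close>
  also have "(\<Sum>r\<in>P'. real (card (free_set P - free_set (insert r P)))) = (\<Sum>r\<in>P'. th * (real N / real r))"
  proof (rule sum.cong[OF refl])
    fix r assume r: "r \<in> P'"
    then have rP: "r \<notin> P" using P'(3) by auto
    have ss: "free_set (insert r P) \<subseteq> free_set P" by (auto simp: free_set_def)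
    have c: "real (card (free_set (insert r P))) = (1 - 1 / real r) * th * real N"
      using P P'(2)[OF r] rP by (subst card_free_set) (auto simp: th_def)
    have "real (card (free_set P - free_set (insert r P))) = real (card (free_set P)) - real (card (free_set (insert r P)))"
      using ss finf by (simp add: card_Diff_subset card_mono of_nat_diff)
    then show "real (card (free_set P - free_set (insert r P))) = th * (real N / real r)"
      using c card_free_set[OF P] by (simp add: th_def algebra_simps)
  qed
  also have "(\<Sum>i\<in>I. th * (real (card (V i)) - 1 + (2 ^ card P - 1) * sqrt (card (carrier R))))
    = th * ((\<Sum>i\<in>I. real (card (V i)) - 1) + real (card I) * ((2 ^ card P - 1) * sqrt (card (carrier R))))"
    by (simp only: sum_distrib_left[symmetric] sum.distrib) simp
  also have "(\<Sum>r\<in>P'. th * (real N / real r)) = th * (\<Sum>r\<in>P'. real N / real r)"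
    by (simp only: sum_distrib_left)
  finally have "th * real N \<le> th * ((\<Sum>i\<in>I. real (card (V i)) - 1)
      + real (card I) * (2 ^ card P - 1) * sqrt (card (carrier R)) + (\<Sum>r\<in>P'. real N / real r))"
    by (simp only: distrib_left mult.assoc)
  then show False using th bound by simp
qed

end

section \<open>Frobenius maps and roots of polynomials\<close>

lemma (in cring) binomial_expansion:
  assumes x: "x \<in> carrier R" and y: "y \<in> carrier R"
  shows "(x \<oplus> y) [^] n = (\<Oplus>k\<in>{..n}. add_pow R (n choose k) (x [^] k \<otimes> y [^] (n - k)))"
proof (induction n)
  case 0
  then show ?case using x y by simp
next
  case (Suc n)
  define t where "t k = x [^] k \<otimes> y [^] (n - k)" for k
  have t: "t k \<in> carrier R" for k using x y by (simp add: t_def)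
  have "(x \<oplus> y) [^] Suc n = (\<Oplus>k\<in>{..n}. add_pow R (n choose k) (t k)) \<otimes> x \<oplus> (\<Oplus>k\<in>{..n}. add_pow R (n choose k) (t k)) \<otimes> y"
    using x y t by (simp add: Suc t_def[symmetric] r_distr finsum_closed Pi_def)
  also have "(\<Oplus>k\<in>{..n}. add_pow R (n choose k) (t k)) \<otimes> x = (\<Oplus>k\<in>{..n}. add_pow R (n choose k) (x [^] Suc k \<otimes> y [^] (n - k)))"
    using x y t by (subst finsum_ldistr) (auto intro!: finsum_cong' simp: add_pow_ldistr add_pow_rdistr t_def m_ac)
  also have "(\<Oplus>k\<in>{..n}. add_pow R (n choose k) (t k)) \<otimes> y = (\<Oplus>k\<in>{..n}. add_pow R (n choose k) (x [^] k \<otimes> y [^] (Suc n - k)))"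
    using x y t by (subst finsum_ldistr) (auto intro!: finsum_cong' simp: add_pow_ldistr t_def m_assoc Suc_diff_le)
  \<comment> \<open>The range may be extended because \<open>n choose Suc n\<close> is 0. Splitting
    off k = 0 afterwards aligns the two sums for Pascal's rule.\<close>
  also have "\<dots> = (\<Oplus>k\<in>{..Suc n}. add_pow R (n choose k) (x [^] k \<otimes> y [^] (Suc n - k)))"
    using x y by (subst finsum_Suc) (auto simp: Pi_def binomial_eq_0)
  also have "\<dots> = (\<Oplus>k\<in>{..n}. add_pow R (n choose Suc k) (x [^] Suc k \<otimes> y [^] (n - k))) \<oplus> y [^] Suc n"
    using x y by (subst finsum_Suc2) auto
  also have "(\<Oplus>k\<in>{..n}. add_pow R (n choose k) (x [^] Suc k \<otimes> y [^] (n - k))) \<oplus> \<dots>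
    = (\<Oplus>k\<in>{..n}. add_pow R (n choose k) (x [^] Suc k \<otimes> y [^] (n - k)) \<oplus> add_pow R (n choose Suc k) (x [^] Suc k \<otimes> y [^] (n - k))) \<oplus> y [^] Suc n"
    using x y by (subst finsum_addf) (auto simp: a_assoc finsum_closed Pi_def)
  also have "\<dots> = (\<Oplus>k\<in>{..n}. add_pow R (Suc n choose Suc k) (x [^] Suc k \<otimes> y [^] (n - k))) \<oplus> y [^] Suc n"
    using x y by (auto intro!: arg_cong2[where f = "(\<oplus>)"] finsum_cong' simp: add.nat_pow_mult)
  also have "\<dots> = (\<Oplus>k\<in>{..Suc n}. add_pow R (Suc n choose k) (x [^] k \<otimes> y [^] (Suc n - k)))"
    using x y by (subst finsum_Suc2) auto
  finally show ?case .
qed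

lemma (in cring) frobenius_add:
  assumes p: "Factorial_Ring.prime p" and char: "add_pow R (p) \<one> = \<zero>"
    and x: "x \<in> carrier R" and y: "y \<in> carrier R"
  shows "(x \<oplus> y) [^] (p::nat) = x [^] p \<oplus> y [^] p"
proof -
  have ann: "add_pow R c z = \<zero>" if "p dvd c" "z \<in> carrier R" for c :: nat and z
  proof -
    obtain b where b: "c = p * b" using \<open>p dvd c\<close> by blast
    have "add_pow R p z = add_pow R (p) (\<one> \<otimes> z)" using that by simp
    also have "\<dots> = (add_pow R (p) \<one>) \<otimes> z" using that by (simp add: add_pow_ldistr)
    finally have "add_pow R p z = \<zero>" using char that by simp
    then show ?thesis using that b by (simp add: add.nat_pow_pow[symmetric])
  qed
  have r: "p \<noteq> 0" using prime_gt_0_nat[OF p] by simp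
  have "(x \<oplus> y) [^] p = (\<Oplus>k\<in>{..p}. add_pow R (p choose k) (x [^] k \<otimes> y [^] (p - k)))"
    by (rule binomial_expansion[OF x y])
  also have "\<dots> = (\<Oplus>k\<in>{0, p}. add_pow R (p choose k) (x [^] k \<otimes> y [^] (p - k)))"
  proof (rule add.finprod_mono_neutral_cong_left[symmetric])
    fix k assume "k \<in> {..p} - {0, p}"
    then have "p dvd (p choose k)" using p by (intro dvd_choose_prime) auto
    then show "add_pow R (p choose k) (x [^] k \<otimes> y [^] (p - k)) = \<zero>" using x y by (intro ann) auto
  qed (use x y in auto)
  also have "\<dots> = x [^] p \<oplus> y [^] p"
    using x y r by (subst finsum_insert) (auto simp: a_comm)
  finally show ?thesis .
qed

lemma (in cring) frobenius_pow_add: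
  assumes p: "Factorial_Ring.prime p" and char: "add_pow R (p) \<one> = \<zero>"
    and x: "x \<in> carrier R" and y: "y \<in> carrier R"
  shows "(x \<oplus> y) [^] (p ^ s :: nat) = x [^] (p ^ s) \<oplus> y [^] (p ^ s)"
proof (induction s)
  case (Suc s)
  have "z [^] (p ^ Suc s) = (z [^] (p ^ s)) [^] p" if "z \<in> carrier R" for z
    using that by (simp add: nat_pow_pow mult.commute)
  then show ?case using x y by (simp only: Suc a_closed) (simp add: frobenius_add[OF p char])
qed (use x y in simp)

lemma (in cring) frobenius_finsum:
  assumes p: "Factorial_Ring.prime p" and char: "add_pow R (p) \<one> = \<zero>"
    and f: "f \<in> A \<rightarrow> carrier R" and "finite A"
  shows "(\<Oplus>i\<in>A. f i) [^] (p ^ s :: nat) = (\<Oplus>i\<in>A. f i [^] (p ^ s))"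
  using assms(4) f
proof (induction A rule: finite_induct)
  case empty
  then show ?case using prime_gt_0_nat[OF p] by (simp add: nat_pow_zero)
next
  case (insert a A)
  then have f: "f \<in> A \<rightarrow> carrier R" "f a \<in> carrier R" by auto
  have "(\<Oplus>i\<in>insert a A. f i) = f a \<oplus> (\<Oplus>i\<in>A. f i)"
    using insert.hyps f by (rule finsum_insert)
  moreover have "(\<Oplus>i\<in>insert a A. f i [^] (p ^ s)) = f a [^] (p ^ s) \<oplus> (\<Oplus>i\<in>A. f i [^] (p ^ s))"
    using insert.hyps f by (intro finsum_insert) auto
  ultimately show ?case
    using f insert.IH[OF f(1)] by (simp only: frobenius_pow_add[OF p char] finsum_closed)
qed

text \<open>Polynomials are lists of coefficients in ascending order here; \<open>apply_shift q c\<close> applies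
  the polynomial \<open>q\<close> in the shift operator to the sequence \<open>c\<close>.\<close>

fun (in ring) horner :: "'a list \<Rightarrow> 'a \<Rightarrow> 'a" where
  "horner [] x = \<zero>"
| "horner (a # q) x = a \<oplus> x \<otimes> horner q x"

fun (in ring) apply_shift :: "'a list \<Rightarrow> (nat \<Rightarrow> 'a) \<Rightarrow> nat \<Rightarrow> 'a" where
  "apply_shift [] c j = \<zero>"
| "apply_shift (a # q) c j = apply_shift q c (Suc j) \<oplus> a \<otimes> c j"

text \<open>Synthetic division by X - w: the coefficients of the quotient are the values at w of the
  tails of the polynomial.\<close>

fun (in ring) quotient :: "'a \<Rightarrow> 'a list \<Rightarrow> 'a list" where
  "quotient w [] = []"
| "quotient w [a] = []"
| "quotient w (a # b # q) = horner (b # q) w # quotient w (b # q)"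

context cring
begin

lemma horner_closed [simp, intro]: "set q \<subseteq> carrier R \<Longrightarrow> x \<in> carrier R \<Longrightarrow> horner q x \<in> carrier R"
  by (induction q) auto

lemma apply_shift_closed [simp, intro]:
  "set q \<subseteq> carrier R \<Longrightarrow> range c \<subseteq> carrier R \<Longrightarrow> apply_shift q c j \<in> carrier R"
  by (induction q arbitrary: j) (auto simp: image_subset_iff)

lemma quotient_closed:
  "set q \<subseteq> carrier R \<Longrightarrow> w \<in> carrier R \<Longrightarrow> set (quotient w q) \<subseteq> carrier R"
  by (induction w q rule: quotient.induct) auto

lemma length_quotient: "length (quotient w q) = length q - 1"
  by (induction w q rule: quotient.induct) auto

lemma last_quotient:
  "set q \<subseteq> carrier R \<Longrightarrow> w \<in> carrier R \<Longrightarrow> length q \<ge> 2 \<Longrightarrow> last (quotient w q) = last q"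
proof (induction w q rule: quotient.induct)
  case (3 w a b q)
  show ?case
  proof (cases q)
    case (Cons c q')
    then have "quotient w (b # q) \<noteq> []" by (metis length_quotient list.size(3) length_Cons diff_Suc_1 nat.distinct(1))
    then show ?thesis using 3 Cons by simp
  qed (use 3 in simp)
qed auto

text \<open>This is q = (X - w) h + q(w), with h the quotient, applied to the sequence c; the term
  with w is moved to the left to avoid subtraction.\<close>

lemma apply_shift_quotient:
  assumes "set q \<subseteq> carrier R" "w \<in> carrier R" "range c \<subseteq> carrier R"
  shows "apply_shift q c j \<oplus> w \<otimes> apply_shift (quotient w q) c j
    = apply_shift (quotient w q) c (Suc j) \<oplus> horner q w \<otimes> c j"
  using assms
proof (induction w q arbitrary: j rule: quotient.induct)
  case (3 w a b q)
  define A B h e where "A = apply_shift (b # q) c (Suc j)" and "B = apply_shift (quotient w (b # q)) c (Suc j)"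
    and "h = horner (b # q) w" and "e = apply_shift (quotient w (b # q)) c (Suc (Suc j))"
  have car: "A \<in> carrier R" "B \<in> carrier R" "h \<in> carrier R" "e \<in> carrier R" "w \<in> carrier R" "a \<in> carrier R"
    "c j \<in> carrier R" "c (Suc j) \<in> carrier R"
    unfolding A_def B_def h_def e_def using 3 quotient_closed[of "b # q" w]
    by (auto intro!: apply_shift_closed horner_closed simp del: apply_shift.simps horner.simps)
  have IH: "A \<oplus> w \<otimes> B = e \<oplus> h \<otimes> c (Suc j)"
    using 3 by (simp add: A_def B_def h_def e_def)
  have "apply_shift (a # b # q) c j \<oplus> w \<otimes> apply_shift (quotient w (a # b # q)) c j
    = (A \<oplus> a \<otimes> c j) \<oplus> w \<otimes> (B \<oplus> h \<otimes> c j)"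
    by (simp add: A_def B_def h_def)
  also have "\<dots> = (A \<oplus> w \<otimes> B) \<oplus> (a \<oplus> w \<otimes> h) \<otimes> c j"
    using car by (simp add: r_distr l_distr a_ac m_ac)
  also have "\<dots> = (e \<oplus> h \<otimes> c (Suc j)) \<oplus> (a \<oplus> w \<otimes> h) \<otimes> c j"
    by (simp only: IH)
  also have "\<dots> = apply_shift (quotient w (a # b # q)) c (Suc j) \<oplus> horner (a # b # q) w \<otimes> c j"
    by (simp add: h_def e_def)
  finally show ?case .
qed (auto simp: image_subset_iff)

text \<open>On a geometric sequence the shift is multiplication by x. Thus
  \<open>apply_shift_quotient\<close> also contains the division identity for values of polynomials,
  and one identity serves both root counting and the search for eigenvectors.\<close>

lemma apply_shift_powers:
  assumes "set q \<subseteq> carrier R" "x \<in> carrier R"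
  shows "apply_shift q (\<lambda>i. x [^] i) j = x [^] j \<otimes> horner q x"
  using assms
proof (induction q arbitrary: j)
  case (Cons a q)
  then have "x [^] Suc j \<otimes> horner q x \<oplus> a \<otimes> x [^] j = x [^] j \<otimes> (a \<oplus> x \<otimes> horner q x)"
    by (simp add: r_distr m_ac a_ac)
  then show ?case using Cons by simp
qed auto

end

text \<open>If w is a root, then q(x) = (x - w) h(x), so every other root of q is a root of the
  shorter polynomial h, which has the same leading coefficient.\<close>

lemma (in domain) card_horner_roots:
  assumes "set q \<subseteq> carrier R" "q \<noteq> []" "last q \<noteq> \<zero>"
  shows "finite {x \<in> carrier R. horner q x = \<zero>} \<and> card {x \<in> carrier R. horner q x = \<zero>} < length q"
  using assms
proof (induction "length q" arbitrary: q rule: less_induct)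
  case less
  show ?case
  proof (cases "\<exists>w \<in> carrier R. horner q w = \<zero>")
    case False
    then have e: "{x \<in> carrier R. horner q x = \<zero>} = {}" by auto
    show ?thesis unfolding e using less.prems by simp
  next
    case True
    then obtain w where w: "w \<in> carrier R" "horner q w = \<zero>" by blast
    have len: "length q \<ge> 2"
    proof (rule ccontr)
      assume "\<not> length q \<ge> 2"
      then obtain a where "q = [a]" using less.prems(2) by (cases q; cases "tl q") auto
      then show False using w less.prems by simp
    qed
    define h where "h = quotient w q"
    have h: "set h \<subseteq> carrier R" "h \<noteq> []" "last h \<noteq> \<zero>" "length h < length q"
      unfolding h_def using quotient_closed[OF less.prems(1) w(1)] length_quotient[of w q]
        last_quotient[OF less.prems(1) w(1) len] less.prems len by auto
    have sub: "{x \<in> carrier R. horner q x = \<zero>} \<subseteq> insert w {x \<in> carrier R. horner h x = \<zero>}"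
    proof
      fix x assume "x \<in> {x \<in> carrier R. horner q x = \<zero>}"
      then have x: "x \<in> carrier R" "horner q x = \<zero>" by auto
      have hx: "horner h x \<in> carrier R" using h x by auto
      have "apply_shift q (\<lambda>i. x [^] i) 0 \<oplus> w \<otimes> apply_shift h (\<lambda>i. x [^] i) 0
        = apply_shift h (\<lambda>i. x [^] i) (Suc 0) \<oplus> horner q w \<otimes> x [^] (0::nat)"
        unfolding h_def by (rule apply_shift_quotient) (use less.prems w x in auto)
      then have "w \<otimes> horner h x = x \<otimes> horner h x"
        using apply_shift_powers[OF less.prems(1) x(1)] apply_shift_powers[OF h(1) x(1)] w x hx by simp
      then have "x = w \<or> horner h x = \<zero>"
        using m_rcancel[OF _ hx w(1) x(1)] by auto
      then show "x \<in> insert w {x \<in> carrier R. horner h x = \<zero>}" using x by auto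
    qed
    have IH: "finite {x \<in> carrier R. horner h x = \<zero>}" "card {x \<in> carrier R. horner h x = \<zero>} < length h"
      using less.hyps[OF h(4) h(1-3)] by auto
    have "card {x \<in> carrier R. horner q x = \<zero>} \<le> card (insert w {x \<in> carrier R. horner h x = \<zero>})"
      using IH by (intro card_mono sub) auto
    also have "\<dots> \<le> Suc (card {x \<in> carrier R. horner h x = \<zero>})" by (rule card_insert_le_m1) auto
    also have "\<dots> < length q" using IH h(4) by linarith
    finally show ?thesis using finite_subset[OF sub] IH by auto
  qed
qed

lemma (in algebraically_closed) horner_root:
  assumes "set q \<subseteq> carrier L" "length q \<ge> 2" "last q \<noteq> \<zero>"
  shows "\<exists>w \<in> carrier L. horner q w = \<zero>"
proof -
  \<comment> \<open>\<open>eval\<close> expects the leading coefficient first, hence the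
    reversal.\<close>
  have ev: "eval (rev q) x = horner q x" if "set q \<subseteq> carrier L" "x \<in> carrier L" for q x
    using that
  proof (induction q)
    case (Cons a q)
    have "eval (rev q @ [a]) x = eval (rev q) x \<otimes> x \<oplus> a"
      using Cons.prems by (intro eval_append_aux) auto
    then show ?case using Cons by (simp add: m_comm a_comm)
  qed simp
  define P where "P = rev q"
  have P: "P \<in> carrier (poly_ring L)" "degree P \<ge> 1"
    using assms by (auto simp: P_def univ_poly_carrier[symmetric] polynomial_def hd_rev)
  then have "size (roots P) \<noteq> 0"
    using roots_over_carrier[OF P(1)] by (simp add: splitted_def)
  then obtain w where "w \<in># roots P" by (metis multiset_nonemptyE size_empty)
  then have "is_root P w" using roots_mem_iff_is_root[OF P(1)] by simp
  then show ?thesis using ev[OF assms(1)] by (auto simp: is_root_def P_def)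
qed

text \<open>If \<open>w\<close> is a root of \<open>q\<close>, then the quotient of \<open>q\<close> by \<open>X - w\<close>, applied to \<open>c\<close>, yields a
  geometric sequence with ratio \<open>w\<close>, or else annihilates \<open>c\<close> and replaces \<open>q\<close>.\<close>

lemma (in algebraically_closed) geometric_sequence_exists:
  assumes q: "set q \<subseteq> carrier L" "q \<noteq> []" "last q = \<one>"
    and Psi: "\<And>c. c \<in> \<Psi> \<Longrightarrow> range c \<subseteq> carrier L" "(\<lambda>_. \<zero>) \<in> \<Psi>"
      "\<And>c d a. c \<in> \<Psi> \<Longrightarrow> d \<in> \<Psi> \<Longrightarrow> a \<in> carrier L \<Longrightarrow> (\<lambda>j. d (Suc j) \<oplus> a \<otimes> c j) \<in> \<Psi>"
    and c: "c \<in> \<Psi>" "c i \<noteq> \<zero>" "\<And>j. apply_shift q c j = \<zero>"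
  shows "\<exists>w \<in> carrier L. \<exists>b \<in> carrier L - {\<zero>}. (\<lambda>j. w [^] j \<otimes> b) \<in> \<Psi>"
  using q c(3)
proof (induction "length q" arbitrary: q rule: less_induct)
  case less
  have cL: "range c \<subseteq> carrier L" using Psi(1)[OF c(1)] .
  \<comment> \<open>The closure hypothesis on \<Psi> is a single Horner step in the shift operator;
    iterating it shows that every polynomial in the shift maps c into \<Psi>.\<close>
  have shift_Psi: "apply_shift h c \<in> \<Psi>" if "set h \<subseteq> carrier L" for h
    using that
  proof (induction h)
    case Nil
    have "apply_shift [] c = (\<lambda>_. \<zero>)" by (simp add: fun_eq_iff)
    then show ?case using Psi(2) by simp
  next
    case (Cons a h)
    have "apply_shift (a # h) c = (\<lambda>j. apply_shift h c (Suc j) \<oplus> a \<otimes> c j)" by (simp add: fun_eq_iff)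
    then show ?case using Psi(3)[OF c(1) Cons.IH] Cons.prems by simp
  qed
  \<comment> \<open>A monic polynomial of length one is the constant 1 and cannot annihilate c,
    which has a nonzero entry.\<close>
  have len: "length q \<ge> 2"
  proof (rule ccontr)
    assume "\<not> length q \<ge> 2"
    then obtain a where "q = [a]" using less.prems(2) by (cases q; cases "tl q") auto
    moreover have "c i \<in> carrier L" using cL by auto
    ultimately show False using less.prems(3) less.prems(4)[of i] c(2) by simp
  qed
  obtain w where w: "w \<in> carrier L" "horner q w = \<zero>"
    using horner_root[OF less.prems(1) len] less.prems(3) by auto
  define h where "h = quotient w q"
  have h: "set h \<subseteq> carrier L" "h \<noteq> []" "last h = \<one>" "length h < length q"
    unfolding h_def using quotient_closed[OF less.prems(1) w(1)] length_quotient[of w q]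
      last_quotient[OF less.prems(1) w(1) len] less.prems len by auto
  define u where "u = apply_shift h c"
  have u: "u j \<in> carrier L" for j unfolding u_def using h cL by auto
  have step: "u (Suc j) = w \<otimes> u j" for j
    using apply_shift_quotient[OF less.prems(1) w(1) cL, of j] less.prems(4)[of j] w cL u
    by (simp add: h_def[symmetric] u_def[symmetric] image_subset_iff)
  have geo: "u j = w [^] j \<otimes> u 0" for j
    by (induction j) (use u w in \<open>simp_all add: step m_ac\<close>)
  show ?case
  proof (cases "u 0 = \<zero>")
    case True
    then have "apply_shift h c j = \<zero>" for j using geo[of j] w by (simp add: u_def)
    then show ?thesis using less.hyps[OF h(4) h(1-3)] by blast
  next
    case False
    have "u = (\<lambda>j. w [^] j \<otimes> u 0)" using geo by (rule ext)
    then have "(\<lambda>j. w [^] j \<otimes> u 0) \<in> \<Psi>" using shift_Psi[OF h(1)] u_def by metis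
    then show ?thesis using False u w by blast
  qed
qed

section \<open>Linearized polynomials and relations between conjugates\<close>

definition (in ring) frob_comb :: "nat \<Rightarrow> nat \<Rightarrow> (nat \<Rightarrow> 'a) \<Rightarrow> 'a \<Rightarrow> 'a" where
  "frob_comb u k c x = (\<Oplus>i\<in>{..<k}. c i \<otimes> x [^] (u ^ i))"

lemma (in cring) finsum_shift_periodic:
  fixes k :: nat and G :: "nat \<Rightarrow> 'a"
  assumes G: "range G \<subseteq> carrier R" and per: "\<And>i. G (i + k) = G i"
  shows "(\<Oplus>i\<in>{..<k}. G (Suc i)) = (\<Oplus>i\<in>{..<k}. G i)"
proof (cases k)
  case (Suc k')
  have Gc: "G i \<in> carrier R" for i using G by auto
  have "(\<Oplus>i\<in>{..k'}. G (Suc i)) \<oplus> G 0 = (\<Oplus>i\<in>{..Suc k'}. G i)"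
    using Gc by (subst finsum_Suc2) auto
  also have "\<dots> = G (Suc k') \<oplus> (\<Oplus>i\<in>{..k'}. G i)"
    using Gc by (subst finsum_Suc) auto
  also have "\<dots> = (\<Oplus>i\<in>{..k'}. G i) \<oplus> G 0"
    using Gc per[of 0] Suc by (simp add: a_comm finsum_closed Pi_def)
  finally have "(\<Oplus>i\<in>{..k'}. G (Suc i)) = (\<Oplus>i\<in>{..k'}. G i)"
    using Gc by (subst (asm) add.r_cancel) (auto simp: finsum_closed Pi_def)
  then show ?thesis by (simp add: Suc lessThan_Suc_atMost)
qed simp

text \<open>The set \<Psi> of k-periodic sequences orthogonal to all shifts of v is stable under the
  shift and annihilated by X^k - 1. It therefore contains a geometric sequence, and periodicity
  makes the ratio a k-th root of unity. A single eigenvector suffices, so k may be divisible by the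
  characteristic.\<close>

lemma (in algebraically_closed) root_of_unity_relation:
  fixes k :: nat and v c :: "nat \<Rightarrow> 'a"
  assumes k: "k > 0" and v: "range v \<subseteq> carrier L" "\<And>j. v (j + k) = v j"
    and c: "range c \<subseteq> carrier L" "\<And>j. c (j + k) = c j" "c i0 \<noteq> \<zero>"
      "\<And>j. (\<Oplus>i\<in>{..<k}. c i \<otimes> v (i + j)) = \<zero>"
  shows "\<exists>w \<in> carrier L. w [^] k = \<one> \<and> (\<Oplus>i\<in>{..<k}. w [^] i \<otimes> v i) = \<zero>"
proof -
  define \<Psi> where "\<Psi> = {c. range c \<subseteq> carrier L \<and> (\<forall>j. c (j + k) = c j) \<and>
    (\<forall>j. (\<Oplus>i\<in>{..<k}. c i \<otimes> v (i + j)) = \<zero>)}"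
  define q where "q = \<ominus> \<one> # replicate (k - 1) \<zero> @ [\<one>]"
  have vc: "v j \<in> carrier L" for j using v(1) by auto
  have app: "apply_shift (replicate n \<zero> @ [\<one>]) d j = d (j + n)" if "range d \<subseteq> carrier L" for n d j
    using that by (induction n arbitrary: j) (auto simp: image_subset_iff)
  have "\<exists>w \<in> carrier L. \<exists>b \<in> carrier L - {\<zero>}. (\<lambda>j. w [^] j \<otimes> b) \<in> \<Psi>"
  proof (rule geometric_sequence_exists[where q = q and c = c and i = i0])
    show "set q \<subseteq> carrier L" "q \<noteq> []" "last q = \<one>" by (auto simp: q_def)
    show "range d \<subseteq> carrier L" if "d \<in> \<Psi>" for d using that by (simp add: \<Psi>_def)
    show "(\<lambda>_. \<zero>) \<in> \<Psi>" using vc by (auto simp: \<Psi>_def)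
    show "c \<in> \<Psi>" using c by (simp add: \<Psi>_def)
    show "c i0 \<noteq> \<zero>" by fact
    have ck: "c j \<in> carrier L" for j using c(1) by auto
    show "apply_shift q c j = \<zero>" for j
    proof -
      have "apply_shift q c j = c (Suc j + (k - 1)) \<oplus> \<ominus> \<one> \<otimes> c j"
        using app[OF c(1)] by (simp add: q_def)
      also have "Suc j + (k - 1) = j + k" using k by simp
      finally show ?thesis using ck c(2) by (simp add: l_minus r_neg)
    qed
    fix d e a assume d: "d \<in> \<Psi>" and e: "e \<in> \<Psi>" and a: "a \<in> carrier L"
    have dc: "d j \<in> carrier L" and ec: "e j \<in> carrier L" for j using d e by (auto simp: \<Psi>_def)
    have per: "d (j + k) = d j" "e (j + k) = e j" for j using d e by (auto simp: \<Psi>_def)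
    have rel: "(\<Oplus>i\<in>{..<k}. (e (Suc i) \<oplus> a \<otimes> d i) \<otimes> v (i + j)) = \<zero>" for j
    proof -
      \<comment> \<open>The index j + k - 1 stands for j - 1 modulo the period k and stays a natural
        number. With it, shifting e amounts to shifting G.\<close>
      define G where "G i = e i \<otimes> v (i + (j + k - 1))" for i
      have G: "range G \<subseteq> carrier L" using ec vc by (auto simp: G_def)
      have Gp: "G (i + k) = G i" for i
        using per(2)[of i] v(2)[of "i + (j + k - 1)"] by (simp add: G_def algebra_simps)
      have GS: "e (Suc i) \<otimes> v (i + j) = G (Suc i)" for i
      proof -
        have "Suc i + (j + k - 1) = i + j + k" using k by simp
        then show ?thesis unfolding G_def using v(2)[of "i + j"] by (simp only:)
      qed
      have "(\<Oplus>i\<in>{..<k}. (e (Suc i) \<oplus> a \<otimes> d i) \<otimes> v (i + j))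
        = (\<Oplus>i\<in>{..<k}. G (Suc i) \<oplus> a \<otimes> (d i \<otimes> v (i + j)))"
        using dc ec vc a by (intro finsum_cong') (auto simp: GS[symmetric] l_distr m_assoc)
      also have "\<dots> = (\<Oplus>i\<in>{..<k}. G (Suc i)) \<oplus> (\<Oplus>i\<in>{..<k}. a \<otimes> (d i \<otimes> v (i + j)))"
        using dc vc a G by (intro finsum_addf) auto
      also have "(\<Oplus>i\<in>{..<k}. a \<otimes> (d i \<otimes> v (i + j))) = a \<otimes> (\<Oplus>i\<in>{..<k}. d i \<otimes> v (i + j))"
        using dc vc a by (intro finsum_rdistr[symmetric]) auto
      also have "(\<Oplus>i\<in>{..<k}. d i \<otimes> v (i + j)) = \<zero>" using d by (simp add: \<Psi>_def)
      also have "(\<Oplus>i\<in>{..<k}. G (Suc i)) = (\<Oplus>i\<in>{..<k}. G i)"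
        by (rule finsum_shift_periodic[OF G Gp])
      also have "\<dots> = \<zero>" using e unfolding G_def \<Psi>_def by blast
      finally show ?thesis using a by simp
    qed
    show "(\<lambda>j. e (Suc j) \<oplus> a \<otimes> d j) \<in> \<Psi>"
      unfolding \<Psi>_def using dc ec per(1) per(2)[of "Suc _"] a rel by (auto simp del: finsum_closed)
  qed
  then obtain w b where w: "w \<in> carrier L" and b: "b \<in> carrier L" "b \<noteq> \<zero>"
    and in_Psi: "(\<lambda>j. w [^] j \<otimes> b) \<in> \<Psi>" by blast
  have "w [^] k \<otimes> b = \<one> \<otimes> b"
    using in_Psi w b unfolding \<Psi>_def by (auto dest!: spec[of _ 0])
  then have wk: "w [^] k = \<one>" using b w m_rcancel[of b "w [^] k" "\<one>"] by blast
  have "(\<Oplus>i\<in>{..<k}. (w [^] i \<otimes> b) \<otimes> v (i + 0)) = \<zero>"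
    using in_Psi unfolding \<Psi>_def by blast
  moreover have "(\<Oplus>i\<in>{..<k}. (w [^] i \<otimes> b) \<otimes> v (i + 0)) = (\<Oplus>i\<in>{..<k}. b \<otimes> (w [^] i \<otimes> v i))"
    using w b vc by (intro finsum_cong') (auto simp: m_ac)
  moreover have "\<dots> = b \<otimes> (\<Oplus>i\<in>{..<k}. w [^] i \<otimes> v i)"
    using w b vc by (intro finsum_rdistr[symmetric]) auto
  moreover have "(\<Oplus>i\<in>{..<k}. w [^] i \<otimes> v i) \<in> carrier L" using w vc by (auto intro!: finsum_closed)
  ultimately have "(\<Oplus>i\<in>{..<k}. w [^] i \<otimes> v i) = \<zero>" using b integral by auto
  then show ?thesis using w wk by blast
qed

lemma (in cring) frob_comb_closed:
  "(\<And>i. i < k \<Longrightarrow> c i \<in> carrier R) \<Longrightarrow> x \<in> carrier R \<Longrightarrow> frob_comb u k c x \<in> carrier R"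
  unfolding frob_comb_def by (rule finsum_closed) auto

text \<open>The u-th power map fixes the coefficients and permutes the conjugates of y cyclically.
  Raising the one given relation to the powers u^j thus supplies the relations for all shifts
  required by \<open>root_of_unity_relation\<close>.\<close>

lemma (in algebraically_closed) frob_comb_root_of_unity:
  assumes p: "Factorial_Ring.prime p" and char: "add_pow L p \<one> = \<zero>" and u: "u = p ^ s"
    and k: "k > 0" and y: "y \<in> carrier L" "y [^] (u ^ k) = y"
    and c: "\<And>i. i < k \<Longrightarrow> c i \<in> carrier L" "\<And>i. i < k \<Longrightarrow> c i [^] u = c i" "i0 < k" "c i0 \<noteq> \<zero>"
    and rel: "frob_comb u k c y = \<zero>"
  shows "\<exists>w \<in> carrier L. w [^] k = \<one> \<and> frob_comb u k (\<lambda>i. w [^] i) y = \<zero>"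
  unfolding frob_comb_def
proof (rule root_of_unity_relation[OF k, where c = "\<lambda>i. c (i mod k)" and ?i0.0 = i0])
  show "range (\<lambda>j. y [^] (u ^ j)) \<subseteq> carrier L" using y by auto
  show "y [^] (u ^ (j + k)) = y [^] (u ^ j)" for j
  proof -
    have "y [^] (u ^ (j + k)) = (y [^] (u ^ k)) [^] (u ^ j)"
      using y(1) by (simp add: nat_pow_pow power_add mult.commute)
    then show ?thesis using y(2) by simp
  qed
  show "range (\<lambda>i. c (i mod k)) \<subseteq> carrier L" using c(1) k by auto
  show "c ((j + k) mod k) = c (j mod k)" for j by simp
  show "c (i0 mod k) \<noteq> \<zero>" using c by simp
  have cpow: "c i [^] (u ^ j) = c i" if "i < k" for i j
  proof (induction j)
    case (Suc j)
    have "c i [^] (u ^ Suc j) = (c i [^] (u ^ j)) [^] u"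
      using c(1)[OF that] by (simp add: nat_pow_pow mult.commute)
    then show ?case using Suc c(2)[OF that] by simp
  qed (use c(1)[OF that] in simp)
  show "(\<Oplus>i\<in>{..<k}. c (i mod k) \<otimes> y [^] (u ^ (i + j))) = \<zero>" for j
  proof -
    have uj: "u ^ j = p ^ (s * j)" by (simp add: u power_mult)
    have "(\<Oplus>i\<in>{..<k}. c (i mod k) \<otimes> y [^] (u ^ (i + j)))
      = (\<Oplus>i\<in>{..<k}. (c i \<otimes> y [^] (u ^ i)) [^] (u ^ j))"
      using c(1) y(1) cpow by (intro finsum_cong') (auto simp: nat_pow_distrib nat_pow_pow power_add)
    also have "\<dots> = (\<Oplus>i\<in>{..<k}. c i \<otimes> y [^] (u ^ i)) [^] (u ^ j)"
      unfolding uj using c(1) y(1) by (intro frobenius_finsum[OF p char, symmetric]) auto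
    also have "\<dots> = \<zero>"
      using rel prime_gt_0_nat[OF p] unfolding frob_comb_def u by (simp add: nat_pow_zero)
    finally show ?thesis .
  qed
qed

lemma (in cring) horner_eq_finsum:
  assumes "set q \<subseteq> carrier R" "x \<in> carrier R"
  shows "horner q x = (\<Oplus>t\<in>{..<length q}. q ! t \<otimes> x [^] t)"
  using assms(1)
proof (induction q)
  case (Cons a q)
  have qc: "q ! t \<in> carrier R" if "t < length q" for t using Cons.prems that by (auto simp: subset_iff)
  have nc: "(a # q) ! t \<in> carrier R" if "t \<le> length q" for t
    using qc Cons.prems that by (cases t) auto
  show ?case
  proof (cases "q = []")
    case False
    then obtain r where r: "length q = Suc r" by (cases q) auto
    have "(\<Oplus>t\<in>{..<length (a # q)}. (a # q) ! t \<otimes> x [^] t) = (\<Oplus>t\<in>{..Suc r}. (a # q) ! t \<otimes> x [^] t)"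
      by (simp add: r lessThan_Suc_atMost)
    also have "\<dots> = (\<Oplus>t\<in>{..r}. (a # q) ! Suc t \<otimes> x [^] Suc t) \<oplus> (a # q) ! 0 \<otimes> x [^] (0::nat)"
      using nc r assms(2) by (intro finsum_Suc2) auto
    also have "(\<Oplus>t\<in>{..r}. (a # q) ! Suc t \<otimes> x [^] Suc t) = (\<Oplus>t\<in>{..r}. x \<otimes> (q ! t \<otimes> x [^] t))"
      using qc r assms(2) by (intro finsum_cong') (auto simp: m_ac)
    also have "\<dots> = x \<otimes> (\<Oplus>t\<in>{..r}. q ! t \<otimes> x [^] t)"
      using qc r assms(2) by (intro finsum_rdistr[symmetric]) auto
    also have "{..r} = {..<length q}" using r by (simp add: lessThan_Suc_atMost)
    also have "(\<Oplus>t\<in>{..<length q}. q ! t \<otimes> x [^] t) = horner q x" using Cons by simp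
    finally show ?thesis using Cons.prems assms(2) by (simp add: a_comm)
  qed (use Cons assms in \<open>simp add: lessThan_Suc\<close>)
qed simp

text \<open>Read as an ordinary sparse polynomial, the linearized polynomial has degree
  u^(k-1).\<close>

lemma (in domain) card_frob_comb_roots:
  assumes u: "u \<ge> 2" and k: "k > 0" and c: "\<And>i. i < k \<Longrightarrow> c i \<in> carrier R" "c (k - 1) \<noteq> \<zero>"
  shows "finite {x \<in> carrier R. frob_comb u k c x = \<zero>}
    \<and> card {x \<in> carrier R. frob_comb u k c x = \<zero>} \<le> u ^ (k - 1)"
proof -
  define D where "D = u ^ (k - 1)"
  have inj: "inj_on (\<lambda>i. u ^ i) {..<k}" using u by (auto simp: inj_on_def)
  define f where "f t = (if t \<in> (\<lambda>i. u ^ i) ` {..<k} then c (inv_into {..<k} (\<lambda>i. u ^ i) t) else \<zero>)" for t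
  define q where "q = map f [0..<Suc D]"
  have fu: "f (u ^ i) = c i" if "i < k" for i
    using that inj by (auto simp: f_def inv_into_f_f)
  have fc: "f t \<in> carrier R" for t using fu by (cases "t \<in> (\<lambda>i. u ^ i) ` {..<k}") (use c in \<open>auto simp: f_def\<close>)
  have le: "u ^ i \<le> D" if "i < k" for i
    unfolding D_def using that u by (intro power_increasing) auto
  have len: "length q = Suc D" by (simp add: q_def)
  have eq: "horner q x = frob_comb u k c x" if x: "x \<in> carrier R" for x
  proof -
    have "horner q x = (\<Oplus>t\<in>{..<Suc D}. f t \<otimes> x [^] t)"
      using fc x by (subst horner_eq_finsum) (auto simp: q_def intro!: finsum_cong' simp del: upt_Suc)
    also have "\<dots> = (\<Oplus>t\<in>(\<lambda>i. u ^ i) ` {..<k}. f t \<otimes> x [^] t)"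
      by (rule add.finprod_mono_neutral_cong_left[symmetric])
        (use fc x le in \<open>auto simp: f_def less_Suc_eq_le\<close>)
    also have "\<dots> = (\<Oplus>i\<in>{..<k}. f (u ^ i) \<otimes> x [^] (u ^ i))"
      using fc x by (intro finsum_reindex inj) auto
    also have "\<dots> = frob_comb u k c x"
      unfolding frob_comb_def using fu c x by (intro finsum_cong') auto
    finally show ?thesis .
  qed
  have "set q \<subseteq> carrier R" "q \<noteq> []" using fc by (auto simp: q_def)
  moreover have "last q \<noteq> \<zero>"
    using fu[of "k - 1"] k c(2) unfolding q_def D_def by simp
  ultimately have "finite {x \<in> carrier R. horner q x = \<zero>}
      \<and> card {x \<in> carrier R. horner q x = \<zero>} < length q"
    by (rule card_horner_roots)
  moreover have "{x \<in> carrier R. horner q x = \<zero>} = {x \<in> carrier R. frob_comb u k c x = \<zero>}"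
    using eq by auto
  ultimately show ?thesis by (simp add: len D_def)
qed

section \<open>Conjugates over intermediate fields\<close>

lemma (in cring) combine_eq_finsum:
  assumes "length Ks = k" "set Ks \<subseteq> carrier R" "\<And>i. i < k \<Longrightarrow> f i \<in> carrier R"
  shows "combine Ks (map f [0..<k]) = (\<Oplus>i\<in>{..<k}. Ks ! i \<otimes> f i)"
  using assms
proof (induction Ks arbitrary: k f)
  case (Cons a Ks)
  then obtain k' where k: "k = Suc k'" by (cases k) auto
  have Kc: "Ks ! i \<in> carrier R" if "i < k'" for i using Cons.prems k that by (auto simp: subset_iff)
  have fc: "f i \<in> carrier R" if "i \<le> k'" for i using Cons.prems k that by auto
  have ac: "(a # Ks) ! i \<in> carrier R" if "i \<le> k'" for i using Kc Cons.prems k that by (cases i) auto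
  have "map f [0..<k] = f 0 # map (\<lambda>i. f (Suc i)) [0..<k']"
    unfolding k by (simp only: upt_conv_Cons[of 0 "Suc k'"] map_Suc_upt[symmetric]) (simp add: o_def)
  then have "combine (a # Ks) (map f [0..<k]) = a \<otimes> f 0 \<oplus> (\<Oplus>i\<in>{..<k'}. Ks ! i \<otimes> f (Suc i))"
    using Cons.IH[of k' "\<lambda>i. f (Suc i)"] Cons.prems k by simp
  also have "\<dots> = (\<Oplus>i\<in>{..<k}. (a # Ks) ! i \<otimes> f i)"
  proof (cases k')
    case 0
    then show ?thesis using ac fc Cons.prems k by (simp add: lessThan_Suc)
  next
    case (Suc k'')
    have "(\<Oplus>i\<in>{..<k}. (a # Ks) ! i \<otimes> f i) = (\<Oplus>i\<in>{..Suc k''}. (a # Ks) ! i \<otimes> f i)"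
      by (simp add: k Suc lessThan_Suc_atMost)
    also have "\<dots> = (\<Oplus>i\<in>{..k''}. Ks ! i \<otimes> f (Suc i)) \<oplus> a \<otimes> f 0"
      using ac fc Suc by (subst finsum_Suc2) auto
    finally show ?thesis
      using Kc fc Cons.prems k Suc by (simp add: lessThan_Suc_atMost a_comm finsum_closed Pi_def)
  qed
  finally show ?case .
qed simp

lemma minus_one_dvd_power:
  fixes a :: nat
  assumes "a \<ge> 1"
  shows "(a - 1) dvd (a ^ k - 1)"
proof (induction k)
  case (Suc k)
  have "a ^ Suc k - 1 = a * (a ^ k - 1) + (a - 1)"
    using assms one_le_power[OF assms, of k] by (simp add: algebra_simps)
  then show ?case using Suc by simp
qed simp

section \<open>Intermediate fields and complete normality as independence\<close>

locale finite_field_pow = finite_field_gen R g for R (structure) and g +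
  fixes p e q n :: nat
  assumes p: "Factorial_Ring.prime p" and e: "e \<ge> 1" and q: "q = p ^ e" and n: "n \<ge> 1"
    and card_R: "card (carrier R) = q ^ n"
begin

lemma q_ge_2: "q \<ge> 2"
proof -
  have "p ^ 1 \<le> p ^ e" using prime_gt_0_nat[OF p] e by (intro power_increasing) auto
  then show ?thesis using prime_ge_2_nat[OF p] by (simp add: q)
qed

lemma N_eq: "N = q ^ n - 1" by (simp add: N_def card_R)

text \<open>The p^k-fold multiple of 1 is the k-th power of the p-fold multiple. As the order of the
  additive group annihilates 1, the p-fold multiple is nilpotent, hence zero.\<close>

lemma char_p: "add_pow R p \<one> = \<zero>"
proof -
  have fin_add: "finite (carrier (add_monoid R))" using fin by simp
  have "add_pow R (card (carrier R)) \<one> = \<zero>"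
    using add.pow_order_eq_1[of \<one>] by (simp add: order_def)
  then have *: "add_pow R (p ^ (e * n)) \<one> = \<zero>" by (simp add: card_R q power_mult)
  have "add_pow R (p ^ k) \<one> = (add_pow R p \<one>) [^] k" for k
  proof (induction k)
    case (Suc k)
    have "add_pow R (p ^ Suc k) \<one> = add_pow R (p ^ k) (add_pow R p \<one>)"
      by (simp add: add.nat_pow_pow mult.commute)
    also have "\<dots> = add_pow R (p ^ k) (\<one> \<otimes> add_pow R p \<one>)" by simp
    also have "\<dots> = add_pow R (p ^ k) \<one> \<otimes> add_pow R p \<one>" by (simp add: add_pow_ldistr)
    finally show ?case using Suc by simp
  qed simp
  then have "(add_pow R p \<one>) [^] (e * n) = \<zero>" using * by simp
  then show ?thesis using nat_pow_nonzero by (metis add.nat_pow_closed one_closed)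
qed

lemma pow_card: "x \<in> carrier R \<Longrightarrow> x [^] (q ^ n) = x"
proof (cases "x = \<zero>")
  case True
  then show ?thesis using q_ge_2 by (simp add: nat_pow_zero)
next
  case False
  assume x: "x \<in> carrier R"
  have "x [^] (N + 1) = g [^] (ind x * (N + 1))"
    using nat_pow_pow[OF g_carrier, of "ind x" "N + 1"] g_pow_ind[OF x False] by simp
  also have "\<dots> = g [^] ind x"
    by (simp only: g_pow_eq_iff) (simp add: algebra_simps)
  finally have "x [^] (N + 1) = x" using g_pow_ind[OF x False] by simp
  moreover have "q ^ n = N + 1" using card_carrier card_R by simp
  ultimately show ?thesis by simp
qed

lemma q_pow_add:
  assumes "x \<in> carrier R" "y \<in> carrier R"
  shows "(x \<oplus> y) [^] (q ^ d) = x [^] (q ^ d) \<oplus> y [^] (q ^ d)"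
  using frobenius_pow_add[OF p char_p assms, of "e * d"] by (simp add: q power_mult)

lemma q_pow_minus:
  assumes "x \<in> carrier R"
  shows "(\<ominus> x) [^] (q ^ d) = \<ominus> (x [^] (q ^ d))"
proof -
  have "x [^] (q ^ d) \<oplus> (\<ominus> x) [^] (q ^ d) = \<zero>"
    using q_pow_add[of x "\<ominus> x" d] assms q_ge_2 by (simp add: r_neg nat_pow_zero)
  then show ?thesis using assms by (metis a_comm a_inv_closed minus_equality nat_pow_closed)
qed

text \<open>The fixed field of a power of Frobenius; for d dividing n it is the subfield with q^d
  elements by \<open>card_K\<close>.\<close>

definition K :: "nat \<Rightarrow> 'a set" where "K d = {x \<in> carrier R. x [^] (q ^ d) = x}"

lemma K_subset: "K d \<subseteq> carrier R" by (auto simp: K_def)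

lemma zero_K: "\<zero> \<in> K d" using q_ge_2 by (simp add: K_def nat_pow_zero)

lemma K_subfield: "subfield (K d) R"
proof (rule subfieldI')
  show "subring (K d) R"
  proof (rule subringI)
    show "K d \<subseteq> carrier R" by (rule K_subset)
    show "\<one> \<in> K d" by (simp add: K_def)
    show "\<ominus> x \<in> K d" if "x \<in> K d" for x using that by (simp add: K_def q_pow_minus)
    show "x \<otimes> y \<in> K d" if "x \<in> K d" "y \<in> K d" for x y
      using that by (simp add: K_def nat_pow_distrib)
    show "x \<oplus> y \<in> K d" if "x \<in> K d" "y \<in> K d" for x y using that by (simp add: K_def q_pow_add)
  qed
  fix x assume x: "x \<in> K d - {\<zero>}"
  then have xU: "x \<in> Units R" using K_subset field_Units by auto
  have "x \<otimes> (inv x) [^] (q ^ d) = x [^] (q ^ d) \<otimes> (inv x) [^] (q ^ d)"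
    using x by (simp add: K_def)
  also have "\<dots> = (x \<otimes> inv x) [^] (q ^ d)"
    by (rule nat_pow_distrib[symmetric]) (use xU in auto)
  also have "\<dots> = \<one>" using xU by simp
  finally have "inv x = (inv x) [^] (q ^ d)"
    using xU by (intro comm_inv_char) (auto simp: Units_closed)
  then show "inv x \<in> K d" using xU by (simp add: K_def)
qed

lemma pow_minus_one_dvd:
  assumes "d dvd n"
  shows "(q ^ d - 1) dvd (q ^ n - 1)"
proof -
  obtain k where k: "n = d * k" using assms by blast
  show ?thesis using minus_one_dvd_power[of "q ^ d" k] q_ge_2 by (simp add: k power_mult)
qed

lemma K_pow: "y \<in> K d \<Longrightarrow> y [^] (j::nat) \<in> K d"
  by (auto simp: K_def nat_pow_pow) (metis mult.commute nat_pow_pow)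

lemma in_K_nonzero_iff:
  assumes "x \<in> carrier R" "x \<noteq> \<zero>"
  shows "x \<in> K d \<longleftrightarrow> x [^] (q ^ d - 1) = \<one>"
proof -
  have "x [^] (q ^ d) = x [^] (Suc (q ^ d - 1))" using q_ge_2 by simp
  then have "x [^] (q ^ d) = x [^] (q ^ d - 1) \<otimes> x" by simp
  then show ?thesis using assms m_rcancel[of x "x [^] (q ^ d - 1)" \<one>] by (simp add: K_def)
qed

text \<open>With r = N / (q^d - 1), the nonzero elements of \<open>K d\<close> are the powers of
  g^r, and there are q^d - 1 of them.\<close>

lemma card_K:
  assumes d: "d dvd n"
  shows "card (K d) = q ^ d"
proof -
  have d0: "d > 0" using d n by (auto intro: Nat.gr0I)
  define D where "D = q ^ d - 1"
  have qd: "q ^ d \<ge> 2" using q_ge_2 d0 power_increasing[of 1 d q] by simp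
  have D: "D > 0" using qd by (simp add: D_def)
  obtain r where r: "N = D * r" using pow_minus_one_dvd[OF d] by (auto simp: N_eq D_def)
  have r0: "r > 0" using r N_pos by (cases r) auto
  have "bij_betw (\<lambda>t. g [^] (r * t)) {..<D} (K d - {\<zero>})"
  proof (rule bij_betwI[where g = "\<lambda>x. ind x div r"])
    show "(\<lambda>t. g [^] (r * t)) \<in> {..<D} \<rightarrow> K d - {\<zero>}"
    proof
      fix t
      have "(g [^] (r * t)) [^] D = g [^] (N * t)"
        using g_carrier by (simp add: nat_pow_pow r mult_ac)
      also have "\<dots> = g [^] (0::nat)" by (simp only: g_pow_eq_iff) simp
      finally show "g [^] (r * t) \<in> K d - {\<zero>}" by (simp add: in_K_nonzero_iff D_def)
    qed
    have *: "g [^] (r * (ind x div r)) = x" "ind x div r < D" if x: "x \<in> K d - {\<zero>}" for x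
    proof -
      have xR: "x \<in> carrier R" "x \<noteq> \<zero>" using x K_subset by auto
      have "x [^] D = \<one>" using x xR in_K_nonzero_iff by (simp add: D_def)
      then have "g [^] (ind x * D) = g [^] (0::nat)"
        using g_pow_ind[OF xR] nat_pow_pow[OF g_carrier, of "ind x" D] by simp
      then have "(ind x * D) mod N = 0 mod N" by (simp only: g_pow_eq_iff)
      then have "N dvd ind x * D" by (simp add: mod_eq_0_iff_dvd)
      then have "r dvd ind x" using D by (simp add: r mult.commute[of D])
      then show "g [^] (r * (ind x div r)) = x" using g_pow_ind[OF xR] by simp
      show "ind x div r < D"
        using ind_less[OF xR] r0 by (simp add: r less_mult_imp_div_less)
    qed
    show "(\<lambda>x. ind x div r) \<in> K d - {\<zero>} \<rightarrow> {..<D}" using *(2) by blast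
    show "g [^] (r * (ind x div r)) = x" if "x \<in> K d - {\<zero>}" for x by (rule *(1)[OF that])
    show "ind (g [^] (r * t)) div r = t" if "t \<in> {..<D}" for t
      using that r0 by (simp add: ind_g_pow r mult.commute[of D])
  qed
  then have "card (K d - {\<zero>}) = D" by (simp add: bij_betw_same_card[symmetric])
  moreover have "finite (K d)" using K_subset fin finite_subset by blast
  ultimately show ?thesis using zero_K[of d] qd by (simp add: card_Diff_singleton D_def)
qed

text \<open>Independence of the conjugates over all intermediate fields at once, with coefficient
  functions in place of lists. Spanning is left out because it follows by counting in
  \<open>completely_normalI\<close>.\<close>

definition indep_conjugates :: "'a \<Rightarrow> bool" where
  "indep_conjugates x \<longleftrightarrow> (\<forall>d c. d dvd n \<longrightarrow> (\<forall>i<n div d. c i \<in> K d) \<longrightarrow>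
     frob_comb (q ^ d) (n div d) c x = \<zero> \<longrightarrow> (\<forall>i<n div d. c i = \<zero>))"

lemma completely_normalI:
  assumes x: "x \<in> carrier R" and ind: "indep_conjugates x"
  shows "completely_normal R q n x"
  unfolding completely_normal_def
proof (intro allI impI)
  fix d assume "0 < d \<and> d dvd n"
  then have d: "d dvd n" "d > 0" by auto
  define k where "k = n div d"
  have dk: "d * k = n" using d by (simp add: k_def)
  define f where "f i = x [^] (q ^ (d * i))" for i
  define Us where "Us = map f [0..<k]"
  have f: "f i \<in> carrier R" for i using x by (simp add: f_def)
  have UsR: "set Us \<subseteq> carrier R" using f by (auto simp: Us_def)
  have comb: "combine Ks Us = frob_comb (q ^ d) k (\<lambda>i. Ks ! i) x" if "length Ks = k" "set Ks \<subseteq> K d" for Ks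
    using combine_eq_finsum[of Ks k f] that f K_subset
    by (auto simp: Us_def frob_comb_def f_def power_mult)
  have trivial: "set Ks \<subseteq> {\<zero>}" if Ks: "length Ks = k" "set Ks \<subseteq> K d" "combine Ks Us = \<zero>" for Ks
  proof -
    have "\<forall>i<k. Ks ! i = \<zero>"
      using ind d(1) Ks comb[OF Ks(1,2)] unfolding indep_conjugates_def k_def[symmetric]
      by (metis (full_types) k_def nth_mem subsetD)
    then show ?thesis using Ks(1) by (auto simp: in_set_conv_nth)
  qed
  have indep: "independent (K d) Us"
  proof (rule trivial_combine_imp_independent[OF K_subfield UsR])
    fix Ks assume Ks: "set Ks \<subseteq> K d" "combine Ks Us = \<zero>"
    have KsR: "set Ks \<subseteq> carrier R" using Ks(1) K_subset by blast
    \<comment> \<open>Independence concerns coefficient lists of any length, whereas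
      \<open>trivial\<close> handles length k only; cutting off and padding with zeros mediates
      between them.\<close>
    obtain Ks' where Ks': "set (take (length Us) Ks) \<subseteq> set Ks'"
      "set Ks' \<subseteq> set (take (length Us) Ks) \<union> {\<zero>}" "length Ks' = length Us" "\<zero> = combine Ks' Us"
      using combine_normalize[OF KsR UsR Ks(2)] by metis
    have "set Ks' \<subseteq> K d" using Ks'(2) Ks(1) zero_K by (auto dest: in_set_takeD)
    then have "set Ks' \<subseteq> {\<zero>}" using Ks' by (intro trivial) (auto simp: Us_def)
    then show "set (take (length Us) Ks) \<subseteq> {\<zero>}" using Ks'(1) by blast
  qed
  \<comment> \<open>There are (q^d)^(n/d) = q^n coefficient lists, as many as field elements, so
    injectivity of \<open>combine\<close> on them already gives spanning.\<close>
  define A where "A = {Ks. length Ks = k \<and> set Ks \<subseteq> K d}"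
  have "inj_on (\<lambda>Ks. combine Ks Us) A"
  proof (rule inj_onI)
    fix Ks Ks' assume A: "Ks \<in> A" "Ks' \<in> A" and eq: "combine Ks Us = combine Ks' Us"
    define D where "D = map2 (\<lambda>a b. a \<ominus> b) Ks Ks'"
    have nthK: "Ks ! i \<in> K d" "Ks' ! i \<in> K d" if "i < k" for i
      using A that by (auto simp: A_def subset_iff)
    have D: "length D = k" "\<And>i. i < k \<Longrightarrow> D ! i = Ks ! i \<ominus> Ks' ! i"
      using A by (auto simp: D_def A_def)
    have cl: "a \<ominus> b \<in> K d" if "a \<in> K d" "b \<in> K d" for a b
    proof -
      have ab: "a \<in> carrier R" "b \<in> carrier R" "a [^] (q ^ d) = a" "b [^] (q ^ d) = b"
        using that by (auto simp: K_def)
      have "(a \<oplus> \<ominus> b) [^] (q ^ d) = a \<oplus> \<ominus> b"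
        using q_pow_add[of a "\<ominus> b" d] q_pow_minus[of b d] ab by simp
      then show ?thesis using ab by (simp add: K_def a_minus_def)
    qed
    have DK: "set D \<subseteq> K d"
    proof
      fix y assume "y \<in> set D"
      then obtain i where i: "i < k" "y = D ! i" using D(1) by (metis in_set_conv_nth)
      show "y \<in> K d" unfolding i(2) D(2)[OF i(1)] by (rule cl[OF nthK[OF i(1)]])
    qed
    have nthR: "Ks ! i \<in> carrier R" "Ks' ! i \<in> carrier R" if "i < k" for i
      using nthK[OF that] K_subset by auto
    define a b where "a i = Ks ! i \<otimes> f i" and "b i = Ks' ! i \<otimes> f i" for i
    have ab: "a \<in> {..<k} \<rightarrow> carrier R" "b \<in> {..<k} \<rightarrow> carrier R" using nthR f by (auto simp: a_def b_def)
    have sum_eq: "(\<Oplus>i\<in>{..<k}. a i) = (\<Oplus>i\<in>{..<k}. b i)"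
    proof -
      have AR: "length Ks = k" "set Ks \<subseteq> carrier R" "length Ks' = k" "set Ks' \<subseteq> carrier R"
        using A K_subset[of d] unfolding A_def by auto
      show ?thesis
        using eq combine_eq_finsum[OF AR(1,2) f] combine_eq_finsum[OF AR(3,4) f]
        unfolding Us_def a_def b_def by simp
    qed
    have "combine D Us = (\<Oplus>i\<in>{..<k}. D ! i \<otimes> f i)"
      unfolding Us_def using D(1) DK K_subset f by (intro combine_eq_finsum) auto
    also have "\<dots> = (\<Oplus>i\<in>{..<k}. a i \<oplus> \<ominus> \<one> \<otimes> b i)"
      using nthR f D(2) by (intro finsum_cong') (auto simp: a_def b_def minus_eq l_distr l_minus)
    also have "\<dots> = (\<Oplus>i\<in>{..<k}. a i) \<oplus> (\<Oplus>i\<in>{..<k}. \<ominus> \<one> \<otimes> b i)"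
      using ab by (intro finsum_addf) auto
    also have "(\<Oplus>i\<in>{..<k}. \<ominus> \<one> \<otimes> b i) = \<ominus> \<one> \<otimes> (\<Oplus>i\<in>{..<k}. b i)"
      using ab by (intro finsum_rdistr[symmetric]) auto
    also have "(\<Oplus>i\<in>{..<k}. a i) \<oplus> \<dots> = \<zero>"
      using sum_eq ab finsum_closed[OF ab(2)] by (simp add: l_minus r_neg)
    finally have "set D \<subseteq> {\<zero>}" using trivial D DK by blast
    then have "Ks ! i \<ominus> Ks' ! i = \<zero>" if "i < k" for i
      using D that by (metis nth_mem singletonD subsetD)
    then show "Ks = Ks'" using A nthR by (intro nth_equalityI) (auto simp: A_def)
  qed
  moreover have fA: "finite (K d)" using K_subset fin finite_subset by blast
  moreover have "card A = card (carrier R)"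
    using card_lists_length_eq[OF fA, of k] card_K[OF d(1)] dk
    by (simp add: A_def conj_commute card_R flip: power_mult)
  ultimately have "card ((\<lambda>Ks. combine Ks Us) ` A) = card (carrier R)" by (simp add: card_image)
  moreover have "(\<lambda>Ks. combine Ks Us) ` A \<subseteq> carrier R"
    using UsR K_subset by (auto simp: A_def intro!: combine_in_carrier)
  ultimately have img: "(\<lambda>Ks. combine Ks Us) ` A = carrier R"
    using fin by (metis card_subset_eq)
  have "Span (K d) Us = (\<lambda>Ks. combine Ks Us) ` A"
    using Span_eq_combine_set_length_version[OF K_subfield UsR] by (auto simp: A_def Us_def)
  then have "is_basis R (K d) Us" using indep img by (simp add: is_basis_def)
  then show "normal_over R q n d x"
    unfolding normal_over_def Us_def f_def[abs_def] k_def
    using x K_subfield card_K[OF d(1)] by blast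
qed

text \<open>Since q - 1 divides q^(d j) - 1, each conjugate of y is y times an element z j of the
  ground field. A relation for the product with coefficients c j is therefore one for x with
  coefficients c j times z j.\<close>

lemma indep_conjugates_scale:
  assumes x: "x \<in> carrier R" "indep_conjugates x" and y: "y \<in> carrier R" "y \<noteq> \<zero>" "y [^] (q - 1) \<in> K 1"
  shows "indep_conjugates (y \<otimes> x)"
  unfolding indep_conjugates_def
proof (intro allI impI)
  fix d c i assume d: "d dvd n" and c: "\<forall>i<n div d. c i \<in> K d"
    and rel: "frob_comb (q ^ d) (n div d) c (y \<otimes> x) = \<zero>" and i: "i < n div d"
  define z where "z j = y [^] (q ^ (d * j) - 1)" for j
  have dvd: "(q - 1) dvd (q ^ j - 1)" for j
    using minus_one_dvd_power[of q j] q_ge_2 by simp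
  have K1d: "K 1 \<subseteq> K d"
  proof
    fix a assume a: "a \<in> K 1"
    then have aR: "a \<in> carrier R" "a [^] q = a" by (auto simp: K_def)
    have "a [^] (q ^ j) = a" for j
      by (induction j) (use aR in \<open>auto simp: nat_pow_pow[symmetric]\<close>)
    then show "a \<in> K d" using aR by (simp add: K_def)
  qed
  have zK: "z j \<in> K d" for j
  proof -
    obtain t where t: "q ^ (d * j) - 1 = (q - 1) * t" using dvd by blast
    have "z j = (y [^] (q - 1)) [^] t" unfolding z_def t using y by (simp add: nat_pow_pow)
    then show ?thesis using K_pow[OF y(3), of t] K1d by auto
  qed
  have z0: "z j \<noteq> \<zero>" for j unfolding z_def using y(1,2) by (rule nat_pow_nonzero)
  have yz: "y [^] (q ^ (d * j)) = z j \<otimes> y" for j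
  proof -
    have "y [^] (q ^ (d * j)) = y [^] Suc (q ^ (d * j) - 1)" using q_ge_2 by simp
    then show ?thesis by (simp add: z_def)
  qed
  have zR: "z j \<in> carrier R" for j using zK K_subset by blast
  have cR: "c j \<in> carrier R" if "j < n div d" for j using c that K_subset by blast
  have "frob_comb (q ^ d) (n div d) c (y \<otimes> x)
    = (\<Oplus>j\<in>{..<n div d}. y \<otimes> ((c j \<otimes> z j) \<otimes> x [^] ((q ^ d) ^ j)))"
    unfolding frob_comb_def using cR x y zR yz
    by (intro finsum_cong') (auto simp: nat_pow_distrib m_ac simp flip: power_mult)
  also have "\<dots> = y \<otimes> frob_comb (q ^ d) (n div d) (\<lambda>j. c j \<otimes> z j) x"
    unfolding frob_comb_def using cR x y zR by (intro finsum_rdistr[symmetric]) auto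
  finally have "y \<otimes> frob_comb (q ^ d) (n div d) (\<lambda>j. c j \<otimes> z j) x = \<zero>"
    using rel by simp
  moreover have "frob_comb (q ^ d) (n div d) (\<lambda>j. c j \<otimes> z j) x \<in> carrier R"
    using cR zR x(1) by (intro frob_comb_closed) auto
  ultimately have "frob_comb (q ^ d) (n div d) (\<lambda>j. c j \<otimes> z j) x = \<zero>"
    using integral_iff[OF y(1)] y(2) by blast
  moreover have "c j \<otimes> z j \<in> K d" if "j < n div d" for j
    using c that zK[of j] by (auto simp: K_def nat_pow_distrib)
  ultimately have "c i \<otimes> z i = \<zero>"
    using x(2)[unfolded indep_conjugates_def, rule_format, of d "\<lambda>j. c j \<otimes> z j" i] d i by simp
  then show "c i = \<zero>" using z0[of i] cR[OF i] zR[of i] by (simp add: integral_iff)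
qed

end

section \<open>Resolvents in an algebraically closed field\<close>

lemma (in domain) card_roots_of_unity:
  assumes "k > 0"
  shows "finite {x \<in> carrier R. x [^] (k::nat) = \<one>} \<and> card {x \<in> carrier R. x [^] k = \<one>} \<le> k"
proof -
  define q where "q = \<ominus> \<one> # replicate (k - 1) \<zero> @ [\<one>]"
  have rep: "horner (replicate j \<zero> @ [\<one>]) x = x [^] j" if "x \<in> carrier R" for j x
    using that by (induction j) (auto simp: m_comm)
  have "horner q x = \<zero> \<longleftrightarrow> x [^] k = \<one>" if x: "x \<in> carrier R" for x
  proof -
    have "x \<otimes> x [^] (k - 1) = x [^] k"
      using x assms by (cases k) (simp_all add: m_comm)
    then have "horner q x = \<ominus> \<one> \<oplus> x [^] k" using rep[OF x] by (simp add: q_def)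
    then show ?thesis using x
      by (metis a_comm a_inv_closed l_neg minus_equality minus_minus nat_pow_closed one_closed)
  qed
  then have "{x \<in> carrier R. x [^] k = \<one>} = {x \<in> carrier R. horner q x = \<zero>}" by auto
  moreover have "finite {x \<in> carrier R. horner q x = \<zero>} \<and> card {x \<in> carrier R. horner q x = \<zero>} < length q"
    by (rule card_horner_roots) (auto simp: q_def)
  moreover have "length q = Suc k" using assms by (simp add: q_def)
  ultimately show ?thesis by simp
qed

text \<open>The roots of unity in the relations need not lie in R, so R is mapped by h into an
  algebraically closed field.\<close>

locale finite_field_closure = finite_field_pow R g p e q n + L: algebraically_closed L
  for R (structure) and g p e q n and L :: "('c, 'd) ring_scheme" +
  fixes h
  assumes hom: "h \<in> ring_hom R L"
begin

sublocale h: ring_hom_cring R L h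
  by unfold_locales (rule hom)

lemma char_closure: "add_pow L p \<one>\<^bsub>L\<^esub> = \<zero>\<^bsub>L\<^esub>"
proof -
  have "h (add_pow R k \<one>\<^bsub>R\<^esub>) = add_pow L k \<one>\<^bsub>L\<^esub>" for k :: nat
    by (induction k) auto
  from this[of p] show ?thesis using char_p by simp
qed

lemma hom_pow: "x \<in> carrier R \<Longrightarrow> h (x [^]\<^bsub>R\<^esub> (k::nat)) = h x [^]\<^bsub>L\<^esub> k"
  by (induction k) auto

lemma hom_zeroD:
  assumes "x \<in> carrier R" "h x = \<zero>\<^bsub>L\<^esub>"
  shows "x = \<zero>\<^bsub>R\<^esub>"
proof (rule ccontr)
  assume "x \<noteq> \<zero>\<^bsub>R\<^esub>"
  then have xU: "x \<in> Units R" using assms field_Units by auto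
  then have "h x \<otimes>\<^bsub>L\<^esub> h (inv\<^bsub>R\<^esub> x) = \<one>\<^bsub>L\<^esub>" using h.hom_mult[of x "inv\<^bsub>R\<^esub> x"] assms by simp
  then show False using assms xU by simp
qed

lemma hom_inj: "inj_on h (carrier R)"
proof (rule inj_onI)
  fix x y assume "x \<in> carrier R" "y \<in> carrier R" "h x = h y"
  then have "h (x \<ominus>\<^bsub>R\<^esub> y) = \<zero>\<^bsub>L\<^esub>" by (simp add: a_minus_def L.r_neg)
  then have "x \<ominus>\<^bsub>R\<^esub> y = \<zero>\<^bsub>R\<^esub>" using hom_zeroD \<open>x \<in> carrier R\<close> \<open>y \<in> carrier R\<close> by blast
  then show "x = y" using \<open>x \<in> carrier R\<close> \<open>y \<in> carrier R\<close> by simp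
qed

text \<open>For w^(n/d) = 1 this is the Lagrange resolvent of x over the field with q^d elements. It
  is additive in x, so its kernel is a subgroup.\<close>

definition conj_sum :: "nat \<Rightarrow> 'c \<Rightarrow> 'a \<Rightarrow> 'c" where
  "conj_sum d w x = L.frob_comb (q ^ d) (n div d) (\<lambda>i. w [^]\<^bsub>L\<^esub> i) (h x)"

definition unity_roots :: "nat \<Rightarrow> 'c set" where
  "unity_roots k = {w \<in> carrier L. w [^]\<^bsub>L\<^esub> k = \<one>\<^bsub>L\<^esub>}"

lemma divisor_pos: "d dvd n \<Longrightarrow> d > 0" "d dvd n \<Longrightarrow> n div d > 0"
  using n by (auto intro!: Nat.gr0I simp: dvd_div_eq_0_iff)

text \<open>After division by gcd(d,m), n/d is seen to divide p^l times m/gcd(d,m). Hence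
  w^(m/gcd(d,m)) is a root of unity of p-power order, and such a root is 1 because z^(p^l) - 1 = (z
  - 1)^(p^l).\<close>

lemma unity_roots_subset:
  assumes nlm: "n = p ^ l * m" and d: "d dvd n"
  shows "unity_roots (n div d) \<subseteq> unity_roots (m div gcd d m)"
proof
  fix w assume "w \<in> unity_roots (n div d)"
  then have w: "w \<in> carrier L" "w [^]\<^bsub>L\<^esub> (n div d) = \<one>\<^bsub>L\<^esub>" by (auto simp: unity_roots_def)
  obtain k where k: "n = d * k" using d by blast
  define c where "c = gcd d m"
  obtain d' m' where dm: "d = c * d'" "m = c * m'" unfolding c_def by (meson dvdE gcd_dvd1 gcd_dvd2)
  have c0: "c > 0" using n nlm by (auto simp: c_def intro!: Nat.gr0I)
  have "c * (p ^ l * m') = p ^ l * m" by (simp add: dm(2))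
  also have "\<dots> = d * k" using k nlm by simp
  also have "\<dots> = c * (d' * k)" by (simp add: dm(1))
  finally have "p ^ l * m' = d' * k" using c0 by (simp only: mult_cancel1) simp
  moreover have "n div d = k" using k divisor_pos(1)[OF d] by simp
  ultimately have "w [^]\<^bsub>L\<^esub> (m' * p ^ l) = \<one>\<^bsub>L\<^esub>"
    using w L.nat_pow_pow[OF w(1), of k d'] by (simp add: mult.commute)
  then have "(w [^]\<^bsub>L\<^esub> m') [^]\<^bsub>L\<^esub> (p ^ l) = \<one>\<^bsub>L\<^esub>" using w(1) by (simp add: L.nat_pow_pow)
  moreover define z where "z = w [^]\<^bsub>L\<^esub> m'"
  ultimately have z: "z \<in> carrier L" "z [^]\<^bsub>L\<^esub> (p ^ l) = \<one>\<^bsub>L\<^esub>" using w(1) by auto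
  have "(z \<oplus>\<^bsub>L\<^esub> \<ominus>\<^bsub>L\<^esub> \<one>\<^bsub>L\<^esub>) [^]\<^bsub>L\<^esub> (p ^ l) \<oplus>\<^bsub>L\<^esub> \<one>\<^bsub>L\<^esub> [^]\<^bsub>L\<^esub> (p ^ l) = z [^]\<^bsub>L\<^esub> (p ^ l)"
    using L.frobenius_pow_add[OF p char_closure, of "z \<oplus>\<^bsub>L\<^esub> \<ominus>\<^bsub>L\<^esub> \<one>\<^bsub>L\<^esub>" "\<one>\<^bsub>L\<^esub>" l] z(1)
    by (simp add: L.a_assoc L.l_neg)
  then have "(z \<oplus>\<^bsub>L\<^esub> \<ominus>\<^bsub>L\<^esub> \<one>\<^bsub>L\<^esub>) [^]\<^bsub>L\<^esub> (p ^ l) \<oplus>\<^bsub>L\<^esub> \<one>\<^bsub>L\<^esub> = \<zero>\<^bsub>L\<^esub> \<oplus>\<^bsub>L\<^esub> \<one>\<^bsub>L\<^esub>" using z by simp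
  then have "(z \<oplus>\<^bsub>L\<^esub> \<ominus>\<^bsub>L\<^esub> \<one>\<^bsub>L\<^esub>) [^]\<^bsub>L\<^esub> (p ^ l) = \<zero>\<^bsub>L\<^esub>"
    using z(1) by (subst (asm) L.add.r_cancel) auto
  then have "z \<oplus>\<^bsub>L\<^esub> \<ominus>\<^bsub>L\<^esub> \<one>\<^bsub>L\<^esub> = \<zero>\<^bsub>L\<^esub>"
    using L.nat_pow_nonzero[of "z \<oplus>\<^bsub>L\<^esub> \<ominus>\<^bsub>L\<^esub> \<one>\<^bsub>L\<^esub>" "p ^ l"] z(1) by auto
  then have "z = \<one>\<^bsub>L\<^esub>" using z(1) L.r_right_minus_eq[of z "\<one>\<^bsub>L\<^esub>"] by (simp add: a_minus_def)
  moreover have "m div gcd d m = m'"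
    unfolding c_def[symmetric] using nonzero_mult_div_cancel_left[of c m'] c0 dm(2) by simp
  ultimately show "w \<in> unity_roots (m div gcd d m)" using w(1) by (simp add: z_def unity_roots_def)
qed

lemma unity_roots_card:
  assumes nlm: "n = p ^ l * m" and d: "d dvd n"
  shows "finite (unity_roots (n div d))" "card (unity_roots (n div d)) \<le> m div gcd d m"
proof -
  have "m > 0" using n nlm by (cases m) auto
  then have "m div gcd d m > 0" by (simp add: div_greater_zero_iff gcd_le2_nat)
  note * = L.card_roots_of_unity[OF this, folded unity_roots_def]
  note sub = unity_roots_subset[OF assms]
  show "finite (unity_roots (n div d))" using * sub finite_subset by blast
  show "card (unity_roots (n div d)) \<le> m div gcd d m"
    using * card_mono[OF _ sub] by (meson order_trans)
qed

lemma conj_sum_closed: "w \<in> carrier L \<Longrightarrow> x \<in> carrier R \<Longrightarrow> conj_sum d w x \<in> carrier L"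
  unfolding conj_sum_def by (intro L.frob_comb_closed) auto

lemma conj_sum_add:
  assumes w: "w \<in> carrier L" and xy: "x \<in> carrier R" "y \<in> carrier R"
  shows "conj_sum d w (x \<oplus>\<^bsub>R\<^esub> y) = conj_sum d w x \<oplus>\<^bsub>L\<^esub> conj_sum d w y"
proof -
  have fr: "(h x \<oplus>\<^bsub>L\<^esub> h y) [^]\<^bsub>L\<^esub> ((q ^ d) ^ i) = h x [^]\<^bsub>L\<^esub> ((q ^ d) ^ i) \<oplus>\<^bsub>L\<^esub> h y [^]\<^bsub>L\<^esub> ((q ^ d) ^ i)" for i
    using L.frobenius_pow_add[OF p char_closure, of "h x" "h y" "e * (d * i)"] xy
    by (simp add: q power_mult)
  have "conj_sum d w (x \<oplus>\<^bsub>R\<^esub> y) = (\<Oplus>\<^bsub>L\<^esub>i\<in>{..<n div d}. w [^]\<^bsub>L\<^esub> i \<otimes>\<^bsub>L\<^esub> h x [^]\<^bsub>L\<^esub> ((q ^ d) ^ i)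
      \<oplus>\<^bsub>L\<^esub> w [^]\<^bsub>L\<^esub> i \<otimes>\<^bsub>L\<^esub> h y [^]\<^bsub>L\<^esub> ((q ^ d) ^ i))"
    unfolding conj_sum_def L.frob_comb_def using xy w by (intro L.finsum_cong') (auto simp: fr L.r_distr)
  also have "\<dots> = conj_sum d w x \<oplus>\<^bsub>L\<^esub> conj_sum d w y"
    unfolding conj_sum_def L.frob_comb_def using xy w by (intro L.finsum_addf) auto
  finally show ?thesis .
qed

lemma conj_sum_group_hom:
  assumes w: "w \<in> carrier L"
  shows "group_hom (add_monoid R) (add_monoid L) (conj_sum d w)"
  unfolding group_hom_def group_hom_axioms_def
  using add.is_group L.add.is_group conj_sum_closed[OF w] conj_sum_add[OF w] by (auto simp: hom_def)

text \<open>A dependency for d makes some resolvent for d vanish. If m divides q - 1, then w^q = w,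
  so the vanishing resolvent is itself a relation with coefficients fixed by the q-th power map, and
  a second application of \<open>frob_comb_root_of_unity\<close> reduces d to 1.\<close>

lemma indep_conjugates_criterion:
  assumes nlm: "n = p ^ l * m" and D: "D = {d. d dvd n} \<or> m dvd (q - 1) \<and> D = {1}"
    and x: "x \<in> carrier R"
    and ne: "\<And>d w. d \<in> D \<Longrightarrow> w \<in> unity_roots (n div d) \<Longrightarrow> conj_sum d w x \<noteq> \<zero>\<^bsub>L\<^esub>"
  shows "indep_conjugates x"
proof -
  have cover: "\<exists>w\<in>unity_roots (n div d). conj_sum d w x = \<zero>\<^bsub>L\<^esub>"
    if d: "d dvd n" and c: "\<forall>i<n div d. c i \<in> K d" "i0 < n div d" "c i0 \<noteq> \<zero>\<^bsub>R\<^esub>"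
      and rel: "frob_comb (q ^ d) (n div d) c x = \<zero>\<^bsub>R\<^esub>" for d c i0
  proof -
    have cR: "c i \<in> carrier R" "c i [^]\<^bsub>R\<^esub> (q ^ d) = c i" if "i < n div d" for i
      using c that by (auto simp: K_def)
    have "\<exists>w\<in>carrier L. w [^]\<^bsub>L\<^esub> (n div d) = \<one>\<^bsub>L\<^esub> \<and> L.frob_comb (q ^ d) (n div d) (\<lambda>i. w [^]\<^bsub>L\<^esub> i) (h x) = \<zero>\<^bsub>L\<^esub>"
    proof (rule L.frob_comb_root_of_unity[OF p char_closure])
      show "q ^ d = p ^ (e * d)" by (simp add: q power_mult)
      show "0 < n div d" using divisor_pos d by simp
      show "h x \<in> carrier L" using x by simp
      show "h x [^]\<^bsub>L\<^esub> ((q ^ d) ^ (n div d)) = h x"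
        using hom_pow[OF x, of "q ^ n"] pow_card[OF x] d by (simp flip: power_mult)
      show "h (c i) \<in> carrier L" if "i < n div d" for i using cR that by simp
      show "h (c i) [^]\<^bsub>L\<^esub> q ^ d = h (c i)" if "i < n div d" for i
        using hom_pow[OF cR(1)[OF that], of "q ^ d"] cR(2)[OF that] by simp
      show "i0 < n div d" by fact
      show "h (c i0) \<noteq> \<zero>\<^bsub>L\<^esub>" using hom_zeroD[of "c i0"] cR c by auto
      have "h (frob_comb (q ^ d) (n div d) c x) = L.frob_comb (q ^ d) (n div d) (\<lambda>i. h (c i)) (h x)"
        unfolding frob_comb_def L.frob_comb_def using cR(1) x
        by (subst h.hom_finsum) (auto simp: hom_pow o_def intro!: L.finsum_cong')
      then show "L.frob_comb (q ^ d) (n div d) (\<lambda>i. h (c i)) (h x) = \<zero>\<^bsub>L\<^esub>" using rel by simp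
    qed
    then show ?thesis using x by (auto simp: unity_roots_def conj_sum_def)
  qed
  have False
    if d: "d dvd n" and c: "\<forall>i<n div d. c i \<in> K d" "i0 < n div d" "c i0 \<noteq> \<zero>\<^bsub>R\<^esub>"
      and rel: "frob_comb (q ^ d) (n div d) c x = \<zero>\<^bsub>R\<^esub>" for d c i0
  proof -
    obtain w where w: "w \<in> unity_roots (n div d)" "conj_sum d w x = \<zero>\<^bsub>L\<^esub>" using cover[OF d c rel] by blast
    show ?thesis
    proof (cases "D = {d. d dvd n}")
      case True
      then show ?thesis using w d ne by auto
    next
      case False
      then have D1: "D = {1}" "m dvd q - 1" using D by auto
      have wL: "w \<in> carrier L" "w [^]\<^bsub>L\<^esub> (m div gcd d m) = \<one>\<^bsub>L\<^esub>" using unity_roots_subset[OF nlm d] w(1) by (auto simp: unity_roots_def)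
      have "m div gcd d m dvd m" by (metis dvd_div_mult_self dvd_triv_left gcd_dvd2)
      then have "m div gcd d m dvd q - 1" using D1(2) dvd_trans by blast
      then obtain t where "q - 1 = (m div gcd d m) * t" by blast
      then have "w [^]\<^bsub>L\<^esub> (q - 1) = \<one>\<^bsub>L\<^esub>"
        using L.nat_pow_pow[OF wL(1), of "m div gcd d m" t] wL(2) by simp
      moreover have "w [^]\<^bsub>L\<^esub> q = w [^]\<^bsub>L\<^esub> (q - 1) \<otimes>\<^bsub>L\<^esub> w"
        using q_ge_2 L.nat_pow_Suc[of w "q - 1"] by simp
      ultimately have wq: "w [^]\<^bsub>L\<^esub> q = w" using wL(1) by simp
      have wjq: "(w [^]\<^bsub>L\<^esub> (j::nat)) [^]\<^bsub>L\<^esub> q = w [^]\<^bsub>L\<^esub> j" for j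
        using wq wL(1) by (metis L.nat_pow_pow mult.commute)
      \<comment> \<open>Placing the powers of w at the multiples of d turns the relation between
        conjugates for q^d into one for q.\<close>
      define c' where "c' t = (if d dvd t then w [^]\<^bsub>L\<^esub> (t div d) else \<zero>\<^bsub>L\<^esub>)" for t
      have c': "c' t \<in> carrier L" for t using wL by (simp add: c'_def)
      have "\<exists>w\<in>carrier L. w [^]\<^bsub>L\<^esub> n = \<one>\<^bsub>L\<^esub> \<and> L.frob_comb q n (\<lambda>i. w [^]\<^bsub>L\<^esub> i) (h x) = \<zero>\<^bsub>L\<^esub>"
      proof (rule L.frob_comb_root_of_unity[OF p char_closure q])
        show "0 < n" using n by simp
        show "h x \<in> carrier L" using x by simp
        show "h x [^]\<^bsub>L\<^esub> (q ^ n) = h x" using hom_pow[OF x, of "q ^ n"] pow_card[OF x] by simp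
        show "c' i \<in> carrier L" for i by (rule c')
        show "c' i [^]\<^bsub>L\<^esub> q = c' i" for i
          using wjq q_ge_2 by (auto simp: c'_def L.nat_pow_zero)
        show "0 < n" using n by simp
        show "c' 0 \<noteq> \<zero>\<^bsub>L\<^esub>" by (simp add: c'_def)
        have nd: "n div d * d = n" using d by simp
        have inj: "inj_on (\<lambda>i. d * i) {..<n div d}" using divisor_pos(1)[OF d] by (auto simp: inj_on_def)
        have img: "(\<lambda>i. d * i) ` {..<n div d} = {t \<in> {..<n}. d dvd t}"
        proof safe
          fix i assume "i < n div d"
          then show "d * i < n" using nd divisor_pos(1)[OF d] by (metis mult.commute mult_less_mono1)
        next
          fix t assume "t < n" "d dvd t"
          then obtain i where "t = d * i" by blast
          moreover have "i < n div d" using \<open>t < n\<close> \<open>t = d * i\<close> nd divisor_pos(1)[OF d]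
            by (metis mult.commute nat_mult_less_cancel1)
          ultimately show "t \<in> (\<lambda>i. d * i) ` {..<n div d}" by blast
        qed auto
        have "L.frob_comb q n c' (h x) = (\<Oplus>\<^bsub>L\<^esub>t\<in>(\<lambda>i. d * i) ` {..<n div d}. c' t \<otimes>\<^bsub>L\<^esub> h x [^]\<^bsub>L\<^esub> (q ^ t))"
          unfolding L.frob_comb_def img using c' x
          by (intro L.add.finprod_mono_neutral_cong_right) (auto simp: c'_def)
        also have "\<dots> = (\<Oplus>\<^bsub>L\<^esub>i\<in>{..<n div d}. c' (d * i) \<otimes>\<^bsub>L\<^esub> h x [^]\<^bsub>L\<^esub> (q ^ (d * i)))"
          using c' x by (intro L.finsum_reindex inj) auto
        also have "\<dots> = L.frob_comb (q ^ d) (n div d) (\<lambda>i. w [^]\<^bsub>L\<^esub> i) (h x)"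
          unfolding L.frob_comb_def using wL x divisor_pos(1)[OF d]
          by (intro L.finsum_cong') (auto simp: c'_def power_mult)
        also have "\<dots> = \<zero>\<^bsub>L\<^esub>" using w(2) by (simp add: conj_sum_def)
        finally show "L.frob_comb q n c' (h x) = \<zero>\<^bsub>L\<^esub>" .
      qed
      then show ?thesis using ne[of 1] D1 by (auto simp: unity_roots_def conj_sum_def)
    qed
  qed
  then show ?thesis unfolding indep_conjugates_def by blast
qed

text \<open>The subgroups are the kernels of the resolvents, indexed by (d, w). The map h embeds
  each of them in the zero set of a linearized polynomial of degree (q^d)^(n/d - 1) =
  q^(n-d).\<close>

lemma non_normal_subspaces:
  assumes nlm: "n = p ^ l * m" and D: "D = {d. d dvd n} \<or> m dvd (q - 1) \<and> D = {1}"
  shows "\<exists>I V. finite (I :: (nat \<times> 'c) set) \<and> (\<forall>i\<in>I. subgroup (V i) (add_monoid R))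
    \<and> card I \<le> (\<Sum>d\<in>D. m div gcd d m)
    \<and> (\<Sum>i\<in>I. card (V i)) \<le> (\<Sum>d\<in>D. m div gcd d m * q ^ (n - d))
    \<and> (\<forall>x\<in>carrier R. (\<forall>i\<in>I. x \<notin> V i) \<longrightarrow> indep_conjugates x)"
proof -
  define V where "V = (\<lambda>(d, w). {x \<in> carrier R. conj_sum d w x = \<zero>\<^bsub>L\<^esub>})"
  define I where "I = (SIGMA d:D. unity_roots (n div d))"
  have dn: "d dvd n" if "d \<in> D" for d using D that by auto
  have finD: "finite D" using D n by auto
  note W = unity_roots_card[OF nlm dn]
  have finI: "finite I" unfolding I_def using finD W by blast
  have V_card: "card (V i) \<le> q ^ (n - fst i)" if i: "i \<in> I" for i
  proof -
    obtain d w where dw: "i = (d, w)" "d dvd n" "w \<in> unity_roots (n div d)" using i dn by (auto simp: I_def)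
    have w: "w \<in> carrier L" "w [^]\<^bsub>L\<^esub> (n div d) = \<one>\<^bsub>L\<^esub>" using dw by (auto simp: unity_roots_def)
    have "w \<noteq> \<zero>\<^bsub>L\<^esub>" using w(2) divisor_pos(2)[OF dw(2)] by (auto simp: L.nat_pow_zero)
    note wnz = L.nat_pow_nonzero[OF w(1) this]
    have qd: "q ^ d \<ge> 2" using power_increasing[of 1 d q] divisor_pos(1)[OF dw(2)] q_ge_2 by simp
    let ?Z = "{y \<in> carrier L. L.frob_comb (q ^ d) (n div d) (\<lambda>i. w [^]\<^bsub>L\<^esub> i) y = \<zero>\<^bsub>L\<^esub>}"
    have Z: "finite ?Z" "card ?Z \<le> (q ^ d) ^ (n div d - 1)"
      using L.card_frob_comb_roots[OF qd divisor_pos(2)[OF dw(2)], of "\<lambda>i. w [^]\<^bsub>L\<^esub> i"] w(1) wnz by auto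
    have "card (V i) = card (h ` V i)"
      using hom_inj by (subst card_image) (auto simp: V_def dw inj_on_def)
    also have "\<dots> \<le> card ?Z" by (rule card_mono[OF Z(1)]) (auto simp: V_def dw conj_sum_def)
    also have "\<dots> \<le> (q ^ d) ^ (n div d - 1)" by (rule Z(2))
    also have "\<dots> = q ^ (n - d)" using dw(2) by (simp add: algebra_simps flip: power_mult)
    finally show ?thesis by (simp add: dw)
  qed
  have V_sub: "subgroup (V i) (add_monoid R)" if i: "i \<in> I" for i
  proof -
    obtain d w where dw: "i = (d, w)" "w \<in> carrier L" using i by (auto simp: I_def unity_roots_def)
    show ?thesis
      using group_hom.subgroup_kernel[OF conj_sum_group_hom[OF dw(2), of d]] by (simp add: kernel_def V_def dw)
  qed
  have "card I = (\<Sum>d\<in>D. card (unity_roots (n div d)))"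
    unfolding I_def using finD W(1) by (intro card_SigmaI) auto
  also have "\<dots> \<le> (\<Sum>d\<in>D. m div gcd d m)" by (intro sum_mono W(2))
  finally have cI: "card I \<le> (\<Sum>d\<in>D. m div gcd d m)" .
  have "(\<Sum>i\<in>I. card (V i)) \<le> (\<Sum>i\<in>I. q ^ (n - fst i))" by (intro sum_mono V_card)
  also have "\<dots> = (\<Sum>d\<in>D. \<Sum>w\<in>unity_roots (n div d). q ^ (n - d))"
    unfolding I_def using finD W(1) by (subst sum.Sigma) (auto simp: case_prod_beta)
  also have "\<dots> = (\<Sum>d\<in>D. card (unity_roots (n div d)) * q ^ (n - d))" by simp
  also have "\<dots> \<le> (\<Sum>d\<in>D. m div gcd d m * q ^ (n - d))" by (intro sum_mono mult_right_mono W(2)) auto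
  finally have cV: "(\<Sum>i\<in>I. card (V i)) \<le> (\<Sum>d\<in>D. m div gcd d m * q ^ (n - d))" .
  have "indep_conjugates x" if "x \<in> carrier R" "\<forall>i\<in>I. x \<notin> V i" for x
    by (rule indep_conjugates_criterion[OF nlm D that(1)]) (use that in \<open>auto simp: I_def V_def\<close>)
  then show ?thesis using finI V_sub cI cV by blast
qed

end

section \<open>From independent conjugates to primitive completely normal elements\<close>

context finite_field_pow
begin

lemma primitive_g_pow:
  assumes "coprime k N"
  shows "primitive_element R (g [^] k)"
proof -
  \<comment> \<open>Two constants bear the name \<open>mult_of\<close>:
    \<open>primitive_element\<close> refers to one of them, and \<open>field_mult_group\<close> to
    the other.\<close>
  have eq: "mult_of R = Multiplicative_Group.mult_of R"
    by (simp add: Ring_Divisibility.mult_of_def Multiplicative_Group.mult_of_def)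
  interpret G: group "mult_of R" unfolding eq by (rule field_mult_group)
  have in_G: "g [^] i \<in> carrier (mult_of R)" for i :: nat by simp
  have finG: "finite (carrier (mult_of R))" using fin by simp
  have "carrier (mult_of R) \<subseteq> {(g [^] k) [^] j | j::nat. j \<in> UNIV}"
  proof
    fix x assume "x \<in> carrier (mult_of R)"
    then have x: "x \<in> carrier R" "x \<noteq> \<zero>" by auto
    show "x \<in> {(g [^] k) [^] j | j::nat. j \<in> UNIV}"
    proof (cases "k = 0")
      case True
      then have "N = 1" using assms by simp
      then have "x = g [^] (0::nat)" using g_pow_ind[OF x] ind_less[OF x] by simp
      then show ?thesis using True by auto
    next
      case False
      obtain a b where ab: "k * a = N * b + 1" using bezout_nat[OF False, of N] assms by auto
      have "(g [^] k) [^] (a * ind x) = g [^] (k * a * ind x)"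
        using g_carrier by (simp add: nat_pow_pow mult.assoc)
      also have "k * a * ind x = ind x + N * (b * ind x)"
        unfolding ab by (simp add: algebra_simps)
      also have "g [^] (ind x + N * (b * ind x)) = g [^] ind x"
        by (simp only: g_pow_eq_iff mod_mult_self2)
      finally show ?thesis using g_pow_ind[OF x] by (metis (mono_tags, lifting) UNIV_I mem_Collect_eq)
    qed
  qed
  also have "{(g [^] k) [^] j | j::nat. j \<in> UNIV} = generate (mult_of R) {g [^] k}"
    using G.generate_pow_on_finite_carrier[OF finG in_G, of k] by (simp add: nat_pow_mult_of)
  finally show ?thesis
    using G.generate_incl[of "{g [^] k}"] in_G unfolding primitive_element_def by blast
qed

text \<open>Modulo q - 1 the cofactor (q^n - 1)/(q - 1) is a sum of n ones, so gcd(n,q-1) divides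
  it. The divisor in question is gcd((q-1)^2, q^n - 1).\<close>

lemma norm_kernel_dvd: "(q - 1) * gcd n (q - 1) dvd N"
proof -
  have "real (q ^ n) - 1 = (real q - 1) * (\<Sum>i<n. real q ^ i)"
    by (simp add: power_diff_1_eq)
  then have "real (q ^ n - 1) = real ((q - 1) * (\<Sum>i<n. q ^ i))"
    using q_ge_2 by (simp add: of_nat_diff)
  then have N: "N = (q - 1) * (\<Sum>i<n. q ^ i)" by (simp only: N_eq of_nat_eq_iff)
  have "(\<Sum>i<n. q ^ i) = (\<Sum>i<n. (q ^ i - 1) + 1)"
    using q_ge_2 by (intro sum.cong) auto
  also have "\<dots> = (\<Sum>i<n. q ^ i - 1) + n" by (simp only: sum.distrib) simp
  finally have S: "(\<Sum>i<n. q ^ i) = (\<Sum>i<n. q ^ i - 1) + n" .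
  have "gcd n (q - 1) dvd (\<Sum>i<n. q ^ i - 1)"
    using minus_one_dvd_power[of q] q_ge_2 by (intro dvd_sum) (auto intro: dvd_trans[OF gcd_dvd2])
  then have "gcd n (q - 1) dvd (\<Sum>i<n. q ^ i)" unfolding S by simp
  then show ?thesis unfolding N by (rule mult_dvd_mono[OF dvd_refl])
qed

text \<open>Multiplication by an element whose \<open>(q - 1)\<close>-st power lies in the ground field preserves
  complete normality, so only the primes dividing the index of the group of these elements
  obstruct primitivity.\<close>

lemma primitive_completely_normalI:
  assumes x: "x \<in> carrier R" "x \<noteq> \<zero>" "indep_conjugates x"
    and r: "\<And>r. Factorial_Ring.prime r \<Longrightarrow> r dvd N div ((q - 1) * gcd n (q - 1)) \<Longrightarrow> \<not> r dvd ind x"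
  shows "\<exists>y \<in> carrier R. primitive_element R y \<and> completely_normal R q n y"
proof -
  define M where "M = N div ((q - 1) * gcd n (q - 1))"
  define A where "A = {r. Factorial_Ring.prime r \<and> r dvd N \<and> \<not> r dvd ind x}"
  define t where "t = \<Prod>A"
  have MN: "N = M * ((q - 1) * gcd n (q - 1))" using norm_kernel_dvd by (simp add: M_def)
  have finA: "finite A" by (rule finite_subset[of _ "{r. r dvd N}"]) (use N_pos in \<open>auto simp: A_def\<close>)
  \<comment> \<open>Each prime divisor of N divides exactly one summand: t collects those that do
    not divide \<open>ind x\<close>, and one that divides \<open>ind x\<close> divides neither t
    nor, by hypothesis, M. So k is coprime to N, and g^k is x times g^(M t).\<close>
  define k where "k = M * t + ind x"
  have "coprime k N"
  proof (rule ccontr)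
    assume "\<not> coprime k N"
    then obtain s where s: "Factorial_Ring.prime s" "s dvd k" "s dvd N"
      by (metis coprime_iff_gcd_eq_1 gcd_greatest_iff prime_factor_nat)
    show False
    proof (cases "s dvd ind x")
      case True
      then have "s dvd M * t" using s(2) by (simp add: k_def dvd_add_left_iff)
      then consider "s dvd M" | "s dvd t" using s(1) prime_dvd_mult_iff by blast
      then show False
      proof cases
        case 1
        then show False using r[OF s(1)] True by (simp add: M_def)
      next
        case 2
        then obtain a where "a \<in> A" "s dvd a"
          unfolding t_def using prime_dvd_prod_iff[OF finA s(1), of id] by auto
        then show False using True s(1) by (auto simp: A_def dest: primes_dvd_imp_eq)
      qed
    next
      case False
      then have "s \<in> A" using s by (simp add: A_def)
      then have "s dvd t" unfolding t_def using dvd_prodI[OF finA, of s "\<lambda>x. x"] by simp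
      then have "s dvd M * t" by simp
      then show False using s(2) False by (simp add: k_def dvd_add_right_iff)
    qed
  qed
  then have prim: "primitive_element R (g [^] k)" by (rule primitive_g_pow)
  define y where "y = g [^] (M * t)"
  have gk: "g [^] k = y \<otimes> x"
    using g_carrier g_pow_ind[OF x(1,2)] by (simp add: k_def y_def flip: nat_pow_mult)
  have y: "y \<in> carrier R" "y \<noteq> \<zero>" by (simp_all add: y_def)
  have y1: "y [^] (q - 1) = g [^] (M * t * (q - 1))"
    using g_carrier by (simp add: y_def nat_pow_pow)
  define G where "G = gcd n (q - 1)"
  have "G dvd q - 1" by (simp add: G_def)
  then obtain s where s: "q - 1 = G * s" by blast
  have "M * t * (q - 1) * (q - 1) = M * t * (q - 1) * (G * s)" by (simp only: s[symmetric])
  also have "\<dots> = N * (t * s)" unfolding MN G_def[symmetric] by (simp only: mult_ac)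
  finally have "(y [^] (q - 1)) [^] (q - 1) = g [^] (N * (t * s))"
    unfolding y1 by (simp only: nat_pow_pow[OF g_carrier])
  also have "\<dots> = g [^] (0::nat)" by (simp only: g_pow_eq_iff) simp
  finally have "y [^] (q - 1) \<in> K 1"
    unfolding y1 by (subst in_K_nonzero_iff) auto
  then have "indep_conjugates (g [^] k)"
    unfolding gk by (intro indep_conjugates_scale x y)
  then have "completely_normal R q n (g [^] k)" by (intro completely_normalI) auto
  then show ?thesis using prim by blast
qed

lemma existence_criterion:
  assumes nlm: "n = p ^ l * m" and D: "D = {d. d dvd n} \<or> m dvd (q - 1) \<and> D = {1}"
    and P: "finite P" "finite P'" "P \<inter> P' = {}"
      "P \<union> P' = {r. Factorial_Ring.prime r \<and> r dvd (q ^ n - 1) div ((q - 1) * gcd n (q - 1))}"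
    and bound: "real (q ^ n) > (\<Sum>d\<in>D. real (m div gcd d m) * real (q ^ (n - d)))
      + (\<Sum>d\<in>D. real (m div gcd d m)) * (2 ^ card P - 1) * sqrt (real (q ^ n))
      + (\<Sum>r\<in>P'. real (q ^ n) / real r)"
  shows "\<exists>y \<in> carrier R. primitive_element R y \<and> completely_normal R q n y"
proof -
  let ?M = "(q ^ n - 1) div ((q - 1) * gcd n (q - 1))"
  interpret cl: algebraic_closure alg_closure "indexed_const ` (carrier R)"
    by (rule alg_closureE(1))
  interpret c: finite_field_closure R g p e q n alg_closure indexed_const
    by unfold_locales (rule alg_closureE(2))
  from c.non_normal_subspaces[OF nlm D]
  obtain I V where I: "finite (I :: (nat \<times> (('a list \<times> nat) multiset \<Rightarrow> 'a)) set)"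
    and V: "\<forall>i\<in>I. subgroup (V i) (add_monoid R)"
    and cI: "card I \<le> (\<Sum>d\<in>D. m div gcd d m)"
    and cV: "(\<Sum>i\<in>I. card (V i)) \<le> (\<Sum>d\<in>D. m div gcd d m * q ^ (n - d))"
    and ind: "\<forall>x\<in>carrier R. (\<forall>i\<in>I. x \<notin> V i) \<longrightarrow> indep_conjugates x"
    by blast
  have MN: "?M dvd N" using norm_kernel_dvd unfolding N_eq by (metis dvd_div_mult_self dvd_triv_left)
  have PN: "Factorial_Ring.prime r \<and> r dvd N" if "r \<in> P \<union> P'" for r
    using that MN dvd_trans unfolding P(4) by blast
  define Q where "Q = real (q ^ n)"
  have QN: "Q = real N + 1" using N_eq q_ge_2 by (simp add: Q_def of_nat_diff)
  have cR: "real (card (carrier R)) = Q" by (simp add: card_R Q_def)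
  define s where "s = (\<Sum>r\<in>P'. 1 / real r)"
  have sQ: "(\<Sum>r\<in>P'. a / real r) = a * s" for a by (simp add: s_def sum_distrib_left)
  define B where "B = (\<Sum>i\<in>I. real (card (V i))) + real (card I) * (2 ^ card P - 1) * sqrt Q"
  have "real (card I) \<le> (\<Sum>d\<in>D. real (m div gcd d m))"
    using cI by (simp flip: of_nat_sum)
  then have "real (card I) * (2 ^ card P - 1) * sqrt Q
      \<le> (\<Sum>d\<in>D. real (m div gcd d m)) * (2 ^ card P - 1) * sqrt Q"
    by (intro mult_right_mono) (auto simp: Q_def)
  moreover have "(\<Sum>i\<in>I. real (card (V i))) \<le> (\<Sum>d\<in>D. real (m div gcd d m) * real (q ^ (n - d)))"
    using cV unfolding of_nat_mult[symmetric] of_nat_sum[symmetric] of_nat_le_iff .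
  ultimately have B: "Q * (1 - s) > B"
    using bound unfolding Q_def[symmetric] sQ B_def by (simp add: algebra_simps)
  have B0: "B \<ge> 0" unfolding B_def by (intro add_nonneg_nonneg sum_nonneg mult_nonneg_nonneg) (auto simp: Q_def)
  have s1: "1 - s > 0" using B B0 QN by (smt (verit) mult_nonneg_nonpos of_nat_0_le_iff)
  have "\<exists>x\<in>free_set (P \<union> P'). \<forall>i\<in>I. x \<notin> V i"
  proof (rule sieve[OF P(1) _ P(2) _ P(3) I])
    show "Factorial_Ring.prime r \<and> r dvd N" if "r \<in> P" for r using PN that by blast
    show "Factorial_Ring.prime r \<and> r dvd N" if "r \<in> P'" for r using PN that by blast
    show "subgroup (V i) (add_monoid R)" if "i \<in> I" for i using V that by blast
    \<comment> \<open>The criterion is stated with q^n but the sieve with N = q^n - 1. The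
      difference 1 - s is made up by the zero element, which the sizes of the subgroups count once
      each.\<close>
    have "real N * (1 - s) > B - real (card I)"
    proof (cases "I = {}")
      case True
      then have "B = 0" by (simp add: B_def)
      then show ?thesis using s1 N_pos True by simp
    next
      case False
      then have "card I \<ge> 1" using I by (simp add: Suc_leI card_gt_0_iff)
      moreover have "s \<ge> 0" unfolding s_def by (intro sum_nonneg) auto
      moreover have "real N * (1 - s) = Q * (1 - s) - (1 - s)" by (simp add: QN algebra_simps)
      ultimately show ?thesis using B by linarith
    qed
    then show "real N > (\<Sum>i\<in>I. real (card (V i)) - 1)
      + real (card I) * (2 ^ card P - 1) * sqrt (card (carrier R)) + (\<Sum>r\<in>P'. real N / real r)"
      unfolding sQ cR B_def by (simp add: sum_subtractf algebra_simps)
  qed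
  then obtain x where x: "x \<in> free_set (P \<union> P')" "\<forall>i\<in>I. x \<notin> V i" by blast
  show ?thesis
  proof (rule primitive_completely_normalI)
    show xR: "x \<in> carrier R" "x \<noteq> \<zero>" using x(1) by (auto simp: free_set_def)
    show "indep_conjugates x" using ind xR x(2) by blast
    show "\<not> r dvd ind x" if "Factorial_Ring.prime r" "r dvd N div ((q - 1) * gcd n (q - 1))" for r
    proof -
      have "r \<in> P \<union> P'" using that unfolding P(4) N_eq by blast
      then show ?thesis using x(1) by (auto simp: free_set_def)
    qed
  qed
qed

end

section \<open>An exact count, the pair (5,4), and degrees one and two\<close>

context finite_field_closure
begin

text \<open>The n-th roots of unity are the images of the powers of g^(N/n).\<close>

lemma card_unity_roots_eq:
  assumes "n dvd q - 1"
  shows "card (unity_roots n) = n"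
proof (rule antisym)
  have n0: "n > 0" using n by simp
  note up = L.card_roots_of_unity[OF n0, folded unity_roots_def]
  show "card (unity_roots n) \<le> n" using up by blast
  have "n dvd N" using assms pow_minus_one_dvd[of 1] by (auto simp: N_eq intro: dvd_trans)
  then obtain r where r: "N = n * r" by blast
  have r0: "r > 0" using r N_pos by (cases r) auto
  have "inj_on (\<lambda>i. g [^]\<^bsub>R\<^esub> (r * i)) {..<n}"
  proof (rule inj_onI)
    fix i j assume ij: "i \<in> {..<n}" "j \<in> {..<n}" and "g [^]\<^bsub>R\<^esub> (r * i) = g [^]\<^bsub>R\<^esub> (r * j)"
    then have "(r * i) mod N = (r * j) mod N" by (simp only: g_pow_eq_iff)
    then show "i = j" using ij r0 by (simp add: r mult.commute[of n])
  qed
  then have "inj_on (h \<circ> (\<lambda>i. g [^]\<^bsub>R\<^esub> (r * i))) {..<n}"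
    by (rule comp_inj_on) (rule inj_on_subset[OF hom_inj], auto)
  then have "n = card ((h \<circ> (\<lambda>i. g [^]\<^bsub>R\<^esub> (r * i))) ` {..<n})" by (simp only: card_image card_lessThan)
  also have "\<dots> \<le> card (unity_roots n)"
  proof (rule card_mono)
    show "finite (unity_roots n)" using up by blast
    have "(g [^]\<^bsub>R\<^esub> (r * i)) [^]\<^bsub>R\<^esub> n = \<one>\<^bsub>R\<^esub>" for i
    proof -
      have "(g [^]\<^bsub>R\<^esub> (r * i)) [^]\<^bsub>R\<^esub> n = g [^]\<^bsub>R\<^esub> (N * i)"
        using g_carrier by (simp add: nat_pow_pow r mult_ac)
      also have "\<dots> = g [^]\<^bsub>R\<^esub> (0::nat)" by (simp only: g_pow_eq_iff) simp
      finally show ?thesis by simp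
    qed
    then show "(h \<circ> (\<lambda>i. g [^]\<^bsub>R\<^esub> (r * i))) ` {..<n} \<subseteq> unity_roots n"
      by (auto simp: unity_roots_def simp flip: hom_pow)
  qed
  finally show "n \<le> card (unity_roots n)" .
qed

text \<open>When all \<open>n\<close>-th roots of unity lie in the ground field, \<open>x \<mapsto> (conj_sum 1 w x)\<close> identifies
  \<open>R\<close> with a product of \<open>n\<close> sets of size \<open>q\<close>.\<close>

lemma card_indep_conjugates_ge:
  assumes nq: "n dvd q - 1"
  shows "card {x \<in> carrier R. indep_conjugates x} \<ge> (q - 1) ^ n"
proof -
  define W where "W = unity_roots n"
  define E where "E w = {y \<in> carrier L. w \<otimes>\<^bsub>L\<^esub> y [^]\<^bsub>L\<^esub> q = y}" for w
  define \<Phi> where "\<Phi> x = restrict (\<lambda>w. conj_sum 1 w x) W" for x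
  have n0: "n > 0" using n by simp
  have cW: "card W = n" unfolding W_def by (rule card_unity_roots_eq[OF nq])
  have finW: "finite W" using cW n0 card_ge_0_finite by force
  have WL: "w \<in> carrier L" "w [^]\<^bsub>L\<^esub> n = \<one>\<^bsub>L\<^esub>" if "w \<in> W" for w
    using that by (auto simp: W_def unity_roots_def)
  have Wq: "w [^]\<^bsub>L\<^esub> q = w" if "w \<in> W" for w
  proof -
    obtain t where t: "q - 1 = n * t" using nq by blast
    have "w [^]\<^bsub>L\<^esub> (q - 1) = \<one>\<^bsub>L\<^esub>"
      unfolding t using L.nat_pow_pow[OF WL(1)[OF that], of n t] WL[OF that] by simp
    moreover have "w [^]\<^bsub>L\<^esub> q = w [^]\<^bsub>L\<^esub> (q - 1) \<otimes>\<^bsub>L\<^esub> w"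
      using q_ge_2 L.nat_pow_Suc[of w "q - 1"] by simp
    ultimately show ?thesis using WL[OF that] by simp
  qed
  have Wnz: "w \<noteq> \<zero>\<^bsub>L\<^esub>" if "w \<in> W" for w using WL[OF that] n0 by (auto simp: L.nat_pow_zero)
  have E: "finite (E w)" "card (E w) \<le> q" "\<zero>\<^bsub>L\<^esub> \<in> E w" if w: "w \<in> W" for w
  proof -
    define c where "c i = (if i = 0 then \<ominus>\<^bsub>L\<^esub> \<one>\<^bsub>L\<^esub> else w)" for i :: nat
    have "L.frob_comb q 2 c y = \<zero>\<^bsub>L\<^esub> \<longleftrightarrow> w \<otimes>\<^bsub>L\<^esub> y [^]\<^bsub>L\<^esub> q = y" if y: "y \<in> carrier L" for y
    proof -
      have "{..<2} = {0, 1::nat}" by auto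
      then have "L.frob_comb q 2 c y = \<ominus>\<^bsub>L\<^esub> y \<oplus>\<^bsub>L\<^esub> w \<otimes>\<^bsub>L\<^esub> y [^]\<^bsub>L\<^esub> q"
        using y WL[OF w] unfolding L.frob_comb_def by (simp add: c_def L.l_minus)
      also have "\<dots> = w \<otimes>\<^bsub>L\<^esub> y [^]\<^bsub>L\<^esub> q \<ominus>\<^bsub>L\<^esub> y"
        using y WL[OF w] by (simp add: a_minus_def L.a_comm)
      finally show ?thesis using y WL[OF w] by simp
    qed
    then have Eeq: "E w = {y \<in> carrier L. L.frob_comb q 2 c y = \<zero>\<^bsub>L\<^esub>}" by (auto simp: E_def)
    have "finite {y \<in> carrier L. L.frob_comb q 2 c y = \<zero>\<^bsub>L\<^esub>}
      \<and> card {y \<in> carrier L. L.frob_comb q 2 c y = \<zero>\<^bsub>L\<^esub>} \<le> q ^ (2 - 1)"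
      by (rule L.card_frob_comb_roots) (use q_ge_2 WL[OF w] Wnz[OF w] in \<open>auto simp: c_def\<close>)
    then show "finite (E w)" "card (E w) \<le> q" unfolding Eeq by auto
    show "\<zero>\<^bsub>L\<^esub> \<in> E w" using WL[OF w] q_ge_2 by (simp add: E_def L.nat_pow_zero)
  qed
  \<comment> \<open>The q-th power map followed by multiplication by w carries each summand of the
    resolvent to the next one, and the sum is cyclic.\<close>
  have TE: "conj_sum 1 w x \<in> E w" if w: "w \<in> W" and x: "x \<in> carrier R" for w x
  proof -
    define G where "G i = w [^]\<^bsub>L\<^esub> i \<otimes>\<^bsub>L\<^esub> h x [^]\<^bsub>L\<^esub> (q ^ i)" for i
    have G: "range G \<subseteq> carrier L" using WL[OF w] x by (auto simp: G_def)
    have hx: "h x [^]\<^bsub>L\<^esub> (q ^ n) = h x" using pow_card[OF x] hom_pow[OF x, of "q ^ n"] by simp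
    have per: "G (i + n) = G i" for i
    proof -
      have "h x [^]\<^bsub>L\<^esub> (q ^ (i + n)) = (h x [^]\<^bsub>L\<^esub> (q ^ n)) [^]\<^bsub>L\<^esub> (q ^ i)"
        using x by (simp add: L.nat_pow_pow power_add mult.commute)
      moreover have "w [^]\<^bsub>L\<^esub> (i + n) = w [^]\<^bsub>L\<^esub> i"
        using WL[OF w] L.nat_pow_mult[of w i n] by simp
      ultimately show ?thesis by (simp add: G_def hx)
    qed
    have sum: "conj_sum 1 w x = (\<Oplus>\<^bsub>L\<^esub>i\<in>{..<n}. G i)"
      by (simp add: conj_sum_def L.frob_comb_def G_def)
    have step: "w \<otimes>\<^bsub>L\<^esub> G i [^]\<^bsub>L\<^esub> q = G (Suc i)" for i
    proof -
      have "(w [^]\<^bsub>L\<^esub> i) [^]\<^bsub>L\<^esub> q = w [^]\<^bsub>L\<^esub> i"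
        using Wq[OF w] WL(1)[OF w] by (metis L.nat_pow_pow mult.commute)
      then have "G i [^]\<^bsub>L\<^esub> q = w [^]\<^bsub>L\<^esub> i \<otimes>\<^bsub>L\<^esub> h x [^]\<^bsub>L\<^esub> (q ^ Suc i)"
        using WL[OF w] x by (simp add: G_def L.nat_pow_distrib L.nat_pow_pow mult.commute)
      then show ?thesis using WL[OF w] x by (simp add: G_def L.m_ac)
    qed
    have GP: "G \<in> {..<n} \<rightarrow> carrier L" using G by auto
    have "w \<otimes>\<^bsub>L\<^esub> (\<Oplus>\<^bsub>L\<^esub>i\<in>{..<n}. G i) [^]\<^bsub>L\<^esub> q = w \<otimes>\<^bsub>L\<^esub> (\<Oplus>\<^bsub>L\<^esub>i\<in>{..<n}. G i [^]\<^bsub>L\<^esub> q)"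
      using L.frobenius_finsum[OF p char_closure GP, of e] by (simp add: q)
    also have "\<dots> = (\<Oplus>\<^bsub>L\<^esub>i\<in>{..<n}. w \<otimes>\<^bsub>L\<^esub> G i [^]\<^bsub>L\<^esub> q)"
      using WL[OF w] G by (intro L.finsum_rdistr) auto
    also have "\<dots> = (\<Oplus>\<^bsub>L\<^esub>i\<in>{..<n}. G i)"
      unfolding step by (rule L.finsum_shift_periodic[OF G per])
    finally show ?thesis using sum conj_sum_closed[OF WL(1)[OF w] x, of 1] by (simp add: E_def)
  qed
  \<comment> \<open>Otherwise the conjugates of z would be the coefficients of a nonzero polynomial
    of degree below n that vanishes on the n elements of W.\<close>
  have zero: "z = \<zero>\<^bsub>R\<^esub>" if z: "z \<in> carrier R" and "\<And>w. w \<in> W \<Longrightarrow> conj_sum 1 w z = \<zero>\<^bsub>L\<^esub>" for z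
  proof (rule ccontr)
    assume nz: "z \<noteq> \<zero>\<^bsub>R\<^esub>"
    define qs where "qs = map (\<lambda>i. h z [^]\<^bsub>L\<^esub> (q ^ i)) [0..<n]"
    have hz: "h z \<noteq> \<zero>\<^bsub>L\<^esub>" using hom_zeroD[OF z] nz by blast
    have qs: "set qs \<subseteq> carrier L" "qs \<noteq> []" "last qs \<noteq> \<zero>\<^bsub>L\<^esub>"
      using z n0 L.nat_pow_nonzero[OF _ hz] by (auto simp: qs_def last_map)
    have "L.horner qs w = \<zero>\<^bsub>L\<^esub>" if w: "w \<in> W" for w
    proof -
      have "L.horner qs w = (\<Oplus>\<^bsub>L\<^esub>t\<in>{..<length qs}. qs ! t \<otimes>\<^bsub>L\<^esub> w [^]\<^bsub>L\<^esub> t)"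
        by (rule L.horner_eq_finsum[OF qs(1) WL(1)[OF w]])
      also have "\<dots> = conj_sum 1 w z"
        unfolding conj_sum_def L.frob_comb_def using WL[OF w] z
        by (intro L.finsum_cong') (auto simp: qs_def L.m_comm)
      finally show ?thesis using that \<open>\<And>w. w \<in> W \<Longrightarrow> conj_sum 1 w z = \<zero>\<^bsub>L\<^esub>\<close> by simp
    qed
    then have "W \<subseteq> {w \<in> carrier L. L.horner qs w = \<zero>\<^bsub>L\<^esub>}" using WL by auto
    then have "card W < length qs"
      using L.card_horner_roots[OF qs] card_mono le_less_trans by metis
    then show False by (simp add: cW qs_def)
  qed
  have inj: "inj_on \<Phi> (carrier R)"
  proof (rule inj_onI)
    fix x y assume x: "x \<in> carrier R" and y: "y \<in> carrier R" and eq: "\<Phi> x = \<Phi> y"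
    have "x \<ominus>\<^bsub>R\<^esub> y = \<zero>\<^bsub>R\<^esub>"
    proof (rule zero)
      show "x \<ominus>\<^bsub>R\<^esub> y \<in> carrier R" using x y by simp
      fix w assume w: "w \<in> W"
      then have "conj_sum 1 w x = conj_sum 1 w y" using eq by (metis \<Phi>_def restrict_apply')
      moreover have "x = (x \<ominus>\<^bsub>R\<^esub> y) \<oplus>\<^bsub>R\<^esub> y" using x y by (simp add: a_minus_def a_assoc l_neg)
      then have "conj_sum 1 w x = conj_sum 1 w (x \<ominus>\<^bsub>R\<^esub> y) \<oplus>\<^bsub>L\<^esub> conj_sum 1 w y"
        using conj_sum_add[OF WL(1)[OF w], of "x \<ominus>\<^bsub>R\<^esub> y" y 1] x y by simp
      ultimately have "\<zero>\<^bsub>L\<^esub> \<oplus>\<^bsub>L\<^esub> conj_sum 1 w y = conj_sum 1 w (x \<ominus>\<^bsub>R\<^esub> y) \<oplus>\<^bsub>L\<^esub> conj_sum 1 w y"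
        using conj_sum_closed[OF WL(1)[OF w] y, of 1] by simp
      then show "conj_sum 1 w (x \<ominus>\<^bsub>R\<^esub> y) = \<zero>\<^bsub>L\<^esub>"
        using conj_sum_closed[OF WL(1)[OF w], of _ 1] x y by (subst (asm) L.add.r_cancel) auto
    qed
    then show "x = y" using x y by simp
  qed
  have img: "\<Phi> ` carrier R \<subseteq> PiE W E" using TE by (auto simp: \<Phi>_def)
  have finPi: "finite (PiE W E)" using finW E by (intro finite_PiE) auto
  have cPi: "q ^ n \<le> (\<Prod>w\<in>W. card (E w))"
    using card_mono[OF finPi img] by (simp add: card_image[OF inj] card_R card_PiE[OF finW])
  \<comment> \<open>A product of n sets of size at most q has room for q^n elements only if each set
    has size exactly q.\<close>
  have Eq: "card (E w) = q" if w: "w \<in> W" for w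
  proof (rule antisym[OF E(2)[OF w]])
    have "q ^ n \<le> card (E w) * (\<Prod>v\<in>W - {w}. card (E v))"
      using cPi by (simp add: prod.remove[OF finW w])
    also have "\<dots> \<le> card (E w) * (\<Prod>v\<in>W - {w}. q)"
      using E(2) by (intro mult_left_mono prod_mono) auto
    also have "\<dots> = card (E w) * q ^ (n - 1)" using cW w finW by simp
    finally have "q * q ^ (n - 1) \<le> card (E w) * q ^ (n - 1)" using n0 by (simp add: power_eq_if)
    then show "q \<le> card (E w)" using q_ge_2 by simp
  qed
  have "card (PiE W E) = q ^ n" using Eq cW by (simp add: card_PiE[OF finW])
  then have onto: "\<Phi> ` carrier R = PiE W E"
    by (intro card_subset_eq finPi img) (simp add: card_image[OF inj] card_R)
  have "(q - 1) ^ n = (\<Prod>w\<in>W. card (E w - {\<zero>\<^bsub>L\<^esub>}))"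
    using Eq E cW by (simp add: card_Diff_singleton)
  also have "\<dots> = card (PiE W (\<lambda>w. E w - {\<zero>\<^bsub>L\<^esub>}))" by (simp add: card_PiE[OF finW])
  also have "\<dots> \<le> card (\<Phi> ` {x \<in> carrier R. indep_conjugates x})"
  proof (rule card_mono)
    show "finite (\<Phi> ` {x \<in> carrier R. indep_conjugates x})" using fin by simp
    show "PiE W (\<lambda>w. E w - {\<zero>\<^bsub>L\<^esub>}) \<subseteq> \<Phi> ` {x \<in> carrier R. indep_conjugates x}"
    proof
      fix f assume f: "f \<in> PiE W (\<lambda>w. E w - {\<zero>\<^bsub>L\<^esub>})"
      then have "f \<in> PiE W E" by (auto simp: PiE_iff)
      then obtain x where x: "x \<in> carrier R" "f = \<Phi> x" using onto by blast
      have "conj_sum 1 w x \<noteq> \<zero>\<^bsub>L\<^esub>" if w: "w \<in> W" for w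
        using f w unfolding x(2) by (auto simp: \<Phi>_def PiE_iff)
      then have "indep_conjugates x"
        by (intro indep_conjugates_criterion[of 0 n "{1}", OF _ _ x(1)]) (use nq in \<open>auto simp: W_def\<close>)
      then show "f \<in> \<Phi> ` {x \<in> carrier R. indep_conjugates x}" using x by blast
    qed
  qed
  also have "\<dots> \<le> card {x \<in> carrier R. indep_conjugates x}"
    using fin by (intro card_image_le) auto
  finally show ?thesis .
qed

end

context finite_field_pow
begin

lemma indep_conjugates_nonzero: "indep_conjugates x \<Longrightarrow> x \<noteq> \<zero>"
proof
  assume ind: "indep_conjugates x" and x: "x = \<zero>"
  have "frob_comb (q ^ 1) (n div 1) (\<lambda>_. \<one>) x = (\<Oplus>i\<in>{..<n div 1}. \<zero>)"
    unfolding frob_comb_def using q_ge_2 x by (intro finsum_cong') (auto simp: nat_pow_zero)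
  then have "frob_comb (q ^ 1) (n div 1) (\<lambda>_. \<one>) x = \<zero>" by simp
  moreover have "\<one> \<in> K 1" by (simp add: K_def)
  ultimately have "\<one> = \<zero>"
    using ind[unfolded indep_conjugates_def, rule_format, of 1 "\<lambda>_. \<one>" 0] n by simp
  then show False by simp
qed

text \<open>Here M = 39. Of the 624 nonzero elements at least 4^4 = 256 have independent conjugates
  and exactly 384 are free of 3 and 13; as 256 + 384 > 624, some element is both. The sieve cannot
  succeed: four subgroups of size 125 take up 500 of 625 elements, and even the best splitting, with
  3 in P and 13 in P', leads to 648.\<close>

lemma exceptional_5_4:
  assumes "q = 5" "n = 4"
  shows "\<exists>y \<in> carrier R. primitive_element R y \<and> completely_normal R q n y"
proof -
  interpret cl: algebraic_closure alg_closure "indexed_const ` (carrier R)"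
    by (rule alg_closureE(1))
  interpret c: finite_field_closure R g p e q n alg_closure indexed_const
    by unfold_locales (rule alg_closureE(2))
  let ?A = "{x \<in> carrier R. indep_conjugates x}"
  have N: "N = 624" by (simp add: N_eq assms)
  have A: "card ?A \<ge> 256" using c.card_indep_conjugates_ge by (simp add: assms)
  have "real (card (free_set {3, 13})) = (\<Prod>r\<in>{3, 13}. 1 - 1 / real r) * real N"
    by (rule card_free_set) (auto simp: N)
  then have F: "card (free_set {3, 13}) = 384" by (simp add: N)
  have "?A \<inter> free_set {3, 13} \<noteq> {}"
  proof
    assume "?A \<inter> free_set {3, 13} = {}"
    moreover have "finite ?A" "finite (free_set {3, 13})" using fin by (auto simp: free_set_def)
    ultimately have "card (?A \<union> free_set {3, 13}) = card ?A + card (free_set {3, 13})"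
      by (intro card_Un_disjoint) auto
    moreover have "card (?A \<union> free_set {3, 13}) \<le> card (carrier R - {\<zero>})"
      using fin indep_conjugates_nonzero by (intro card_mono) (auto simp: free_set_def)
    ultimately show False using A F card_nonzero N by simp
  qed
  then obtain x where x: "x \<in> carrier R" "indep_conjugates x" "x \<in> free_set {3, 13}" by blast
  show ?thesis
  proof (rule primitive_completely_normalI)
    show "x \<in> carrier R" "x \<noteq> \<zero>" "indep_conjugates x" using x indep_conjugates_nonzero by auto
    fix r assume r: "Factorial_Ring.prime r" "r dvd N div ((q - 1) * gcd n (q - 1))"
    have "r dvd 3 * 13" using r(2) by (simp add: N assms)
    then have "r dvd 3 \<or> r dvd 13" using r(1) prime_dvd_mult_iff by blast
    then have "r = 3 \<or> r = 13" using r(1) primes_dvd_imp_eq[of r 3] primes_dvd_imp_eq[of r 13] by auto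
    then show "\<not> r dvd ind x" using x(3) by (auto simp: free_set_def)
  qed
qed

lemma degree_1:
  assumes "n = 1"
  shows "\<exists>y \<in> carrier R. primitive_element R y \<and> completely_normal R q n y"
proof -
  have "primitive_element R g" using primitive_g_pow[of 1] g_carrier by simp
  moreover have "indep_conjugates g"
    unfolding indep_conjugates_def
  proof (intro allI impI)
    fix d c i assume "d dvd n" "\<forall>i<n div d. c i \<in> K d" "frob_comb (q ^ d) (n div d) c g = \<zero>" "i < n div d"
    then have "d = 1" "i = 0" "c 0 \<in> carrier R" "frob_comb q 1 c g = \<zero>"
      using assms K_subset by auto
    then show "c i = \<zero>"
      using g_carrier g_nonzero by (simp add: frob_comb_def lessThan_Suc integral_iff)
  qed
  ultimately show ?thesis using completely_normalI g_carrier by blast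
qed

text \<open>Every generator works. A relation over the ground field would put g^(q-1) into that
  field, whence q^2 - 1 would divide (q-1)^2, and q + 1 would divide q - 1.\<close>

lemma degree_2:
  assumes "n = 2"  "p \<noteq> 2"
  shows "\<exists>y \<in> carrier R. primitive_element R y \<and> completely_normal R q n y"
proof -
  have prim: "primitive_element R g" using primitive_g_pow[of 1] g_carrier by simp
  have "indep_conjugates g"
    unfolding indep_conjugates_def
  proof (intro allI impI)
    fix d c i assume d: "d dvd n" and c: "\<forall>i<n div d. c i \<in> K d"
      and rel: "frob_comb (q ^ d) (n div d) c g = \<zero>" and i: "i < n div d"
    have "d \<noteq> 0" using d assms by (intro notI) simp
    moreover have "d \<le> 2" using d assms by (auto dest: dvd_imp_le)
    ultimately consider "d = 2" | "d = 1" by linarith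
    then show "c i = \<zero>"
    proof cases
      case 1
      then have "i = 0" "c 0 \<in> carrier R" using i c K_subset assms by auto
      then show ?thesis
        using 1 rel g_carrier g_nonzero assms by (simp add: frob_comb_def lessThan_Suc integral_iff)
    next
      case 2
      have cK: "c 0 \<in> K 1" "c 1 \<in> K 1" using c 2 assms by auto
      then have cR: "c 0 \<in> carrier R" "c 1 \<in> carrier R" using K_subset by auto
      have two: "{..<2} = {0, 1::nat}" by auto
      have r: "c 0 \<otimes> g \<oplus> c 1 \<otimes> g [^] q = \<zero>"
        using rel g_carrier cR 2 assms by (simp add: frob_comb_def two)
      have gq: "g [^] q = g [^] (q - 1) \<otimes> g" using q_ge_2 nat_pow_Suc[of g "q - 1"] by simp
      have "(c 0 \<oplus> c 1 \<otimes> g [^] (q - 1)) \<otimes> g = \<zero>"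
        using r cR g_carrier by (simp add: gq l_distr m_assoc)
      then have r': "c 0 \<oplus> c 1 \<otimes> g [^] (q - 1) = \<zero>"
        using cR g_carrier g_nonzero by (simp add: integral_iff)
      have c1: "c 1 = \<zero>"
      proof (rule ccontr)
        assume nz: "c 1 \<noteq> \<zero>"
        interpret K1: subfield "K 1" R by (rule K_subfield)
        have U: "c 1 \<in> Units R" using nz cR field_Units by auto
        have "c 1 \<otimes> g [^] (q - 1) = \<ominus> c 0"
          using r' cR by (metis a_comm g_pow_carrier m_closed minus_equality)
        then have "g [^] (q - 1) = inv (c 1) \<otimes> (\<ominus> c 0)"
          using U cR by (metis Units_inv_closed Units_l_inv g_pow_carrier l_one m_assoc)
        moreover have "inv (c 1) \<in> K 1" using subfield_m_inv(1)[OF K_subfield] cK nz by auto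
        ultimately have "g [^] (q - 1) \<in> K 1"
          using cK subringE(5,6)[OF subfieldE(1)[OF K_subfield]] by auto
        then have "(g [^] (q - 1)) [^] (q - 1) = \<one>" by (subst (asm) in_K_nonzero_iff) auto
        then have "g [^] ((q - 1) * (q - 1)) = g [^] (0::nat)"
          using g_carrier by (simp add: nat_pow_pow)
        then have "((q - 1) * (q - 1)) mod N = 0 mod N" by (simp only: g_pow_eq_iff)
        then have "N dvd (q - 1) * (q - 1)" by (simp add: mod_eq_0_iff_dvd)
        moreover have "N = (q - 1) * (q + 1)"
          using q_ge_2 by (simp add: N_eq assms power2_eq_square algebra_simps)
        ultimately have "(q - 1) * (q + 1) dvd (q - 1) * (q - 1)" by (simp only:)
        then have "q + 1 dvd q - 1" using q_ge_2 nat_mult_dvd_cancel1[of "q - 1" "q + 1" "q - 1"] by simp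
        then show False using q_ge_2 by (auto dest: dvd_imp_le)
      qed
      then have "c 0 = \<zero>" using r' cR by simp
      moreover have "i = 0 \<or> i = 1" using i 2 assms by auto
      ultimately show ?thesis using c1 by auto
    qed
  qed
  then show ?thesis using prim completely_normalI g_carrier by blast
qed

end

section \<open>Explicit criteria\<close>

text \<open>Each prime factor \<open>r \<ge> 16\<close> of \<open>M\<close> contributes at most \<open>1\<close> to the quotient of \<open>16 ^ \<omega>(M)\<close> by
  the radical of \<open>M\<close>, so only the six primes below \<open>16\<close> matter.\<close>

definition small_prime_factor :: "nat \<Rightarrow> real" where
  "small_prime_factor M = (if 2 dvd M then 8 else 1) * (if 3 dvd M then 16 / 3 else 1)
    * (if 5 dvd M then 16 / 5 else 1) * (if 7 dvd M then 16 / 7 else 1)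
    * (if 11 dvd M then 16 / 11 else 1) * (if 13 dvd M then 16 / 13 else 1)"

text \<open>All six factors together give 8 * 16^5 / 15015, which lies between 558 and 559.\<close>

lemma small_prime_factor_le: "small_prime_factor M \<le> 559"
proof -
  have *: "(if b then x else 1) \<le> x" if "1 \<le> x" for x :: real and b using that by simp
  have "small_prime_factor M \<le> 8 * (16 / 3) * (16 / 5) * (16 / 7) * (16 / 11) * (16 / 13)"
    unfolding small_prime_factor_def by (intro mult_mono *) auto
  then show ?thesis by simp
qed

lemma small_prime_factor_nonneg: "small_prime_factor M \<ge> 0"
  unfolding small_prime_factor_def by (intro mult_nonneg_nonneg) simp_all

lemma prime_less_16: "Factorial_Ring.prime (r::nat) \<Longrightarrow> r < 16 \<Longrightarrow> r \<in> {2, 3, 5, 7, 11, 13}"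
proof -
  assume r: "Factorial_Ring.prime r" "r < 16"
  have "r \<in> {0,1,2,3,4,5,6,7,8,9,10,11,12,13,14,15}" using r(2) by (simp only: insert_iff empty_iff) presburger
  then show ?thesis using r(1) by auto
qed

lemma sixteen_power_omega_le:
  assumes "M > 0"
  shows "16 ^ card {r. Factorial_Ring.prime r \<and> r dvd M} \<le> small_prime_factor M * real M"
proof -
  define A where "A = {r. Factorial_Ring.prime r \<and> r dvd M}"
  have finA: "finite A" by (rule finite_subset[of _ "{r. r dvd M}"]) (use assms in \<open>auto simp: A_def\<close>)
  have pos: "r > 0" if "r \<in> A" for r using that prime_gt_0_nat by (auto simp: A_def)
  have "finite B \<Longrightarrow> B \<subseteq> A \<Longrightarrow> \<Prod>B dvd M" for B
  proof (induction B rule: finite_induct)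
    case (insert r B)
    have "coprime r (\<Prod>B)"
      using insert.hyps insert.prems by (intro prod_coprime_right) (auto simp: A_def intro!: primes_coprime)
    then show ?case using insert by (simp add: divides_mult A_def)
  qed simp
  then have "\<Prod>A dvd M" using finA by blast
  then have "\<Prod>A \<le> M" using assms by (intro dvd_imp_le)
  then have le: "real (\<Prod>A) \<le> real M" by (simp only: of_nat_le_iff)
  define f where "f r = (if r < 16 then 16 / real r else 1)" for r :: nat
  have "(16::real) ^ card A = (\<Prod>r\<in>A. 16 / real r) * real (\<Prod>A)"
    using pos finA by (auto simp add: prod_dividef)
  also have "\<dots> \<le> (\<Prod>r\<in>A. f r) * real (\<Prod>A)"
    using pos by (intro mult_right_mono prod_mono) (auto simp: f_def prod_nonneg)
  also have "(\<Prod>r\<in>A. f r) = (\<Prod>r\<in>A \<inter> {2, 3, 5, 7, 11, 13}. f r)"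
  proof (rule prod.mono_neutral_right[OF finA])
    show "\<forall>i\<in>A - A \<inter> {2, 3, 5, 7, 11, 13}. f i = 1"
      using prime_less_16 unfolding A_def f_def by (metis (no_types, lifting) DiffE IntI mem_Collect_eq)
  qed auto
  also have "\<dots> = (\<Prod>r\<in>{2, 3, 5, 7, 11, 13}. if r dvd M then f r else 1)"
  proof -
    have "A \<inter> {2, 3, 5, 7, 11, 13} = {r \<in> {2, 3, 5, 7, 11, 13}. r dvd M}" by (auto simp: A_def)
    then show ?thesis by (simp only: prod.inter_filter finite.intros)
  qed
  also have "\<dots> = small_prime_factor M"
  proof -
    have fv: "f 2 = 8" "f 3 = 16 / 3" "f 5 = 16 / 5" "f 7 = 16 / 7" "f 11 = 16 / 11" "f 13 = 16 / 13"
      by (simp_all add: f_def)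
    show ?thesis by (simp add: small_prime_factor_def mult.assoc fv cong: if_cong split del: if_split)
  qed
  also have "small_prime_factor M * real (\<Prod>A) \<le> small_prime_factor M * real M"
    by (intro mult_left_mono le small_prime_factor_nonneg)
  finally show ?thesis by (simp add: A_def)
qed

text \<open>The usual divisor sum, written with codivisors because m/d is the bound for the number
  of roots of unity belonging to d.\<close>

definition sigma :: "nat \<Rightarrow> nat" where "sigma m = (\<Sum>d | d dvd m. m div d)"

text \<open>A divisor d of n equals p^i times gcd(d,m) with i <= l, so each divisor of m occurs as a
  gcd at most l + 1 times.\<close>

lemma sum_divisors_le_sigma:
  assumes p: "Factorial_Ring.prime (p::nat)" and m: "m > 0" and n: "n = p ^ l * m"
  shows "(\<Sum>d | d dvd n. m div gcd d m) \<le> (l + 1) * sigma m"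
proof -
  have p1: "p > 1" using prime_gt_1_nat[OF p] .
  have n0: "n > 0" using n m p1 by simp
  have fin: "finite {d. d dvd n}" "finite {d. d dvd m}" using n0 m by auto
  define F where "F d = (multiplicity p (d div gcd d m), gcd d m)" for d
  have dec: "d div gcd d m dvd p ^ l" if d: "d dvd n" for d
  proof -
    define c where "c = gcd d m"
    have c0: "c > 0" using m by (simp add: c_def)
    obtain a b where ab: "d = c * a" "m = c * b" unfolding c_def by (meson dvdE gcd_dvd1 gcd_dvd2)
    have "coprime a b"
      using ab c0 by (metis c_def gcd_mult_distrib_nat coprime_iff_gcd_eq_1 mult.right_neutral mult_left_cancel neq0_conv)
    moreover have "a dvd p ^ l * b"
      using d c0 unfolding n ab by (metis dvd_times_left_cancel_iff mult.left_commute neq0_conv)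
    ultimately have "a dvd p ^ l" by (simp add: coprime_dvd_mult_left_iff)
    moreover have "d div c = a" using ab(1) c0 by simp
    ultimately show ?thesis by (simp add: c_def)
  qed
  have powd: "d = p ^ multiplicity p (d div gcd d m) * gcd d m" "multiplicity p (d div gcd d m) \<le> l"
    if d: "d dvd n" for d
  proof -
    obtain i where i: "i \<le> l" "d div gcd d m = p ^ i"
      using dec[OF d] divides_primepow_nat[OF p] by auto
    then have mu: "multiplicity p (d div gcd d m) = i" using p1 p by simp
    show "multiplicity p (d div gcd d m) \<le> l" using mu i by simp
    have "d = d div gcd d m * gcd d m" by simp
    then show "d = p ^ multiplicity p (d div gcd d m) * gcd d m" using mu i by simp
  qed
  have "inj_on F {d. d dvd n}"
    by (rule inj_onI) (metis F_def mem_Collect_eq powd(1) prod.inject)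
  then have "(\<Sum>d | d dvd n. m div gcd d m) = (\<Sum>x\<in>F ` {d. d dvd n}. m div snd x)"
    by (subst sum.reindex) (auto simp: F_def)
  also have "\<dots> \<le> (\<Sum>x\<in>{..l} \<times> {d. d dvd m}. m div snd x)"
    using fin powd(2) by (intro sum_mono2) (auto simp: F_def)
  also have "\<dots> = (\<Sum>i\<le>l. \<Sum>d | d dvd m. m div d)"
    unfolding sum.cartesian_product by (simp add: case_prod_beta)
  also have "\<dots> = (l + 1) * sigma m" by (simp add: sigma_def)
  finally show ?thesis .
qed

text \<open>Replacing the divisors by all numbers from 1 to n leaves a geometric series.\<close>

lemma sum_divisor_powers_le:
  assumes q: "q \<ge> 2" and n: "n > 0"
  shows "(\<Sum>d | d dvd n. real (m div gcd d m) * real (q ^ (n - d))) \<le> real m / (real q - 1) * real (q ^ n)"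
proof -
  have "(\<Sum>d | d dvd n. real (m div gcd d m) * real (q ^ (n - d))) \<le> (\<Sum>d | d dvd n. real m * real (q ^ (n - d)))"
    by (intro sum_mono mult_right_mono) (auto simp: div_le_dividend)
  also have "\<dots> \<le> (\<Sum>d\<in>{1..n}. real m * real (q ^ (n - d)))"
    using n by (intro sum_mono2) (auto simp: Suc_le_eq dvd_pos_nat dest: dvd_imp_le)
  also have "\<dots> = real m * (\<Sum>i<n. real q ^ i)"
    unfolding sum_distrib_left
    by (rule sum.reindex_bij_witness[of _ "\<lambda>i. n - i" "\<lambda>d. n - d"]) auto
  also have "(\<Sum>i<n. real q ^ i) = (real q ^ n - 1) / (real q - 1)"
    using q by (simp add: geometric_sum)
  also have "real m * ((real q ^ n - 1) / (real q - 1)) = real m / (real q - 1) * (real (q ^ n) - 1)" by simp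
  also have "\<dots> \<le> real m / (real q - 1) * real (q ^ n)"
    using q by (intro mult_left_mono) auto
  finally show ?thesis .
qed

section \<open>Criteria in terms of q, n and m\<close>

context finite_field_pow
begin

lemma index_pos: "(q ^ n - 1) div ((q - 1) * gcd n (q - 1)) > 0"
  using norm_kernel_dvd N_pos by (metis N_eq dvd_div_eq_0_iff gr0I less_numeral_extra(3))

text \<open>Here \<delta> is a fraction of the field that the subgroups leave over, and N0 bounds
  their number. It suffices that N0 * 2^omega <= \<delta> * sqrt(Q); the fourth power of this
  follows from 16^omega <= c * M and M * h <= Q.\<close>

lemma omega_criterion:
  assumes nlm: "n = p ^ l * m" and D: "D = {d. d dvd n} \<or> m dvd (q - 1) \<and> D = {1}"
    and S: "(\<Sum>d\<in>D. real (m div gcd d m) * real (q ^ (n - d))) \<le> (1 - \<delta>) * real (q ^ n)"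
    and \<delta>: "\<delta> > 0" and N0: "(\<Sum>d\<in>D. m div gcd d m) \<le> N0"
    and bound: "small_prime_factor ((q ^ n - 1) div ((q - 1) * gcd n (q - 1))) * real N0 ^ 4
      \<le> \<delta> ^ 4 * real (q ^ n) * real ((q - 1) * gcd n (q - 1))"
  shows "\<exists>y \<in> carrier R. primitive_element R y \<and> completely_normal R q n y"
proof -
  define h where "h = (q - 1) * gcd n (q - 1)"
  define M where "M = (q ^ n - 1) div h"
  define P where "P = {r. Factorial_Ring.prime r \<and> r dvd M}"
  define Q where "Q = real (q ^ n)"
  define w where "w = card P"
  have M0: "M > 0" using index_pos by (simp add: M_def h_def)
  have h0: "h > 0" using q_ge_2 n by (simp add: h_def)
  have Q0: "Q > 0" using q_ge_2 by (simp add: Q_def)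
  have finP: "finite P" by (rule finite_subset[of _ "{r. r dvd M}"]) (use M0 in \<open>auto simp: P_def\<close>)
  have "M * h = q ^ n - 1" using norm_kernel_dvd by (simp add: M_def h_def N_eq)
  then have MQ: "real M * real h \<le> Q" by (simp add: Q_def flip: of_nat_mult)
  have w16: "16 ^ w \<le> small_prime_factor M * real M"
    using sixteen_power_omega_le[OF M0] by (simp add: w_def P_def)
  have "real N0 ^ 4 * 16 ^ w * real h \<le> real N0 ^ 4 * (small_prime_factor M * real M) * real h"
    by (intro mult_left_mono mult_right_mono w16) auto
  also have "\<dots> = small_prime_factor M * real N0 ^ 4 * (real M * real h)" by (simp add: mult_ac)
  also have "\<dots> \<le> (\<delta> ^ 4 * Q * real h) * Q"
  proof (rule mult_mono[OF _ MQ])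
    show "small_prime_factor M * real N0 ^ 4 \<le> \<delta> ^ 4 * Q * real h"
      using bound by (simp only: M_def h_def Q_def)
  qed (use \<delta> Q0 in auto)
  also have "\<dots> = (\<delta> ^ 4 * Q ^ 2) * real h" by (simp only: power2_eq_square mult_ac)
  finally have "real N0 ^ 4 * 16 ^ w * real h \<le> (\<delta> ^ 4 * Q ^ 2) * real h" .
  then have *: "real N0 ^ 4 * 16 ^ w \<le> \<delta> ^ 4 * Q ^ 2" using h0 by simp
  have "(16::real) ^ w = (2 ^ w) ^ 4"
    by (simp add: power_mult[symmetric] mult.commute[of w 4]) (simp add: power_mult)
  moreover have "Q ^ 2 = sqrt Q ^ 4" using Q0
    by (metis less_eq_real_def power_mult real_sqrt_pow2 mult_2 numeral_Bit0)
  ultimately have "(real N0 * 2 ^ w) ^ 4 \<le> (\<delta> * sqrt Q) ^ 4"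
    using * by (simp add: power_mult_distrib)
  then have le: "real N0 * 2 ^ w \<le> \<delta> * sqrt Q"
    using \<delta> Q0 by (simp add: power_mono_iff)
  define S0 where "S0 = (\<Sum>d\<in>D. real (m div gcd d m))"
  have "finite D" "1 \<in> D" using D n by auto
  then have "m div gcd 1 m \<le> (\<Sum>d\<in>D. m div gcd d m)"
    by (intro member_le_sum) auto
  then have "real (m div gcd 1 m) \<le> S0" unfolding S0_def of_nat_sum[symmetric] of_nat_le_iff .
  moreover have "m > 0" using nlm n by (cases m) auto
  ultimately have S1: "S0 \<ge> 1" by simp
  have SN: "S0 \<le> real N0" using N0 unfolding S0_def of_nat_sum[symmetric] of_nat_le_iff .
  have "S0 * (2 ^ w - 1) * sqrt Q < S0 * 2 ^ w * sqrt Q"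
    using S1 Q0 by (intro mult_strict_right_mono) auto
  also have "\<dots> \<le> real N0 * 2 ^ w * sqrt Q"
    using SN Q0 by (intro mult_right_mono) auto
  also have "\<dots> \<le> \<delta> * sqrt Q * sqrt Q"
    using le Q0 by (intro mult_right_mono) auto
  also have "\<dots> = \<delta> * Q" using Q0 by simp
  finally have fin: "S0 * (2 ^ w - 1) * sqrt Q < \<delta> * Q" .
  show ?thesis
  proof (rule existence_criterion[OF nlm D finP, of "{}"])
    show "P \<union> {} = {r. Factorial_Ring.prime r \<and> r dvd (q ^ n - 1) div ((q - 1) * gcd n (q - 1))}"
      by (simp add: P_def M_def h_def)
    show "(\<Sum>d\<in>D. real (m div gcd d m) * real (q ^ (n - d)))
        + (\<Sum>d\<in>D. real (m div gcd d m)) * (2 ^ card P - 1) * sqrt (real (q ^ n))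
        + (\<Sum>r\<in>{}. real (q ^ n) / real r) < real (q ^ n)"
      using S fin unfolding S0_def[symmetric] Q_def[symmetric] w_def[symmetric] by (simp add: algebra_simps)
  qed auto
qed

text \<open>Only d = 1 counts, with m subgroups of size q^(n-1), so that \<delta> = 1 - m/q.\<close>

lemma regular_criterion:
  assumes nlm: "n = p ^ l * m" and m: "m dvd q - 1"
    and bound: "small_prime_factor ((q ^ n - 1) div ((q - 1) * gcd n (q - 1))) * real (m ^ 4 * q ^ 4)
      \<le> real ((q - m) ^ 4 * q ^ n * ((q - 1) * gcd n (q - 1)))"
  shows "\<exists>y \<in> carrier R. primitive_element R y \<and> completely_normal R q n y"
proof (rule omega_criterion[OF nlm, of "{1}" "real (q - m) / real q" m])
  have mq: "m < q" using m q_ge_2 by (auto dest!: dvd_imp_le)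
  show "{1} = {d. d dvd n} \<or> m dvd (q - 1) \<and> {1} = {1}" using m by simp
  show "real (q - m) / real q > 0" using mq by simp
  have "real (q ^ n) = real q * real (q ^ (n - 1))" using n by (simp add: power_eq_if)
  then show "(\<Sum>d\<in>{1}. real (m div gcd d m) * real (q ^ (n - d))) \<le> (1 - real (q - m) / real q) * real (q ^ n)"
    using mq by (simp add: of_nat_diff field_simps)
  show "small_prime_factor ((q ^ n - 1) div ((q - 1) * gcd n (q - 1))) * real m ^ 4
      \<le> (real (q - m) / real q) ^ 4 * real (q ^ n) * real ((q - 1) * gcd n (q - 1))"
    using bound q_ge_2 by (simp add: power_divide field_simps)
qed auto

text \<open>The geometric series gives \<delta> = 1 - m/(q-1). One of the four factors q - 1 in the
  denominator cancels against the order of the group of admissible multipliers.\<close>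

lemma general_criterion:
  assumes nlm: "n = p ^ l * m" and m: "m < q - 1" and N0: "(l + 1) * sigma m \<le> N0"
    and bound: "small_prime_factor ((q ^ n - 1) div ((q - 1) * gcd n (q - 1))) * real (N0 ^ 4 * (q - 1) ^ 3)
      \<le> real ((q - 1 - m) ^ 4 * q ^ n * gcd n (q - 1))"
  shows "\<exists>y \<in> carrier R. primitive_element R y \<and> completely_normal R q n y"
proof (rule omega_criterion[OF nlm, of "{d. d dvd n}" "real (q - 1 - m) / real (q - 1)" N0])
  have m0: "m > 0" using nlm n by (cases m) auto
  show "{d. d dvd n} = {d. d dvd n} \<or> m dvd (q - 1) \<and> {d. d dvd n} = {1}" by simp
  show "real (q - 1 - m) / real (q - 1) > 0" using m by simp
  show "(\<Sum>d | d dvd n. m div gcd d m) \<le> N0"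
    using sum_divisors_le_sigma[OF p m0 nlm] N0 by simp
  have "1 - real (q - 1 - m) / real (q - 1) = real m / (real q - 1)"
    using m by (simp add: of_nat_diff field_simps)
  then show "(\<Sum>d | d dvd n. real (m div gcd d m) * real (q ^ (n - d)))
      \<le> (1 - real (q - 1 - m) / real (q - 1)) * real (q ^ n)"
    using sum_divisor_powers_le[OF q_ge_2, of n m] n by simp
  define a where "a = real (q - 1)"
  have a: "a > 0" using q_ge_2 by (simp add: a_def)
  show "small_prime_factor ((q ^ n - 1) div ((q - 1) * gcd n (q - 1))) * real N0 ^ 4
      \<le> (real (q - 1 - m) / real (q - 1)) ^ 4 * real (q ^ n) * real ((q - 1) * gcd n (q - 1))"
    using bound a unfolding of_nat_mult of_nat_power a_def[symmetric]
    by (simp add: power_divide field_simps power4_eq_xxxx power3_eq_cube)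
qed

end

section \<open>Evaluating divisor sums and prime factors\<close>

lemma sigma_eq_sum_list:
  assumes "m > 0"
  shows "sigma m = (\<Sum>d\<leftarrow>[1..<Suc m]. if d dvd m then m div d else 0)"
proof -
  have eq: "{d \<in> {1..<Suc m}. d dvd m} = {d. d dvd m}"
    using assms by (auto simp: Suc_le_eq dvd_pos_nat dest: dvd_imp_le)
  have "(\<Sum>d\<in>{1..<Suc m}. if d dvd m then m div d else 0) = sigma m"
    unfolding sigma_def eq[symmetric] by (rule sum.inter_filter[symmetric]) simp
  then show ?thesis by (simp add: interv_sum_list_conv_sum_set_nat del: upt_Suc)
qed

lemma upt_one_numeral: "[Suc 0..<numeral v] = (if Suc 0 < numeral v then Suc 0 # [2..<numeral v] else [])"
  by (subst upt_rec) (simp add: numeral_2_eq_2 del: upt_Suc)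

lemma sigma_values: "sigma 3 = 4" "sigma 4 = 7" "sigma 5 = 6" "sigma 6 = 12" "sigma 7 = 8" "sigma 8 = 15"
  "sigma 9 = 13" "sigma 10 = 18" "sigma 11 = 12" "sigma 12 = 28"
  by (simp_all add: sigma_eq_sum_list upt_one_numeral upt_rec_numeral del: upt_Suc)

lemma sigma_le: "sigma m \<le> m * (m + 1) div 2"
proof (cases "m = 0")
  case False
  have "sigma m = (\<Sum>d | d dvd m. d)"
    unfolding sigma_def by (rule sum.reindex_bij_witness[of _ "\<lambda>d. m div d" "\<lambda>d. m div d"])
      (use False in \<open>auto simp: dvd_div_eq_0_iff div_dvd_iff_mult\<close>)
  also have "\<dots> \<le> (\<Sum>d\<in>{0..m}. d)"
    using False by (intro sum_mono2) (auto dest: dvd_imp_le)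
  finally show ?thesis using gauss_sum_nat[of m] by simp
qed (simp add: sigma_def)

text \<open>Passing from t to t + 1 at most doubles t and so multiplies the fourth power by at most
  16. This will extend an estimate from one value of p^l to all larger ones.\<close>

lemma quartic_le_exponential:
  fixes A B c t0 k :: nat
  assumes "A * t0 ^ 4 \<le> B" "c \<ge> 16" "t0 \<ge> 1"
  shows "A * (t0 + k) ^ 4 \<le> B * c ^ k"
proof (induction k)
  case (Suc k)
  have "(t0 + Suc k) ^ 4 \<le> (2 * (t0 + k)) ^ 4" using assms by (intro power_mono) auto
  also have "\<dots> = 16 * (t0 + k) ^ 4" by (simp only: power_mult_distrib) simp
  finally have "A * (t0 + Suc k) ^ 4 \<le> A * (16 * (t0 + k) ^ 4)" by (rule mult_left_mono) simp
  also have "\<dots> = 16 * (A * (t0 + k) ^ 4)" by (simp only: mult_ac)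
  also have "\<dots> \<le> c * (B * c ^ k)" by (rule mult_mono) (use Suc assms in auto)
  finally show ?case by (simp add: mult_ac)
qed (use assms in simp)

text \<open>This is the index (7^5 - 1)/6 for the pair (7,5). Trial division may stop below 53, as
  53^2 = 2809.\<close>

lemma prime_2801: "Factorial_Ring.prime (2801::nat)"
proof (rule ccontr)
  assume "\<not> ?thesis"
  then have "\<exists>a. a dvd (2801::nat) \<and> a \<noteq> 1 \<and> a \<noteq> 2801"
    unfolding prime_nat_iff by (metis one_less_numeral_iff semiring_norm(77))
  then obtain a b :: nat where ab: "2801 = a * b" "a \<noteq> 1" "b \<noteq> 1"
    by (metis dvdE mult.right_neutral)
  have trial: "\<not> d dvd 2801" if "1 < d" "d < 53" for d :: nat
  proof -
    have *: "\<forall>d\<in>set [2..<53]. \<not> d dvd (2801::nat)" by simp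
    have "d \<in> set [2..<53]" unfolding set_upt atLeastLessThan_iff using that by linarith
    then show ?thesis by (rule bspec[OF *])
  qed
  have "a \<noteq> 0" "b \<noteq> 0" using ab(1) by (auto intro: Nat.gr0I)
  moreover have "a dvd 2801" "b dvd 2801" unfolding ab(1) by auto
  ultimately have "a \<ge> 53" "b \<ge> 53"
    using trial[of a] trial[of b] ab(2,3) by (meson less_one linorder_neqE_nat not_less)+
  then have "53 * 53 \<le> a * b" by (intro mult_le_mono)
  then show False using ab(1) by simp
qed

lemma prime_divisors_prod_list:
  assumes "\<forall>r\<in>set rs. Factorial_Ring.prime (r::nat)"
  shows "{r. Factorial_Ring.prime r \<and> r dvd prod_list rs} = set rs"
  using assms
proof (induction rs)
  case (Cons r rs)
  have "{s. Factorial_Ring.prime s \<and> s dvd prod_list (r # rs)}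
    = {s. Factorial_Ring.prime s \<and> s dvd r} \<union> {s. Factorial_Ring.prime s \<and> s dvd prod_list rs}"
    by (auto simp: prime_dvd_mult_iff)
  also have "{s. Factorial_Ring.prime s \<and> s dvd r} = {r}"
    using Cons.prems by (auto dest: primes_dvd_imp_eq)
  finally show ?case using Cons by simp
qed (auto simp: prime_nat_iff)

section \<open>Numerical forms of the criteria and the remaining pairs\<close>

locale primitive_cn_setting = finite_field_pow R g p e q n for R (structure) and g p e q n +
  fixes l m :: nat
  assumes m: "m \<ge> 1" and cop: "coprime m p" and nlm: "n = p ^ l * m" and mq: "m < q"
begin

lemma distinct_primes_not_dvd:
  assumes "Factorial_Ring.prime (r::nat)" "Factorial_Ring.prime s" "r \<noteq> s" "r dvd q" "s dvd q"
  shows False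
proof -
  have "r dvd p" "s dvd p" using assms prime_dvd_power unfolding q by blast+
  then have "r = p" "s = p" using assms p primes_dvd_imp_eq by blast+
  then show False using assms by simp
qed

text \<open>Small values that survive the bounds and congruences of the case analysis without being
  prime powers.\<close>

lemma q_neq: "q \<noteq> 6" "q \<noteq> 10" "q \<noteq> 12" "q \<noteq> 14" "q \<noteq> 15" "q \<noteq> 20"
  using distinct_primes_not_dvd[of 2 3] distinct_primes_not_dvd[of 2 5] distinct_primes_not_dvd[of 2 7]
    distinct_primes_not_dvd[of 3 5] by auto

lemma coprime_m_q: "coprime m q" using cop by (simp add: q)

abbreviation "pcn_exists \<equiv> \<exists>y \<in> carrier R. primitive_element R y \<and> completely_normal R q n y"

text \<open>Since m divides gcd(n,q-1), one of the four factors m is absorbed there.\<close>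

lemma regular_559:
  assumes "m dvd q - 1" and bound: "559 * m ^ 3 * q ^ 4 \<le> (q - m) ^ 4 * q ^ n * (q - 1)"
  shows pcn_exists
proof (rule regular_criterion[OF nlm assms(1)])
  let ?M = "(q ^ n - 1) div ((q - 1) * gcd n (q - 1))"
  have "m dvd gcd n (q - 1)" using assms(1) nlm by simp
  then have mg: "m \<le> gcd n (q - 1)" using q_ge_2 by (intro dvd_imp_le) auto
  have "small_prime_factor ?M * real (m ^ 4 * q ^ 4) \<le> 559 * real (m ^ 4 * q ^ 4)"
    by (intro mult_right_mono small_prime_factor_le) auto
  also have "\<dots> = real (559 * m ^ 3 * q ^ 4 * m)" by (simp add: power4_eq_xxxx power3_eq_cube)
  also have "\<dots> \<le> real ((q - m) ^ 4 * q ^ n * (q - 1) * gcd n (q - 1))"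
    unfolding of_nat_le_iff by (intro mult_mono bound mg) auto
  finally show "small_prime_factor ?M * real (m ^ 4 * q ^ 4)
      \<le> real ((q - m) ^ 4 * q ^ n * ((q - 1) * gcd n (q - 1)))" by (simp only: mult.assoc)
qed

text \<open>After division by q^4, the right-hand side of \<open>regular_559\<close> increases in q
  and n, so it may be checked at lower bounds a and b.\<close>

lemma regular_mono:
  assumes "m dvd q - 1" "a \<le> q" "b \<le> n" "4 \<le> b" "1 \<le> a" and bound: "559 * m ^ 3 \<le> (a - m) ^ 4 * a ^ (b - 4) * (a - 1)"
  shows pcn_exists
proof (rule regular_559[OF assms(1)])
  have "559 * m ^ 3 * q ^ 4 \<le> (a - m) ^ 4 * a ^ (b - 4) * (a - 1) * q ^ 4" using bound by simp
  also have "\<dots> \<le> (q - m) ^ 4 * q ^ (n - 4) * (q - 1) * q ^ 4"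
  proof (intro mult_mono)
    have "a ^ (b - 4) \<le> a ^ (n - 4)" using assms by (intro power_increasing) auto
    also have "\<dots> \<le> q ^ (n - 4)" using assms by (intro power_mono) auto
    finally show "a ^ (b - 4) \<le> q ^ (n - 4)" .
  qed (use assms in \<open>auto intro!: power_mono\<close>)
  also have "\<dots> = (q - m) ^ 4 * (q ^ (n - 4) * q ^ 4) * (q - 1)" by (simp only: mult_ac)
  also have "q ^ (n - 4) * q ^ 4 = q ^ n" using assms by (simp flip: power_add)
  finally show "559 * m ^ 3 * q ^ 4 \<le> (q - m) ^ 4 * q ^ n * (q - 1)" .
qed

text \<open>The factor (q-1)^3 is estimated by q^3, which cancels against q^n; what remains
  increases in q and n. The parameter c lets a known common factor of n and q - 1 enter.\<close>

lemma general_mono: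
  assumes "m < q - 1" "(l + 1) * sigma m \<le> N0" "a \<le> q" "b \<le> n" "3 \<le> b" "1 \<le> a" "c \<le> gcd n (q - 1)"
    and bound: "559 * N0 ^ 4 \<le> (a - 1 - m) ^ 4 * a ^ (b - 3) * c"
  shows pcn_exists
proof (rule general_criterion[OF nlm assms(1,2)])
  let ?M = "(q ^ n - 1) div ((q - 1) * gcd n (q - 1))"
  have "small_prime_factor ?M * real (N0 ^ 4 * (q - 1) ^ 3) \<le> 559 * real (N0 ^ 4 * (q - 1) ^ 3)"
    by (intro mult_right_mono small_prime_factor_le) auto
  also have "\<dots> = real (559 * N0 ^ 4 * (q - 1) ^ 3)" by simp
  also have "559 * N0 ^ 4 * (q - 1) ^ 3 \<le> (a - 1 - m) ^ 4 * a ^ (b - 3) * c * q ^ 3"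
    by (intro mult_mono bound power_mono) auto
  also have "\<dots> \<le> (q - 1 - m) ^ 4 * q ^ (n - 3) * gcd n (q - 1) * q ^ 3"
  proof (intro mult_mono)
    have "a ^ (b - 3) \<le> a ^ (n - 3)" using assms by (intro power_increasing) auto
    also have "\<dots> \<le> q ^ (n - 3)" using assms by (intro power_mono) auto
    finally show "a ^ (b - 3) \<le> q ^ (n - 3)" .
  qed (use assms in \<open>auto intro!: power_mono\<close>)
  also have "\<dots> = (q - 1 - m) ^ 4 * (q ^ (n - 3) * q ^ 3) * gcd n (q - 1)" by (simp only: mult_ac)
  also have "q ^ (n - 3) * q ^ 3 = q ^ n" using assms by (simp flip: power_add)
  finally show "small_prime_factor ?M * real (N0 ^ 4 * (q - 1) ^ 3)
      \<le> real ((q - 1 - m) ^ 4 * q ^ n * gcd n (q - 1))" by simp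
qed

text \<open>Pairs in which the constant \<open>559\<close> is too big, but the actual small primes of the index suffice.\<close>

lemma regular_pairs:
  shows "q = 3 \<Longrightarrow> n = 3 \<Longrightarrow> m = 1 \<Longrightarrow> pcn_exists"
    "q = 4 \<Longrightarrow> n = 2 \<Longrightarrow> m = 1 \<Longrightarrow> pcn_exists"
    "q = 4 \<Longrightarrow> n = 4 \<Longrightarrow> m = 1 \<Longrightarrow> pcn_exists"
    "q = 8 \<Longrightarrow> n = 2 \<Longrightarrow> m = 1 \<Longrightarrow> pcn_exists"
    "q = 7 \<Longrightarrow> n = 3 \<Longrightarrow> m = 3 \<Longrightarrow> pcn_exists"
    "q = 13 \<Longrightarrow> n = 3 \<Longrightarrow> m = 3 \<Longrightarrow> pcn_exists"
    "q = 8 \<Longrightarrow> n = 7 \<Longrightarrow> m = 7 \<Longrightarrow> pcn_exists"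
    "q = 9 \<Longrightarrow> n = 4 \<Longrightarrow> m = 4 \<Longrightarrow> pcn_exists"
    "q = 9 \<Longrightarrow> n = 8 \<Longrightarrow> m = 8 \<Longrightarrow> pcn_exists"
  by (rule regular_criterion[OF nlm]; simp add: small_prime_factor_def gcd_non_0_nat)+

lemma general_pairs:
  shows "q = 8 \<Longrightarrow> n = 3 \<Longrightarrow> m = 3 \<Longrightarrow> l = 0 \<Longrightarrow> pcn_exists"
    "q = 8 \<Longrightarrow> n = 5 \<Longrightarrow> m = 5 \<Longrightarrow> l = 0 \<Longrightarrow> pcn_exists"
    "q = 9 \<Longrightarrow> n = 5 \<Longrightarrow> m = 5 \<Longrightarrow> l = 0 \<Longrightarrow> pcn_exists"
    "q = 9 \<Longrightarrow> n = 7 \<Longrightarrow> m = 7 \<Longrightarrow> l = 0 \<Longrightarrow> pcn_exists"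
    "q = 11 \<Longrightarrow> n = 3 \<Longrightarrow> m = 3 \<Longrightarrow> l = 0 \<Longrightarrow> pcn_exists"
    "q = 11 \<Longrightarrow> n = 7 \<Longrightarrow> m = 7 \<Longrightarrow> l = 0 \<Longrightarrow> pcn_exists"
    "q = 11 \<Longrightarrow> n = 8 \<Longrightarrow> m = 8 \<Longrightarrow> l = 0 \<Longrightarrow> pcn_exists"
    "q = 11 \<Longrightarrow> n = 9 \<Longrightarrow> m = 9 \<Longrightarrow> l = 0 \<Longrightarrow> pcn_exists"
    "q = 13 \<Longrightarrow> n = 5 \<Longrightarrow> m = 5 \<Longrightarrow> l = 0 \<Longrightarrow> pcn_exists"
    "q = 17 \<Longrightarrow> n = 3 \<Longrightarrow> m = 3 \<Longrightarrow> l = 0 \<Longrightarrow> pcn_exists"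
    "q = 23 \<Longrightarrow> n = 3 \<Longrightarrow> m = 3 \<Longrightarrow> l = 0 \<Longrightarrow> pcn_exists"
    "q = 8 \<Longrightarrow> n = 6 \<Longrightarrow> m = 3 \<Longrightarrow> l = 1 \<Longrightarrow> pcn_exists"
  by (rule general_criterion[OF nlm _ order_refl]; simp add: small_prime_factor_def gcd_non_0_nat sigma_values)+

text \<open>The number s replaces the square root of q^n by something that can be evaluated, and
  \<open>rs\<close> may list a prime several times.\<close>

lemma regular_explicit:
  assumes "m dvd q - 1" and M: "(q ^ n - 1) div ((q - 1) * gcd n (q - 1)) = prod_list rs"
    and rs: "\<forall>r\<in>set rs. Factorial_Ring.prime (r::nat)"
    and P: "finite P" "finite P'" "P \<inter> P' = {}" "P \<union> P' = set rs"
    and s: "real (q ^ n) \<le> s ^ 2" "s \<ge> 0"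
    and bound: "real (q ^ n) > real m * real (q ^ (n - 1)) + real m * (2 ^ card P - 1) * s
      + (\<Sum>r\<in>P'. real (q ^ n) / real r)"
  shows pcn_exists
proof (rule existence_criterion[OF nlm _ P(1-3), of "{1}"])
  show "{1} = {d. d dvd n} \<or> m dvd q - 1 \<and> {1} = {1}" using assms(1) by simp
  show "P \<union> P' = {r. Factorial_Ring.prime r \<and> r dvd (q ^ n - 1) div ((q - 1) * gcd n (q - 1))}"
    unfolding M prime_divisors_prod_list[OF rs] by (rule P(4))
  have "sqrt (real (q ^ n)) \<le> s" by (intro real_le_lsqrt s)
  then have "real m * (2 ^ card P - 1) * sqrt (real (q ^ n)) \<le> real m * (2 ^ card P - 1) * s"
    by (intro mult_left_mono) auto
  then show "(\<Sum>d\<in>{1}. real (m div gcd d m) * real (q ^ (n - d)))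
      + (\<Sum>d\<in>{1}. real (m div gcd d m)) * (2 ^ card P - 1) * sqrt (real (q ^ n))
      + (\<Sum>r\<in>P'. real (q ^ n) / real r) < real (q ^ n)"
    using bound by simp
qed

text \<open>The sum over the divisors is evaluated exactly here, not through the geometric
  series.\<close>

lemma general_explicit:
  assumes nm: "n = m" and M: "(q ^ n - 1) div ((q - 1) * gcd n (q - 1)) = prod_list rs"
    and rs: "\<forall>r\<in>set rs. Factorial_Ring.prime (r::nat)"
    and P: "finite P" "finite P'" "P \<inter> P' = {}" "P \<union> P' = set rs"
    and s: "real (q ^ n) \<le> s ^ 2" "s \<ge> 0"
    and bound: "real (q ^ n) > (\<Sum>d\<leftarrow>[1..<Suc n]. if d dvd n then real (n div d) * real (q ^ (n - d)) else 0)
      + real (sigma n) * (2 ^ card P - 1) * s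
      + (\<Sum>r\<in>P'. real (q ^ n) / real r)"
  shows pcn_exists
proof (rule existence_criterion[OF nlm _ P(1-3), of "{d. d dvd n}"])
  show "{d. d dvd n} = {d. d dvd n} \<or> m dvd q - 1 \<and> {d. d dvd n} = {1}" by simp
  show "P \<union> P' = {r. Factorial_Ring.prime r \<and> r dvd (q ^ n - 1) div ((q - 1) * gcd n (q - 1))}"
    unfolding M prime_divisors_prod_list[OF rs] by (rule P(4))
  have eq: "{d \<in> {1..<Suc n}. d dvd n} = {d. d dvd n}"
    using n by (auto simp: Suc_le_eq dvd_pos_nat dest: dvd_imp_le)
  have sum: "(\<Sum>d | d dvd n. f d) = (\<Sum>d\<leftarrow>[1..<Suc n]. if d dvd n then f d else (0::real))" for f
  proof -
    have "(\<Sum>d | d dvd n. f d) = (\<Sum>d\<in>{1..<Suc n}. if d dvd n then f d else 0)"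
      unfolding eq[symmetric] by (rule sum.inter_filter) simp
    then show ?thesis by (simp add: interv_sum_list_conv_sum_set_nat del: upt_Suc)
  qed
  have "sqrt (real (q ^ n)) \<le> s" by (intro real_le_lsqrt s)
  then have le: "real (sigma n) * (2 ^ card P - 1) * sqrt (real (q ^ n)) \<le> real (sigma n) * (2 ^ card P - 1) * s"
    by (intro mult_left_mono mult_nonneg_nonneg) auto
  have "gcd d m = d" if "d dvd n" for d using that nm by (simp add: gcd_proj1_iff)
  then have e: "(\<Sum>d | d dvd n. real (m div gcd d m)) = real (sigma n)"
      "(\<Sum>d | d dvd n. real (m div gcd d m) * real (q ^ (n - d))) = (\<Sum>d | d dvd n. real (n div d) * real (q ^ (n - d)))"
    using nm by (simp_all add: sigma_def)
  show "(\<Sum>d | d dvd n. real (m div gcd d m) * real (q ^ (n - d)))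
      + (\<Sum>d | d dvd n. real (m div gcd d m)) * (2 ^ card P - 1) * sqrt (real (q ^ n))
      + (\<Sum>r\<in>P'. real (q ^ n) / real r) < real (q ^ n)"
    unfolding e using bound le unfolding sum by linarith
qed

text \<open>In each line the smaller primes go to P and the larger ones to P': a prime in P doubles
  2^|P|, while a prime in P' costs the fraction 1/r. All numbers q^n in question are squares or 4^3,
  so the last argument is their exact root.\<close>

lemma explicit_pairs_regular:
  shows "q = 2 \<Longrightarrow> n = 2 \<Longrightarrow> m = 1 \<Longrightarrow> pcn_exists" "q = 2 \<Longrightarrow> n = 4 \<Longrightarrow> m = 1 \<Longrightarrow> pcn_exists"
    "q = 2 \<Longrightarrow> n = 8 \<Longrightarrow> m = 1 \<Longrightarrow> pcn_exists" "q = 3 \<Longrightarrow> n = 6 \<Longrightarrow> m = 2 \<Longrightarrow> pcn_exists"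
    "q = 4 \<Longrightarrow> n = 3 \<Longrightarrow> m = 3 \<Longrightarrow> pcn_exists" "q = 4 \<Longrightarrow> n = 6 \<Longrightarrow> m = 3 \<Longrightarrow> pcn_exists"
    "q = 7 \<Longrightarrow> n = 6 \<Longrightarrow> m = 6 \<Longrightarrow> pcn_exists"
  subgoal by (rule regular_explicit[of "[3]" "{}" "{3}" 2]) (auto simp: gcd_non_0_nat)
  subgoal by (rule regular_explicit[of "[3, 5]" "{3}" "{5}" 4]) (auto simp: gcd_non_0_nat)
  subgoal by (rule regular_explicit[of "[3, 5, 17]" "{3}" "{5, 17}" 16]) (auto simp: gcd_non_0_nat)
  subgoal by (rule regular_explicit[of "[2, 7, 13]" "{2}" "{7, 13}" 27]) (auto simp: gcd_non_0_nat)
  subgoal by (rule regular_explicit[of "[7]" "{}" "{7}" 8]) (auto simp: gcd_non_0_nat)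
  subgoal by (rule regular_explicit[of "[5, 7, 13]" "{5, 7}" "{13}" 64]) (auto simp: gcd_non_0_nat)
  subgoal by (rule regular_explicit[of "[2, 2, 19, 43]" "{2}" "{19, 43}" 343]) (auto simp: gcd_non_0_nat)
  done

lemma explicit_pairs_general:
  shows "q = 5 \<Longrightarrow> n = 3 \<Longrightarrow> m = 3 \<Longrightarrow> pcn_exists" "q = 7 \<Longrightarrow> n = 4 \<Longrightarrow> m = 4 \<Longrightarrow> pcn_exists"
    "q = 7 \<Longrightarrow> n = 5 \<Longrightarrow> m = 5 \<Longrightarrow> pcn_exists" "q = 11 \<Longrightarrow> n = 4 \<Longrightarrow> m = 4 \<Longrightarrow> pcn_exists"
    "q = 11 \<Longrightarrow> n = 6 \<Longrightarrow> m = 6 \<Longrightarrow> pcn_exists"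
  subgoal by (rule general_explicit[of "[31]" "{}" "{31}" 12]) 
      (simp, simp add: gcd_non_0_nat, simp, simp, simp, simp, force, simp, simp,
       simp add: sigma_values upt_one_numeral del: upt_Suc)
  subgoal by (rule general_explicit[of "[2, 2, 2, 5, 5]" "{2}" "{5}" 49]) 
      (simp, simp add: gcd_non_0_nat, simp, simp, simp, simp, force, simp, simp,
       simp add: sigma_values upt_one_numeral del: upt_Suc)
  subgoal by (rule general_explicit[of "[2801]" "{}" "{2801}" 130]) 
      (simp, simp add: gcd_non_0_nat, simp only: list.set ball_simps prime_2801 simp_thms, simp, simp, simp, force, simp, simp,
       simp add: sigma_values upt_one_numeral del: upt_Suc)
  subgoal by (rule general_explicit[of "[2, 2, 3, 61]" "{2}" "{3, 61}" 121]) 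
      (simp, simp add: gcd_non_0_nat, simp, simp, simp, simp, force, simp, simp,
       simp add: sigma_values upt_one_numeral del: upt_Suc)
  subgoal by (rule general_explicit[of "[2, 3, 3, 7, 19, 37]" "{2, 3}" "{7, 19, 37}" 1331]) 
      (simp, simp add: gcd_non_0_nat, simp, simp, simp, simp, force, simp, simp,
       simp add: sigma_values upt_one_numeral del: upt_Suc)
  done

section \<open>Case analysis\<close>

lemma p_dvd_q: "p dvd q" using e by (simp add: q)

lemma p_le_q: "p \<le> q" using p_dvd_q q_ge_2 by (intro dvd_imp_le) auto

lemma p_ge_2: "p \<ge> 2" using prime_ge_2_nat[OF p] .

lemma even_q: "even q \<Longrightarrow> p = 2"
proof -
  assume "even q"
  then have "2 dvd p" unfolding q by (rule prime_dvd_power[OF two_is_prime_nat])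
  then show ?thesis using primes_dvd_imp_eq[OF two_is_prime_nat p] by simp
qed

lemma l_le_power: "l + 1 \<le> p ^ l"
proof -
  have "l + 1 \<le> 2 ^ l" by (induction l) auto
  also have "\<dots> \<le> p ^ l" using p_ge_2 by (intro power_mono) auto
  finally show ?thesis .
qed

lemma dvd_q_neq_p: "r dvd m \<Longrightarrow> r > 1 \<Longrightarrow> \<not> r dvd q"
proof
  assume "r dvd m" "r > 1" "r dvd q"
  then have "is_unit r" using coprime_common_divisor[OF coprime_m_q] by blast
  then show False using \<open>r > 1\<close> by simp
qed

lemma power_cases: "p ^ l = 1 \<or> p ^ l = 2 \<and> p = 2 \<and> l = 1 \<or> p ^ l = 3 \<and> p = 3 \<or> p ^ l = 4 \<and> p = 2 \<or> p ^ l \<ge> 5"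
proof (cases "l = 0")
  case False
  then obtain k where k: "l = Suc k" by (cases l) auto
  show ?thesis
  proof (cases k)
    case 0
    have "p \<noteq> 4" using p by auto
    then show ?thesis using k 0 p_ge_2 by auto
  next
    case (Suc j)
    show ?thesis
    proof (cases "p = 2")
      case True
      have "(2::nat) ^ l = 4 * 2 ^ j" by (simp add: k Suc)
      moreover have "(2::nat) ^ j = 1 \<or> 2 ^ j \<ge> (2::nat)" by (cases j) auto
      ultimately show ?thesis using True by auto
    next
      case False
      then have "p \<ge> 3" using p_ge_2 by simp
      then have "3 ^ 2 \<le> p ^ 2" by (intro power_mono) auto
      also have "\<dots> \<le> p ^ l" using k Suc p_ge_2 by (intro power_increasing) auto
      finally show ?thesis by simp
    qed
  qed
qed simp

lemma q_power_of_2: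
  assumes "p = 2"
  shows "q = 2 \<or> q = 4 \<or> q = 8 \<or> q \<ge> 16"
proof -
  consider "e = 1" | "e = 2" | "e = 3" | "e \<ge> 4" using e by linarith
  then show ?thesis
  proof cases
    case 4
    then show ?thesis using power_increasing[of 4 e "2::nat"] by (simp add: q assms)
  qed (auto simp: q assms)
qed

lemma pcn_exists_m_1:
  assumes m1: "m = 1" and n1: "n \<noteq> 1"
  shows pcn_exists
proof -
  have nl: "n = p ^ l" using nlm m1 by simp
  have md: "m dvd q - 1" using m1 by simp
  have "n = 2 \<and> p = 2 \<or> n = 3 \<and> p = 3 \<or> n = 4 \<and> p = 2 \<or> n \<ge> 5"
    using power_cases nl n1 by auto
  then consider "n = 2" "p = 2" | "n = 3" "p = 3" | "n = 4" "p = 2" | "n \<ge> 5" by blast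
  then show ?thesis
  proof cases
    case 1
    consider "q = 2" | "q = 4" | "q = 8" | "q \<ge> 16" using q_power_of_2[OF 1(2)] by blast
    then show ?thesis
    proof cases
      case 4
      show ?thesis
      proof (rule regular_559[OF md])
        \<comment> \<open>For n = 2 \<open>regular_mono\<close> does not apply. What has to be shown
          is 559 q^2 <= (q-1)^5, and 4 * 559 = 2236 is less than 15^3 = 3375.\<close>
        have "15 ^ 3 \<le> (q - 1) ^ 3" using 4 by (intro power_mono) auto
        moreover have "q ^ 2 \<le> (2 * (q - 1)) ^ 2" using 4 by (intro power_mono) auto
        moreover have "(2 * (q - 1)) ^ 2 = 4 * (q - 1) ^ 2" by (simp only: power_mult_distrib) simp
        ultimately have "559 * q ^ 2 \<le> 3375 * (q - 1) ^ 2" "3375 \<le> (q - 1) ^ 3" by simp_all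
        then have "559 * q ^ 2 \<le> (q - 1) ^ 3 * (q - 1) ^ 2" by (meson le_trans mult_le_mono1)
        then have "559 * q ^ 2 * q ^ 2 \<le> (q - 1) ^ 5 * q ^ 2" by (simp flip: power_add)
        moreover have "q ^ 4 = q ^ 2 * q ^ 2" by (simp flip: power_add)
        moreover have "(q - 1) ^ 5 = (q - 1) ^ 4 * (q - 1)" using power_add[of "q - 1" 4 1] by simp
        ultimately show "559 * m ^ 3 * q ^ 4 \<le> (q - m) ^ 4 * q ^ n * (q - 1)"
          by (simp only: m1 1(1) power_one mult_1_right mult.assoc mult.commute[of "q ^ 2" "q - 1"])
      qed
    qed (use 1 m1 explicit_pairs_regular(1) regular_pairs(2,4) in auto)
  next
    case 2
    have "q = 3 \<or> q \<ge> 9"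
    proof (cases "e = 1")
      case False
      then have "3 ^ 2 \<le> p ^ e" using e 2 power_increasing[of 2 e p] by simp
      then show ?thesis by (simp add: q)
    qed (use 2 q in simp)
    then show ?thesis
    proof
      assume q9: "q \<ge> 9"
      show ?thesis
      proof (rule regular_559[OF md])
        \<comment> \<open>For n = 3 the claim amounts to 559 q <= (q-1)^5, and 8^4 = 4096 is
          ample.\<close>
        have a: "8 ^ 4 \<le> (q - 1) ^ 4" using q9 by (intro power_mono) auto
        have "559 * q \<le> 4096 * (q - 1)" using q9 by simp
        also have "\<dots> \<le> (q - 1) ^ 4 * (q - 1)" using a by (intro mult_right_mono) auto
        finally have "559 * q * q ^ 3 \<le> (q - 1) ^ 4 * (q - 1) * q ^ 3" by (rule mult_right_mono) simp
        then show "559 * m ^ 3 * q ^ 4 \<le> (q - m) ^ 4 * q ^ n * (q - 1)"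
          by (simp add: m1 2 power4_eq_xxxx power3_eq_cube mult_ac)
      qed
    qed (use 2 m1 regular_pairs(1) in auto)
  next
    case 3
    consider "q = 2" | "q = 4" | "q \<ge> 8" using q_power_of_2[OF 3(2)] by fastforce
    then show ?thesis
    proof cases
      case 3
      show ?thesis by (rule regular_mono[OF md 3, of 4]) (use m1 \<open>n = 4\<close> in auto)
    qed (use 3 m1 explicit_pairs_regular(2) regular_pairs(3) in auto)
  next
    case 4
    consider "q = 2" | "q = 3" | "q \<ge> 4" using q_ge_2 by linarith
    then show ?thesis
    proof cases
      case 1
      then have p2: "p = 2" using even_q by simp
      have "l \<ge> 3" using 4 nl p2 power_increasing[of l 2 "2::nat"] by (cases "l \<ge> 3") auto
      then have "l = 3 \<or> l \<ge> 4" by auto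
      then show ?thesis
      proof
        assume "l \<ge> 4"
        then have "n \<ge> 16" using power_increasing[of 4 l "2::nat"] by (simp add: nl p2)
        then show ?thesis using regular_mono[OF md, of 2 16] 1 m1 by simp
      qed (use 1 p2 nl m1 explicit_pairs_regular(3) in auto)
    next
      case 2
      then have p3: "p = 3" using p_dvd_q primes_dvd_imp_eq[OF p, of 3] by simp
      have "l \<ge> 2" using 4 nl p3 power_increasing[of l 1 "3::nat"] by (cases "l \<ge> 2") auto
      then have "n \<ge> 9" using power_increasing[of 2 l "3::nat"] by (simp add: nl p3)
      then show ?thesis using regular_mono[OF md, of 3 9] 2 m1 by simp
    next
      case 3
      show ?thesis by (rule regular_mono[OF md 3 4]) (use m1 in auto)
    qed
  qed
qed

text \<open>Both q and p are odd, so either n = 2, where a generator works, or n >= 6.\<close>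

lemma pcn_exists_m_2:
  assumes m2: "m = 2"
  shows pcn_exists
proof -
  have odd: "odd q" using dvd_q_neq_p[of 2] m2 by simp
  then have md: "m dvd q - 1" using m2 q_ge_2 by simp
  have p3: "p \<ge> 3" using p_dvd_q odd p_ge_2 by (cases "p = 2") auto
  show ?thesis
  proof (cases "l = 0")
    case True
    then show ?thesis using degree_2 nlm m2 p3 by simp
  next
    case False
    have n6: "n \<ge> 6" using power_increasing[of 1 l p] False p3 nlm m2 by simp
    have "q \<noteq> 4" using odd by auto
    then consider "q = 3" | "q \<ge> 5" using q_ge_2 mq m2 by linarith
    then show ?thesis
    proof cases
      case 1
      then have p3: "p = 3" using p_le_q p3 by simp
      show ?thesis
      proof (cases "l = 1")
        case True
        then show ?thesis using 1 m2 p3 nlm explicit_pairs_regular(4) by simp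
      next
        case F: False
        then have "n \<ge> 18" using power_increasing[of 2 l "3::nat"] False by (simp add: nlm p3 m2)
        then show ?thesis using regular_mono[OF md, of 3 18] 1 m2 by simp
      qed
    next
      case 2
      show ?thesis by (rule regular_mono[OF md 2 n6]) (use m2 in auto)
    qed
  qed
qed

lemma degree_ge: "l > 0 \<Longrightarrow> 2 * m \<le> n"
  using power_increasing[of 1 l p] p_ge_2 nlm by (simp add: Suc_le_eq)

text \<open>Writing q = m c + 1 leaves few values of q for small m. For large m the least possible
  value q = m + 1 decides, where the power of m + 1 dominates.\<close>

lemma pcn_exists_regular:
  assumes md: "m dvd q - 1" and m3: "m \<ge> 3"
  shows pcn_exists
proof -
  obtain c where c: "q - 1 = m * c" using md by blast
  then have qc: "q = m * c + 1" using q_ge_2 by simp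
  have c1: "c \<ge> 1" using c q_ge_2 by (cases c) auto
  have c2: "c = 1 \<or> c = 2 \<or> c = 3 \<or> c = 4 \<or> c \<ge> 5" using c1 by linarith
  show ?thesis
  proof (cases "l = 0")
    case False
    have n2: "2 * m \<le> n" using degree_ge False by simp
    consider "m = 3" | "m = 4" | "m \<ge> 5" using m3 by linarith
    then show ?thesis
    proof cases
      case 1
      have "q = 4 \<or> q \<ge> 7" using c2 qc 1 by auto
      then show ?thesis
      proof
        assume q4: "q = 4"
        then have p2: "p = 2" using even_q by simp
        show ?thesis
        proof (cases "l = 1")
          case True
          then show ?thesis using q4 1 p2 nlm explicit_pairs_regular(6) by simp
        next
          case F: False
          then have "n \<ge> 12" using power_increasing[of 2 l "2::nat"] False by (simp add: nlm p2 1)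
          then show ?thesis using regular_mono[OF md, of 4 12] q4 1 by simp
        qed
      next
        assume "q \<ge> 7"
        then show ?thesis using regular_mono[OF md, of 7 6] n2 1 by simp
      qed
    next
      case 2
      then have "p \<noteq> 2" using cop by auto
      then have "n \<ge> 12" using power_increasing[of 1 l p] False p_ge_2 by (simp add: nlm 2)
      then show ?thesis using regular_mono[OF md, of 5 12] 2 mq by simp
    next
      case 3
      show ?thesis
      \<comment> \<open>At a = m + 1 the fourth power is 1 and a - 1 = m cancels, so the claim
        becomes 559 m^2 <= (m+1)^(2m-4), with exponent at least 6.\<close>
      proof (rule regular_mono[OF md, of "m + 1" "2 * m"])
        have "559 \<le> (6::nat) ^ 4" by simp
        also have "\<dots> \<le> (m + 1) ^ 4" using 3 by (intro power_mono) auto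
        finally have "559 * m ^ 2 \<le> (m + 1) ^ 4 * (m + 1) ^ 2" by (intro mult_mono power_mono) auto
        also have "\<dots> = (m + 1) ^ 6" by (simp flip: power_add)
        also have "\<dots> \<le> (m + 1) ^ (2 * m - 4)" using 3 by (intro power_increasing) auto
        finally have "559 * m ^ 2 * m \<le> (m + 1) ^ (2 * m - 4) * m" by (rule mult_right_mono) simp
        then show "559 * m ^ 3 \<le> (m + 1 - m) ^ 4 * (m + 1) ^ (2 * m - 4) * (m + 1 - 1)"
          by (simp add: power3_eq_cube power2_eq_square)
      qed (use 3 n2 mq in auto)
    qed
  next
    case True
    then have nm: "n = m" using nlm by simp
    have "m = 3 \<or> m = 4 \<or> m = 5 \<or> m = 6 \<or> m = 7 \<or> m = 8 \<or> m \<ge> 9" using m3 by linarith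
    then consider "m = 3" | "m = 4" | "m = 5" | "m = 6" | "m = 7" | "m = 8" | "m \<ge> 9" by blast
    then show ?thesis
    proof cases
      case 1
      have "q = 4 \<or> q = 7 \<or> q = 13 \<or> q \<ge> 16" using c2 qc 1 q_neq by auto
      then consider "q = 4" | "q = 7" | "q = 13" | "q \<ge> 16" by blast
      then show ?thesis
      proof cases
        case 4
        show ?thesis
        proof (rule regular_559[OF md])
          have a: "13 ^ 4 \<le> (q - 3) ^ 4" using 4 by (intro power_mono) auto
          \<comment> \<open>The constants are 15093 = 559 * 3^3 and 28561 = 13^4; for n = 3 the
            comparison has to be made after cancelling q^3.\<close>
          have "15093 * q \<le> 28561 * (q - 1)" using 4 by simp
          also have "\<dots> \<le> (q - 3) ^ 4 * (q - 1)" using a by (intro mult_right_mono) auto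
          finally have "15093 * q * q ^ 3 \<le> (q - 3) ^ 4 * (q - 1) * q ^ 3" by (rule mult_right_mono) simp
          then show "559 * m ^ 3 * q ^ 4 \<le> (q - m) ^ 4 * q ^ n * (q - 1)"
            by (simp add: 1 nm power4_eq_xxxx power3_eq_cube mult_ac)
        qed
      qed (use 1 nm explicit_pairs_regular(5) regular_pairs(5,6) in auto)
    next
      case 2
      have "q = 5 \<or> q = 9 \<or> q \<ge> 13" using c2 qc 2 by auto
      then consider "q = 5" | "q = 9" | "q \<ge> 13" by blast
      then show ?thesis
      proof cases
        case 3
        show ?thesis by (rule regular_mono[OF md 3, of 4]) (use 2 nm in auto)
      qed (use 2 nm exceptional_5_4 regular_pairs(8) in auto)
    next
      case 3
      have "q \<ge> 11" using c2 qc 3 q_neq by auto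
      then show ?thesis by (rule regular_mono[OF md, of _ 5]) (use 3 nm in auto)
    next
      case 4
      have "q = 7 \<or> q \<ge> 13" using c2 qc 4 by auto
      then show ?thesis
      proof
        assume "q \<ge> 13"
        then show ?thesis by (rule regular_mono[OF md, of _ 6]) (use 4 nm in auto)
      qed (use 4 nm explicit_pairs_regular(7) in auto)
    next
      case 5
      have "q = 8 \<or> q \<ge> 15" using c2 qc 5 by auto
      then show ?thesis
      proof
        assume "q \<ge> 15"
        then show ?thesis by (rule regular_mono[OF md, of _ 7]) (use 5 nm in auto)
      qed (use 5 nm regular_pairs(7) in auto)
    next
      case 6
      have "q = 9 \<or> q \<ge> 17" using c2 qc 6 by auto
      then show ?thesis
      proof
        assume "q \<ge> 17"
        then show ?thesis by (rule regular_mono[OF md, of _ 8]) (use 6 nm in auto)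
      qed (use 6 nm regular_pairs(9) in auto)
    next
      case 7
      show ?thesis
      proof (rule regular_mono[OF md, of "m + 1" m])
        have "559 \<le> (10::nat) ^ 3" by simp
        also have "\<dots> \<le> (m + 1) ^ 3" using 7 by (intro power_mono) auto
        finally have "559 * m ^ 2 \<le> (m + 1) ^ 3 * (m + 1) ^ 2" by (intro mult_mono power_mono) auto
        also have "\<dots> = (m + 1) ^ 5" by (simp flip: power_add)
        also have "\<dots> \<le> (m + 1) ^ (m - 4)" using 7 by (intro power_increasing) auto
        finally have "559 * m ^ 2 * m \<le> (m + 1) ^ (m - 4) * m" by (rule mult_right_mono) simp
        then show "559 * m ^ 3 \<le> (m + 1 - m) ^ 4 * (m + 1) ^ (m - 4) * (m + 1 - 1)"
          by (simp add: power3_eq_cube power2_eq_square)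
      qed (use 7 nm mq in auto)
    qed
  qed
qed

lemma general_l0:
  assumes "l = 0" "m < q - 1" "a \<le> q" "m \<ge> 3" "1 \<le> a" "559 * sigma m ^ 4 \<le> (a - 1 - m) ^ 4 * a ^ (m - 3)"
  shows pcn_exists
  by (rule general_mono[of "sigma m" a m 1]) (use assms nlm in \<open>auto simp: Suc_le_eq\<close>)

text \<open>Here q >= m + 2. Coprimality to m, the failure of m to divide q - 1, and primality of p
  reduce the q below the range of the estimate to pairs settled separately.\<close>

lemma pcn_exists_general_l0:
  assumes nd: "\<not> m dvd q - 1" and m3: "m \<ge> 3" and l0: "l = 0"
  shows pcn_exists
proof -
  have nm: "n = m" using nlm l0 by simp
  have "q - 1 \<noteq> m" using nd by auto
  then have mq1: "m < q - 1" using mq by linarith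
  then have mq2: "q \<ge> m + 2" by linarith
  note G = general_l0[OF l0 mq1 _ m3]
  have "m = 3 \<or> m = 4 \<or> m = 5 \<or> m = 6 \<or> m = 7 \<or> m = 8 \<or> m = 9 \<or> m = 10 \<or> m = 11 \<or> m = 12 \<or> m \<ge> 13"
    using m3 by presburger
  then consider "m = 3" | "m = 4" | "m = 5" | "m = 6" | "m = 7" | "m = 8" | "m = 9" | "m = 10"
    | "m = 11" | "m = 12" | "m \<ge> 13" by blast
  then show ?thesis
  proof cases
    case 1
    have "\<not> 3 dvd q" using dvd_q_neq_p[of 3] 1 by simp
    moreover have "\<not> 3 dvd q - 1" using nd 1 by simp
    ultimately have "q = 5 \<or> q = 8 \<or> q = 11 \<or> q = 14 \<or> q = 17 \<or> q = 20 \<or> q = 23 \<or> q \<ge> 24"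
      using mq2 1 by presburger
    then consider "q = 5" | "q = 8" | "q = 11" | "q = 17" | "q = 23" | "q \<ge> 24"
      using q_neq by blast
    then show ?thesis
    proof cases
      case 6
      then show ?thesis by (rule G) (use 1 in \<open>auto simp: sigma_values\<close>)
    qed (use 1 nm l0 explicit_pairs_general(1) general_pairs(1,5,10,11) in auto)
  next
    case 2
    have od: "odd q" using dvd_q_neq_p[of 2] 2 by simp
    moreover have "\<not> 4 dvd q - 1" using nd 2 by simp
    ultimately have "q = 7 \<or> q = 11 \<or> q = 15 \<or> q \<ge> 19" using mq2 2 by presburger
    then consider "q = 7" | "q = 11" | "q \<ge> 19" using q_neq by blast
    then show ?thesis
    proof cases
      case 3
      \<comment> \<open>The factor 2 from the gcd is essential: at q = 19 the estimate with c = 1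
        fails.\<close>
      have "2 dvd gcd n (q - 1)" using od nm 2 by simp
      then have g2: "2 \<le> gcd n (q - 1)" using mq1 by (intro dvd_imp_le) auto
      show ?thesis
        by (rule general_mono[OF mq1 _ 3, of "sigma m" 4 2]) (use 2 nm l0 g2 in \<open>auto simp: sigma_values\<close>)
    qed (use 2 nm explicit_pairs_general(2,4) in auto)
  next
    case 3
    have "\<not> 5 dvd q" using dvd_q_neq_p[of 5] 3 by simp
    moreover have "\<not> 5 dvd q - 1" using nd 3 by simp
    ultimately have "q = 7 \<or> q = 8 \<or> q = 9 \<or> q = 12 \<or> q = 13 \<or> q \<ge> 14" using mq2 3 by presburger
    then consider "q = 7" | "q = 8" | "q = 9" | "q = 13" | "q \<ge> 14" using q_neq by blast
    then show ?thesis
    proof cases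
      case 5
      then show ?thesis by (rule G) (use 3 in \<open>auto simp: sigma_values\<close>)
    qed (use 3 nm l0 explicit_pairs_general(3) general_pairs(2,3,9) in auto)
  next
    case 4
    have "\<not> 2 dvd q" "\<not> 3 dvd q" using dvd_q_neq_p[of 2] dvd_q_neq_p[of 3] 4 by simp_all
    moreover have "\<not> 6 dvd q - 1" using nd 4 by simp
    ultimately have "q = 11 \<or> q \<ge> 17" using mq2 4 by presburger
    then show ?thesis
    proof
      assume "q \<ge> 17"
      then show ?thesis by (rule G) (use 4 in \<open>auto simp: sigma_values\<close>)
    qed (use 4 nm explicit_pairs_general(5) in auto)
  next
    case 5
    have "q = 9 \<or> q = 10 \<or> q = 11 \<or> q \<ge> 12" using mq2 5 by linarith
    then consider "q = 9" | "q = 11" | "q \<ge> 12" using q_neq by blast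
    then show ?thesis
    proof cases
      case 3
      then show ?thesis by (rule G) (use 5 in \<open>auto simp: sigma_values\<close>)
    qed (use 5 nm l0 general_pairs(4,6) in auto)
  next
    case 6
    have "q = 10 \<or> q = 11 \<or> q = 12 \<or> q \<ge> 13" using mq2 6 by linarith
    then consider "q = 11" | "q \<ge> 13" using q_neq by blast
    then show ?thesis
    proof cases
      case 2
      then show ?thesis by (rule G) (use 6 in \<open>auto simp: sigma_values\<close>)
    qed (use 6 nm l0 general_pairs(7) in auto)
  next
    case 7
    have "q = 11 \<or> q \<ge> 12" using mq2 7 by linarith
    then show ?thesis
    proof
      assume "q \<ge> 12"
      then show ?thesis by (rule G) (use 7 in \<open>auto simp: sigma_values\<close>)
    qed (use 7 nm l0 general_pairs(8) in auto)
  next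
    case 8
    have "q \<ge> 13" using mq2 8 q_neq by linarith
    then show ?thesis by (rule G) (use 8 in \<open>auto simp: sigma_values\<close>)
  next
    case 9
    have "q \<ge> 13" using mq2 9 by linarith
    then show ?thesis by (rule G) (use 9 in \<open>auto simp: sigma_values\<close>)
  next
    case 10
    have "q \<ge> 14" using mq2 10 by linarith
    then show ?thesis by (rule G) (use 10 in \<open>auto simp: sigma_values\<close>)
  next
    case 11
    show ?thesis
    proof (rule G[OF mq2])
      have "2 * sigma m \<le> m * (m + 1)" using sigma_le[of m] by linarith
      also have "\<dots> \<le> (m + 2) * (m + 2)" by (intro mult_le_mono) auto
      finally have "(2 * sigma m) ^ 4 \<le> ((m + 2) * (m + 2)) ^ 4" by (rule power_mono) simp
      then have "16 * sigma m ^ 4 \<le> (m + 2) ^ 8"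
        by (simp only: power_mult_distrib power_add[symmetric]) simp
      \<comment> \<open>The constant 35 is 559/16 rounded up; the factor 16 comes from the 2 in the
        bound for \<open>sigma m\<close>.\<close>
      then have "559 * sigma m ^ 4 \<le> 35 * (m + 2) ^ 8" by linarith
      also have "\<dots> \<le> (m + 2) ^ 2 * (m + 2) ^ 8"
      proof (intro mult_right_mono)
        have "15 ^ 2 \<le> (m + 2) ^ 2" using 11 by (intro power_mono) auto
        then show "35 \<le> (m + 2) ^ 2" by simp
      qed simp
      also have "\<dots> = (m + 2) ^ 10" by (simp flip: power_add)
      also have "\<dots> \<le> (m + 2) ^ (m - 3)" using 11 by (intro power_increasing) auto
      finally show "559 * sigma m ^ 4 \<le> (m + 2 - 1 - m) ^ 4 * (m + 2) ^ (m - 3)" by simp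
    qed simp
  qed
qed

text \<open>As l + 1 <= p^l, the estimate can be phrased with p^l alone. Raising p^l by one
  multiplies the left side by at most 16 and the right side by a^m >= 16, so a check at a lower
  bound t covers all larger values.\<close>

lemma general_t:
  assumes "m < q - 1" "a \<le> q" "1 \<le> a" "1 \<le> t" "t \<le> p ^ l" "3 \<le> t * m" "16 \<le> a ^ m"
    and bound: "559 * (sigma m * t) ^ 4 \<le> (a - 1 - m) ^ 4 * a ^ (t * m - 3)"
  shows pcn_exists
proof (rule general_mono[OF assms(1) _ assms(2), of "sigma m * p ^ l" n 1])
  show "(l + 1) * sigma m \<le> sigma m * p ^ l" using l_le_power by (simp only: mult.commute mult_le_mono)
  obtain k where k: "p ^ l = t + k" using assms(5) le_Suc_ex by blast
  have "t * m \<le> n" using assms(5) nlm by simp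
  then show "3 \<le> n" using assms(6) by linarith
  have "559 * sigma m ^ 4 * (t + k) ^ 4 \<le> (a - 1 - m) ^ 4 * a ^ (t * m - 3) * (a ^ m) ^ k"
    by (rule quartic_le_exponential) (use assms bound in \<open>auto simp: power_mult_distrib mult.assoc\<close>)
  also have "\<dots> = (a - 1 - m) ^ 4 * (a ^ (t * m - 3) * a ^ (m * k))" by (simp only: power_mult mult.assoc)
  also have "a ^ (t * m - 3) * a ^ (m * k) = a ^ (n - 3)"
  proof -
    have "t * m - 3 + m * k = n - 3" using assms(6) by (simp add: nlm k algebra_simps)
    then show ?thesis by (simp flip: power_add)
  qed
  finally show "559 * (sigma m * p ^ l) ^ 4 \<le> (a - 1 - m) ^ 4 * a ^ (n - 3) * 1"
    by (simp add: k power_mult_distrib mult.assoc)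
  have "gcd n (q - 1) > 0" using n by simp
  then show "1 \<le> gcd n (q - 1)" by linarith
qed (use assms in auto)

text \<open>As p does not divide m, p^l is at least 3 for m = 4 and at least 5 for m = 6, which
  makes up for the small exponents.\<close>

lemma pcn_exists_general_l_pos:
  assumes nd: "\<not> m dvd q - 1" and m3: "m \<ge> 3" and l0: "l \<noteq> 0"
  shows pcn_exists
proof -
  have "q - 1 \<noteq> m" using nd by auto
  then have mq1: "m < q - 1" using mq by linarith
  then have mq2: "q \<ge> m + 2" by linarith
  have "p ^ l \<noteq> 1" using l0 p_ge_2 by simp
  then have T: "p ^ l = 2 \<and> p = 2 \<and> l = 1 \<or> p ^ l = 3 \<and> p = 3 \<or> p ^ l = 4 \<and> p = 2 \<or> p ^ l \<ge> 5"
    using power_cases by blast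
  consider "m = 3" | "m = 4" | "m = 5" | "m = 6" | "m \<ge> 7" using m3 by linarith
  then show ?thesis
  proof cases
    case 1
    have "p \<noteq> 3" using cop 1 by auto
    moreover have q8: "q = 8 \<or> q \<ge> 16" if "p = 2"
      using q_power_of_2[OF that] mq2 1 nd by auto
    ultimately consider "p ^ l = 2" "l = 1" "q = 8" | "p ^ l = 2" "q \<ge> 16" | "p ^ l = 4" "q \<ge> 8" | "p ^ l \<ge> 5"
      using T by fastforce
    then show ?thesis
    proof cases
      case 1
      then show ?thesis using general_pairs(12) nlm \<open>m = 3\<close> by simp
    next
      case 2
      then show ?thesis by (intro general_t[OF mq1, of 16 2]) (use 1 in \<open>auto simp: sigma_values\<close>)
    next
      case 3
      then show ?thesis by (intro general_t[OF mq1, of 8 4]) (use 1 in \<open>auto simp: sigma_values\<close>)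
    next
      case 4
      then show ?thesis by (intro general_t[OF mq1, of 5 5]) (use 1 mq2 in \<open>auto simp: sigma_values\<close>)
    qed
  next
    case 2
    have "odd q" using dvd_q_neq_p[of 2] 2 by simp
    then have q7: "q \<ge> 7" using mq2 2 by presburger
    have "p \<noteq> 2" using \<open>odd q\<close> p_dvd_q by auto
    then have "p ^ l \<ge> 3" using T by auto
    then show ?thesis by (intro general_t[OF mq1 q7, of 3]) (use 2 in \<open>auto simp: sigma_values\<close>)
  next
    case 3
    consider "p = 2" | "p ^ l \<ge> 3" using T by fastforce
    then show ?thesis
    proof cases
      case 1
      then have q8: "q \<ge> 8" using q_power_of_2 mq2 3 by fastforce
      have "p ^ l \<ge> 2" using T by auto
      then show ?thesis by (intro general_t[OF mq1 q8, of 2]) (use 3 in \<open>auto simp: sigma_values\<close>)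
    next
      case 2
      show ?thesis by (rule general_t[OF mq1 _ _ _ 2, of 7]) (use 3 mq2 in \<open>auto simp: sigma_values\<close>)
    qed
  next
    case 4
    have "p \<noteq> 2" "p \<noteq> 3" using dvd_q_neq_p[of 2] dvd_q_neq_p[of 3] p_dvd_q 4 by auto
    then have "p ^ l \<ge> 5" using T by auto
    then show ?thesis by (intro general_t[OF mq1, of 8 5]) (use 4 mq2 in \<open>auto simp: sigma_values\<close>)
  next
    case 5
    have t2: "2 \<le> p ^ l" using T by auto
    show ?thesis
    proof (rule general_t[OF mq1 mq2 _ _ t2])
      have "9 ^ 2 \<le> (m + 2) ^ 2" using 5 by (intro power_mono) auto
      also have "\<dots> \<le> (m + 2) ^ m" using 5 by (intro power_increasing) auto
      finally show "16 \<le> (m + 2) ^ m" by simp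
      \<comment> \<open>With t = 2 and a = m + 2 the fourth power is 1 again. The left side is at
        most 559 (m+2)^8, and 559 < 9^3 turns this into (m+2)^11, where 11 <= 2m - 3.\<close>
      have "sigma m * 2 \<le> m * (m + 1)" using sigma_le[of m] by linarith
      also have "\<dots> \<le> (m + 2) * (m + 2)" by (intro mult_le_mono) auto
      finally have "(sigma m * 2) ^ 4 \<le> ((m + 2) * (m + 2)) ^ 4" by (rule power_mono) simp
      also have "\<dots> = (m + 2) ^ 8" by (simp only: power_mult_distrib power_add[symmetric]) simp
      finally have "559 * (sigma m * 2) ^ 4 \<le> 559 * (m + 2) ^ 8" by (rule mult_left_mono) simp
      also have "\<dots> \<le> (m + 2) ^ 3 * (m + 2) ^ 8"
      proof (intro mult_right_mono)
        have "9 ^ 3 \<le> (m + 2) ^ 3" using 5 by (intro power_mono) auto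
        then show "559 \<le> (m + 2) ^ 3" by simp
      qed simp
      also have "\<dots> = (m + 2) ^ 11" by (simp flip: power_add)
      also have "\<dots> \<le> (m + 2) ^ (2 * m - 3)" using 5 by (intro power_increasing) auto
      finally show "559 * (sigma m * 2) ^ 4 \<le> (m + 2 - 1 - m) ^ 4 * (m + 2) ^ (2 * m - 3)" by simp
    qed (use 5 in auto)
  qed
qed

lemma pcn_exists_always: pcn_exists
proof -
  consider "n = 1" | "m = 1" "n \<noteq> 1" | "m = 2" | "m \<ge> 3" using m by linarith
  then show ?thesis
  proof cases
    case 4
    then show ?thesis using pcn_exists_regular pcn_exists_general_l0 pcn_exists_general_l_pos by blast
  qed (use degree_1 pcn_exists_m_1 pcn_exists_m_2 in auto)
qed

end

theorem theorem1p4: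
  fixes R :: "('a, 'b) ring_scheme" and p e q l m n :: nat
  assumes "Factorial_Ring.prime p" and "e \<ge> 1" and "q = p ^ e"
    and "m \<ge> 1" and "coprime m p" and "n = p ^ l * m" and "m < q"
    and "field R" and "card (carrier R) = q ^ n"
  shows "\<exists>x \<in> carrier R. primitive_element R x \<and> completely_normal R q n x"
proof -
  interpret field R by fact
  have q0: "q > 0" using assms(1,3) prime_gt_0_nat by simp
  have n0: "n \<ge> 1" using assms(1,4,6) prime_gt_0_nat by (simp add: Suc_le_eq)
  have fin: "finite (carrier R)" using assms(9) q0 by (intro card_ge_0_finite) simp
  obtain g where g: "g \<in> carrier R" "g \<noteq> \<zero>\<^bsub>R\<^esub>"
    "carrier R - {\<zero>\<^bsub>R\<^esub>} = {g [^]\<^bsub>R\<^esub> i | i::nat. i \<in> UNIV}"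
    using finite_field_mult_group_has_gen[OF fin] by auto
  interpret primitive_cn_setting R g p e q n l m
    by unfold_locales (use assms fin g n0 in auto)
  show ?thesis by (rule pcn_exists_always)
qed

end
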